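(* There is a randomized catalytic algorithm that, given oracle access to a simple directed graph $G$ with $n$ vertices and $m\ge n$ edges together with vertices $s,t$, decides whether there exists a directed path from $s$ to $t$. The algorithm always restores the catalytic tape regardless of its random coins; if there is no $s\to t$ path it always answers no, and if there is an $s\to t$ path it answers yes with probability at least $1/2$. It uses $O(\log n)$ workspace and $\widetilde{O}(n)$ catalytic space, and runs in time $\widetilde{O}(nm)$.
   Context: Catalytic (RAM) model: the algorithm has read-only access to the input, read-write access to a small work tape, read-write access to a catalytic tape that starts in an arbitrary configuration $\tau$, and a write-only output tape; it may read or write any specified bit of the catalytic tape in constant time after writing the bit's index to a query tape. For every input and every initial $\tau$, the algorithm must halt within the stated time with the catalytic tape restored exactly to $\tau$. A randomized catalytic algorithm additionally has access to random coins. Oracle access to a graph: the vertex set is $[n]=\{0,\dots,n-1\}$ and for any vertex $v$ one can query its in-degree, its out-degree, its $i$-th in-neighbor and its $i$-th out-neighbor (or $\perp$ if it does not exist). $\widetilde{O}(\cdot)$ hides polylogarithmic factors. *)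

theory Defs
  imports "HOL-Probability.Probability" "Graph_Theory.Pair_Digraph"
begin

text \<open>
  Vertex sets are \<open>{0..<vertices I}\<close>; \<open>in_nbs I v ! i\<close> and \<open>out_nbs I v ! i\<close> are the \<open>i\<close>-th
  in- and out-neighbour of \<open>v\<close>, counted from 0. The order of the neighbours is part of the input
  and is not under the control of the algorithm.
\<close>

record st_input =
  vertices :: nat
  source :: nat
  target :: nat
  in_nbs :: "nat \<Rightarrow> nat list"
  out_nbs :: "nat \<Rightarrow> nat list"

definition represents :: "st_input \<Rightarrow> nat pair_pre_digraph \<Rightarrow> nat \<Rightarrow> nat \<Rightarrow> bool" where
  "represents I G s t \<longleftrightarrow>
     pverts G = {0..<vertices I} \<and> source I = s \<and> target I = t \<and>
     (\<forall>v\<in>pverts G.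
        distinct (in_nbs I v) \<and> set (in_nbs I v) = {u. (u, v) \<in> parcs G} \<and>
        distinct (out_nbs I v) \<and> set (out_nbs I v) = {w. (v, w) \<in> parcs G})"

datatype request =
  Num_Vertices | Source | Target | In_Degree | Out_Degree | In_Neighbour | Out_Neighbour

text \<open>\<open>None\<close> stands for \<open>\<bottom>\<close>.\<close>

fun respond :: "st_input \<Rightarrow> request \<Rightarrow> nat \<Rightarrow> nat \<Rightarrow> nat option" where
  "respond I Num_Vertices v i = Some (vertices I)"
| "respond I Source v i = Some (source I)"
| "respond I Target v i = Some (target I)"
| "respond I In_Degree v i = (if v < vertices I then Some (length (in_nbs I v)) else None)"
| "respond I Out_Degree v i = (if v < vertices I then Some (length (out_nbs I v)) else None)"
| "respond I In_Neighbour v i =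
     (if v < vertices I \<and> i < length (in_nbs I v) then Some (in_nbs I v ! i) else None)"
| "respond I Out_Neighbour v i =
     (if v < vertices I \<and> i < length (out_nbs I v) then Some (out_nbs I v ! i) else None)"

text \<open>Numbers on query and answer tapes are in binary, least significant bit first.\<close>

abbreviation number_of_bits :: "bool list \<Rightarrow> nat" where
  "number_of_bits bs \<equiv> horner_sum of_bool 2 bs"

fun bits_of_number :: "nat \<Rightarrow> bool list" where
  "bits_of_number k = (if k = 0 then [] else odd k # bits_of_number (k div 2))"

declare bits_of_number.simps [simp del]

text \<open>
  A machine has a finite control, a work tape over a finite alphabet, two query tapes, an answer
  tape, a catalytic tape of bits, an output tape and a one-way tape of random coins. In each step
  the control state and the scanned work symbol select one instruction; the \<open>nat\<close> arguments below
  are successor states, except for the first argument of \<open>Write\<close>, which is a work symbol.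

  \<^item> The query tapes are write-only and are erased when a query is made. The first one holds
    the index of a catalytic cell or a vertex, the second one the \<open>i\<close> of an \<open>i\<close>-th neighbour.
  \<^item> The input is read only through \<open>Ask\<close>, which puts the answer on the answer tape and enters the
    first successor state, or enters the second one if the answer is \<open>\<bottom>\<close>.
  \<^item> \<open>Read_Answer\<close> consumes one bit of the answer; its successors are for the bit 0, the bit 1 and
    the end of the answer. The successors of \<open>Read_Cell\<close> and \<open>Coin\<close> are for 0 and for 1.
\<close>

datatype move = Left | Stay | Right

datatype instruction =
  Halt
| Write nat move nat
| Push_Query1 bool nat
| Push_Query2 bool nat
| Ask request nat nat
| Read_Answer nat nat nat
| Read_Cell nat nat
| Write_Cell bool nat
| Coin nat nat
| Output bool nat

fun successors :: "instruction \<Rightarrow> nat set" where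
  "successors Halt = {}"
| "successors (Write a d q) = {q}"
| "successors (Push_Query1 b q) = {q}"
| "successors (Push_Query2 b q) = {q}"
| "successors (Ask r q q') = {q, q'}"
| "successors (Read_Answer q0 q1 q2) = {q0, q1, q2}"
| "successors (Read_Cell q0 q1) = {q0, q1}"
| "successors (Write_Cell b q) = {q}"
| "successors (Coin q0 q1) = {q0, q1}"
| "successors (Output b q) = {q}"

record machine =
  states :: nat
  symbols :: nat
  delta :: "nat \<Rightarrow> nat \<Rightarrow> instruction"

text \<open>States are the numbers below \<open>states M\<close>, with initial state 0; work symbols are the numbers
  below \<open>symbols M\<close>, with blank symbol 0.\<close>

definition catalytic_machine :: "machine \<Rightarrow> bool" where
  "catalytic_machine M \<longleftrightarrow>
     0 < states M \<and> 0 < symbols M \<and>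
     (\<forall>q<states M. \<forall>a<symbols M.
        successors (delta M q a) \<subseteq> {..<states M} \<and>
        (\<forall>b d q'. delta M q a = Write b d q' \<longrightarrow> b < symbols M))"

record config =
  control :: nat
  work :: "nat \<Rightarrow> nat"
  pos :: nat
  query1 :: "bool list"
  query2 :: "bool list"
  answer :: "bool list"
  cat :: "nat \<Rightarrow> bool"
  coins :: "bool stream"
  out :: "bool list"

definition initial :: "(nat \<Rightarrow> bool) \<Rightarrow> bool stream \<Rightarrow> config" where
  "initial \<tau> \<omega> = \<lparr>control = 0, work = (\<lambda>_. 0), pos = 0, query1 = [], query2 = [], answer = [],
     cat = \<tau>, coins = \<omega>, out = []\<rparr>"

fun shift :: "move \<Rightarrow> nat \<Rightarrow> nat" where
  "shift Left p = p - 1"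
| "shift Stay p = p"
| "shift Right p = p + 1"

definition current :: "machine \<Rightarrow> config \<Rightarrow> instruction" where
  "current M c = delta M (control c) (work c (pos c))"

fun exec :: "st_input \<Rightarrow> instruction \<Rightarrow> config \<Rightarrow> config" where
  "exec I Halt c = c"
| "exec I (Write a d q) c =
     c\<lparr>control := q, work := (work c)(pos c := a), pos := shift d (pos c)\<rparr>"
| "exec I (Push_Query1 b q) c = c\<lparr>control := q, query1 := query1 c @ [b]\<rparr>"
| "exec I (Push_Query2 b q) c = c\<lparr>control := q, query2 := query2 c @ [b]\<rparr>"
| "exec I (Ask r q q') c =
     (case respond I r (number_of_bits (query1 c)) (number_of_bits (query2 c)) of
        Some k \<Rightarrow> c\<lparr>control := q, answer := bits_of_number k, query1 := [], query2 := []\<rparr>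
      | None \<Rightarrow> c\<lparr>control := q', answer := [], query1 := [], query2 := []\<rparr>)"
| "exec I (Read_Answer q0 q1 q2) c =
     (case answer c of
        [] \<Rightarrow> c\<lparr>control := q2\<rparr>
      | b # bs \<Rightarrow> c\<lparr>control := (if b then q1 else q0), answer := bs\<rparr>)"
| "exec I (Read_Cell q0 q1) c =
     c\<lparr>control := (if cat c (number_of_bits (query1 c)) then q1 else q0), query1 := []\<rparr>"
| "exec I (Write_Cell b q) c =
     c\<lparr>control := q, cat := (cat c)(number_of_bits (query1 c) := b), query1 := []\<rparr>"
| "exec I (Coin q0 q1) c =
     c\<lparr>control := (if shd (coins c) then q1 else q0), coins := stl (coins c)\<rparr>"
| "exec I (Output b q) c = c\<lparr>control := q, out := out c @ [b]\<rparr>"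

definition run :: "machine \<Rightarrow> st_input \<Rightarrow> (nat \<Rightarrow> bool) \<Rightarrow> bool stream \<Rightarrow> nat \<Rightarrow> config" where
  "run M I \<tau> \<omega> j = ((\<lambda>c. exec I (current M c) c) ^^ j) (initial \<tau> \<omega>)"

text \<open>A halted configuration is a fixed point of \<^const>\<open>exec\<close>, so this says that the machine halts
  after at most \<open>T\<close> steps.\<close>

definition halts_within ::
    "machine \<Rightarrow> st_input \<Rightarrow> (nat \<Rightarrow> bool) \<Rightarrow> bool stream \<Rightarrow> real \<Rightarrow> bool" where
  "halts_within M I \<tau> \<omega> T \<longleftrightarrow> (\<exists>j. real j \<le> T \<and> current M (run M I \<tau> \<omega> j) = Halt)"

definition halts_with ::
    "machine \<Rightarrow> st_input \<Rightarrow> (nat \<Rightarrow> bool) \<Rightarrow> bool stream \<Rightarrow> config \<Rightarrow> bool" where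
  "halts_with M I \<tau> \<omega> c \<longleftrightarrow> (\<exists>j. run M I \<tau> \<omega> j = c \<and> current M c = Halt)"

definition restores :: "machine \<Rightarrow> st_input \<Rightarrow> (nat \<Rightarrow> bool) \<Rightarrow> bool stream \<Rightarrow> bool" where
  "restores M I \<tau> \<omega> \<longleftrightarrow> (\<exists>c. halts_with M I \<tau> \<omega> c \<and> cat c = \<tau>)"

definition answers :: "machine \<Rightarrow> st_input \<Rightarrow> (nat \<Rightarrow> bool) \<Rightarrow> bool stream \<Rightarrow> bool \<Rightarrow> bool" where
  "answers M I \<tau> \<omega> b \<longleftrightarrow> (\<exists>c. halts_with M I \<tau> \<omega> c \<and> out c = [b])"

text \<open>Workspace is charged for the work tape, up to the scanned cell, and for the query tapes.\<close>

definition workspace_within ::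
    "machine \<Rightarrow> st_input \<Rightarrow> (nat \<Rightarrow> bool) \<Rightarrow> bool stream \<Rightarrow> real \<Rightarrow> bool" where
  "workspace_within M I \<tau> \<omega> W \<longleftrightarrow>
     (\<forall>j. let c = run M I \<tau> \<omega> j in
        real (pos c + 1 + length (query1 c) + length (query2 c)) \<le> W)"

text \<open>
  The catalytic tape is modelled as infinite, and the catalytic space is the length of the
  initial segment that contains all cells that are ever read or written. A machine can thus not
  extract information from the length of the tape.
\<close>

definition accesses_cell :: "machine \<Rightarrow> config \<Rightarrow> nat \<Rightarrow> bool" where
  "accesses_cell M c a \<longleftrightarrow> a = number_of_bits (query1 c) \<and>
     ((\<exists>q0 q1. current M c = Read_Cell q0 q1) \<or> (\<exists>b q. current M c = Write_Cell b q))"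

definition catalytic_space_within ::
    "machine \<Rightarrow> st_input \<Rightarrow> (nat \<Rightarrow> bool) \<Rightarrow> bool stream \<Rightarrow> real \<Rightarrow> bool" where
  "catalytic_space_within M I \<tau> \<omega> S \<longleftrightarrow>
     (\<forall>j a. accesses_cell M (run M I \<tau> \<omega> j) a \<longrightarrow> real (a + 1) \<le> S)"

definition coin_space :: "bool stream measure" where
  "coin_space = stream_space (measure_pmf (bernoulli_pmf (1/2)))"

end

theory Submission
  imports Defs
begin

text \<open>
  Each vertex \<open>v\<close> owns a register \<open>X v\<close> of \<open>L = O(log n)\<close> catalytic bits, read as a residue modulo
  some \<open>q < 2 ^ L\<close>. The operation \<open>X v := X v + (\<Sum>u\<leftarrow>in v. X u)\<close> is invertible, because there are no
  loops. Let \<open>F\<close> be the linear map that performs it \<open>n\<close> times for \<open>v = 0, \<dots>, n - 1\<close>. The machine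
  computes \<open>F\<close>, notes \<open>X t\<close>, inverts \<open>F\<close>, increments \<open>X s\<close>, and repeats this; the two values of
  \<open>X t\<close> differ iff \<open>q\<close> does not divide the entry \<open>N\<close> of the non-negative matrix of \<open>F\<close> at \<open>(t, s)\<close>.
  This entry is positive iff \<open>t\<close> is reachable from \<open>s\<close>, and at most \<open>n ^ (n * n)\<close>.

  The modulus is \<open>q = 2 ^ L - 1 - \<delta>\<close> for a random \<open>\<delta> < \<Delta> = 4 ^ b\<close>, where \<open>b\<close> is the bit length of \<open>n\<close>
  and \<open>L = 8 * b\<close>. Every common multiple of the candidates for \<open>q\<close> is divisible by
  \<open>m * (2 ^ L - 1 choose m)\<close> for \<open>m = 2 ^ L - \<Delta>\<close>, and the product of \<open>N\<close> and the candidates that do not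
  divide \<open>N\<close> is such a multiple. Comparing sizes, at least half of the candidates do not divide \<open>N\<close>.

  A register that starts with one of the \<open>\<Delta>\<close> largest values is not a residue modulo \<open>q\<close>. Adding
  \<open>a = i * \<Delta>\<close> modulo \<open>2 ^ L\<close> to all registers repairs this for some \<open>i \<le> n\<close>, since each register is an
  obstacle for at most one \<open>i\<close>; the machine searches for \<open>i\<close> without changing the tape.
\<close>

section \<open>Programs and their compilation\<close>

text \<open>The modulus keeps registers short: over the integers an entry of \<open>F\<close> may
  have about \<open>n * n * log n\<close> bits, and modulo the fixed number \<open>2 ^ L\<close> a
  positive entry might vanish. A random prime would serve, but a random integer from an interval
  avoids testing for primality. Such moduli share factors, which is why they are counted through
  common multiples and not through products. Placing the interval directly below
  \<open>2 ^ L\<close> makes nearly every bit pattern a residue, so that only the few top values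
  call for a shift. Updates work in place and may read neighbours that were updated in the same
  round. This changes which walks are counted, but a round still crosses every edge, and the inverse
  merely visits the vertices in the opposite order. The error is one-sided because
  \<open>N = 0\<close> is divisible by every modulus, while restoration succeeds for every modulus.
  With \<open>L = 8 * b\<close>, the number \<open>2 ^ L\<close> exceeds \<open>\<Delta>\<close> by
  \<open>6 * b\<close> bits. This margin serves the count of non-divisors, the \<open>n + 1\<close>
  shifts and the cell addresses.\<close>

datatype alu = Clear | Unit | Move | Plus | Minus | Compare | Test | Meet

fun alu_val :: "nat \<Rightarrow> alu \<Rightarrow> nat \<Rightarrow> nat \<Rightarrow> nat" where
  "alu_val L Clear a b = 0"
| "alu_val L Unit a b = 1"
| "alu_val L Plus a b = (a + b) mod 2 ^ L"
| "alu_val L Minus a b = (a + 2 ^ L - b) mod 2 ^ L"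
| "alu_val L _ a b = a"

fun alu_flag :: "nat \<Rightarrow> alu \<Rightarrow> nat \<Rightarrow> nat \<Rightarrow> bool" where
  "alu_flag L Plus a b \<longleftrightarrow> 2 ^ L \<le> a + b"
| "alu_flag L Minus a b \<longleftrightarrow> a < b"
| "alu_flag L Compare a b \<longleftrightarrow> a < b"
| "alu_flag L Test a b \<longleftrightarrow> a \<noteq> 0"
| "alu_flag L Meet a b \<longleftrightarrow> (\<exists>i<L. bit a i \<and> bit b i)"
| "alu_flag L _ a b \<longleftrightarrow> False"

fun alu_bit :: "alu \<Rightarrow> bool \<Rightarrow> bool \<Rightarrow> bool \<Rightarrow> bool" where
  "alu_bit Clear c x y = False"
| "alu_bit Unit c x y = c"
| "alu_bit Plus c x y = ((x \<noteq> y) \<noteq> c)"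
| "alu_bit Minus c x y = ((x \<noteq> y) \<noteq> c)"
| "alu_bit _ c x y = x"

fun alu_carry :: "alu \<Rightarrow> bool \<Rightarrow> bool \<Rightarrow> bool \<Rightarrow> bool" where
  "alu_carry Plus c x y = (x \<and> y \<or> c \<and> (x \<or> y))"
| "alu_carry Minus c x y = (\<not> x \<and> y \<or> c \<and> (x = y))"
| "alu_carry Compare c x y = (\<not> x \<and> y \<or> c \<and> (x = y))"
| "alu_carry Test c x y = (c \<or> x)"
| "alu_carry Meet c x y = (c \<or> x \<and> y)"
| "alu_carry _ c x y = False"

text \<open>The state of a bitwise sweep before position \<open>j\<close> in closed form: a carry
  for \<open>Plus\<close>, a borrow for \<open>Minus\<close> and \<open>Compare\<close>, an
  accumulated disjunction for \<open>Test\<close> and \<open>Meet\<close>. For \<open>Unit\<close>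
  it is a one present only before bit 0, which makes the sweep write the number 1.\<close>

fun carry_in :: "alu \<Rightarrow> nat \<Rightarrow> nat \<Rightarrow> nat \<Rightarrow> bool" where
  "carry_in Unit a b j \<longleftrightarrow> j = 0"
| "carry_in Plus a b j \<longleftrightarrow> 2 ^ j \<le> take_bit j a + take_bit j b"
| "carry_in Minus a b j \<longleftrightarrow> take_bit j a < take_bit j b"
| "carry_in Compare a b j \<longleftrightarrow> take_bit j a < take_bit j b"
| "carry_in Test a b j \<longleftrightarrow> take_bit j a \<noteq> 0"
| "carry_in Meet a b j \<longleftrightarrow> (\<exists>i<j. bit a i \<and> bit b i)"
| "carry_in _ a b j \<longleftrightarrow> False"

lemma carry_in_0: "carry_in f a b 0 \<longleftrightarrow> f = Unit"
  by (cases f) auto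

lemma carry_in_Suc: "carry_in f a b (Suc j) \<longleftrightarrow> alu_carry f (carry_in f a b j) (bit a j) (bit b j)"
proof -
  have lt: "take_bit j a < 2 ^ j" "take_bit j b < 2 ^ j" by (simp_all)
  show ?thesis
  proof (cases "f = Meet")
    case True
    then show ?thesis by (auto simp: less_Suc_eq)
  next
    case False
    then show ?thesis
      using lt by (cases f; simp add: take_bit_Suc_from_most; cases "bit a j"; cases "bit b j"; simp; linarith)
  qed
qed

text \<open>A sum of two residues wraps at most once, and a wrapped result falls below each summand.
  This converts the carry of an addition into the borrow of a subtraction.\<close>

lemma sum_mod_carry:
  fixes x y p :: nat
  assumes "x < p" "y < p" "(x + y) mod p = z"
  shows "p \<le> x + y \<longleftrightarrow> z < y"
  using assms by (cases "p \<le> x + y") (auto simp: le_mod_geq)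

text \<open>Subtraction is reduced to addition: \<open>d = a + 2 ^ L - b\<close> satisfies
  \<open>d + b = a + 2 ^ L\<close>, and the carry of \<open>d + b\<close> at each position is the
  borrow of \<open>a - b\<close>.\<close>

lemma bit_alu_val:
  assumes "j < L" "a < 2 ^ L" "b < 2 ^ L"
  shows "bit (alu_val L f a b) j \<longleftrightarrow> alu_bit f (carry_in f a b j) (bit a j) (bit b j)"
proof -
  have plus: "bit (x + y) j \<longleftrightarrow> ((bit x j \<noteq> bit y j) \<noteq> (2 ^ j \<le> take_bit j x + take_bit j y))" for x y :: nat
  proof -
    have lt: "take_bit j x < 2 ^ j" "take_bit j y < 2 ^ j" by simp_all
    have "(x + y) div 2 ^ j = x div 2 ^ j + y div 2 ^ j + (take_bit j x + take_bit j y) div 2 ^ j"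
      unfolding take_bit_eq_mod by (rule div_add1_eq)
    moreover have "(take_bit j x + take_bit j y) div 2 ^ j = of_bool (2 ^ j \<le> take_bit j x + take_bit j y)"
      using lt by (cases "2 ^ j \<le> take_bit j x + take_bit j y") (auto intro!: div_nat_eqI simp del: take_bit_nat_less_exp)
    ultimately show ?thesis by (auto simp: bit_iff_odd)
  qed
  have mod: "bit (z mod 2 ^ L) j \<longleftrightarrow> bit z j" for z :: nat
    using assms(1) by (simp add: bit_take_bit_iff flip: take_bit_eq_mod)
  have minus: "bit (a + 2 ^ L - b) j \<longleftrightarrow> ((bit a j \<noteq> bit b j) \<noteq> (take_bit j a < take_bit j b))"
  proof -
    define d where "d = a + 2 ^ L - b"
    have ab: "d + b = a + 2 ^ L" using assms(3) by (simp add: d_def)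
    have t: "take_bit j d < 2 ^ j" "take_bit j b < 2 ^ j" "take_bit j a < 2 ^ j" by simp_all
    \<comment> \<open>As \<open>j < L\<close>, the number \<open>2 ^ L\<close> is an even multiple
      of \<open>2 ^ j\<close>; adding it affects neither bit \<open>j\<close> nor the bits
      below.\<close>
    obtain r where r: "2 ^ L = 2 ^ j * (2 * r :: nat)"
      using assms(1) by (metis power_add power_Suc le_Suc_ex Suc_leI mult.assoc mult.left_commute)
    have e1: "bit (a + 2 ^ L) j \<longleftrightarrow> bit a j"
      unfolding r by (simp add: bit_iff_odd)
    have "take_bit j (d + b) = take_bit j a"
      unfolding ab r by (simp add: take_bit_eq_mod)
    then have "(take_bit j d + take_bit j b) mod 2 ^ j = take_bit j a"
      by (metis take_bit_add take_bit_eq_mod)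
    then have "2 ^ j \<le> take_bit j d + take_bit j b \<longleftrightarrow> take_bit j a < take_bit j b"
      using t sum_mod_carry by blast
    then show ?thesis
      using plus[of d b] e1 ab unfolding d_def[symmetric] by auto
  qed
  show ?thesis
    using assms by (cases f) (auto simp: plus minus mod bit_Suc_0_iff)
qed

lemma carry_out:
  assumes "0 < L" "a < 2 ^ L" "b < 2 ^ L"
  shows "carry_in f a b L \<longleftrightarrow> alu_flag L f a b"
proof -
  have "take_bit L a = a" "take_bit L b = b"
    using assms by (simp_all add: take_bit_nat_eq_self)
  then show ?thesis using assms(1) by (cases f) simp_all
qed

lemma alu_val_less: "0 < L \<Longrightarrow> a < 2 ^ L \<Longrightarrow> alu_val L f a b < 2 ^ L"
  by (cases f) (use one_less_power[of "2::nat" L] in auto)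

section \<open>An imperative language over \<open>L\<close>-bit registers\<close>

text \<open>Every instruction of the following language is a constant number of sweeps over the work tape,
  whose tracks hold \<open>L\<close>-bit registers. The field \<open>clock\<close> of the store is a ghost variable: a tick
  stands for at most \<open>3 * L + 3\<close> machine steps.\<close>

datatype prim =
  Arith alu nat nat nat
| Push1 nat
| Push2 nat
| Look
| Poke
| Query request
| Fetch nat
| Flip
| Emit

datatype com =
  Skip
| Prim prim
| Seq com com  (infixr \<open>;;\<close> 55)
| Cond com com
| Loop com com

record store =
  regs :: "nat \<Rightarrow> nat"
  flag :: bool
  index1 :: "bool list"
  index2 :: "bool list"
  reply :: "bool list"
  tape :: "nat \<Rightarrow> bool"
  flips :: "bool stream"
  verdict :: "bool list"
  clock :: nat

text \<open>These side conditions feed the space bounds: pushing only onto an empty tape keeps each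
  query tape at \<open>L\<close> bits, and \<open>S\<close> bounds the catalytic space.\<close>

fun prim_ok :: "nat \<Rightarrow> prim \<Rightarrow> store \<Rightarrow> bool" where
  "prim_ok S (Push1 r) s \<longleftrightarrow> index1 s = []"
| "prim_ok S (Push2 r) s \<longleftrightarrow> index2 s = []"
| "prim_ok S Look s \<longleftrightarrow> number_of_bits (index1 s) < S"
| "prim_ok S Poke s \<longleftrightarrow> number_of_bits (index1 s) < S"
| "prim_ok S _ s \<longleftrightarrow> True"

fun prim_step :: "st_input \<Rightarrow> nat \<Rightarrow> prim \<Rightarrow> store \<Rightarrow> store" where
  "prim_step I L (Arith f d a b) s =
     s\<lparr>regs := (regs s)(d := alu_val L f (regs s a) (regs s b)),
       flag := alu_flag L f (regs s a) (regs s b)\<rparr>"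
| "prim_step I L (Push1 r) s = s\<lparr>index1 := map (bit (regs s r)) [0..<L]\<rparr>"
| "prim_step I L (Push2 r) s = s\<lparr>index2 := map (bit (regs s r)) [0..<L]\<rparr>"
| "prim_step I L Look s = s\<lparr>index1 := [], flag := tape s (number_of_bits (index1 s))\<rparr>"
| "prim_step I L Poke s =
     s\<lparr>tape := (tape s)(number_of_bits (index1 s) := flag s), index1 := []\<rparr>"
| "prim_step I L (Query q) s =
     (case respond I q (number_of_bits (index1 s)) (number_of_bits (index2 s)) of
        Some k \<Rightarrow> s\<lparr>reply := bits_of_number k, index1 := [], index2 := [], flag := True\<rparr>
      | None \<Rightarrow> s\<lparr>reply := [], index1 := [], index2 := [], flag := False\<rparr>)"
| "prim_step I L (Fetch r) s =
     s\<lparr>regs := (regs s)(r := number_of_bits (take L (reply s))), reply := drop L (reply s)\<rparr>"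
| "prim_step I L Flip s = s\<lparr>flips := stl (flips s), flag := shd (flips s)\<rparr>"
| "prim_step I L Emit s = s\<lparr>verdict := verdict s @ [flag s]\<rparr>"

definition tick :: "store \<Rightarrow> store" where
  "tick s = s\<lparr>clock := Suc (clock s)\<rparr>"

text \<open>A derivation exists only for a terminating run, so it certifies halting together with
  the tick count. The guard of a loop is itself a command, which leaves its outcome in the
  flag.\<close>

inductive big :: "st_input \<Rightarrow> nat \<Rightarrow> nat \<Rightarrow> com \<Rightarrow> store \<Rightarrow> store \<Rightarrow> bool"
  for I :: st_input and L S :: nat where
  big_Skip: "big I L S Skip s s"
| big_Prim: "prim_ok S p s \<Longrightarrow> big I L S (Prim p) s (tick (prim_step I L p s))"
| big_Seq: "big I L S c s s1 \<Longrightarrow> big I L S d s1 s2 \<Longrightarrow> big I L S (Seq c d) s s2"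
| big_Cond: "big I L S (if flag s then c else d) (tick s) s1 \<Longrightarrow> big I L S (Cond c d) s s1"
| big_Stop: "big I L S c s s1 \<Longrightarrow> \<not> flag s1 \<Longrightarrow> big I L S (Loop c d) s (tick s1)"
| big_Go: "big I L S c s s1 \<Longrightarrow> flag s1 \<Longrightarrow> big I L S d (tick s1) s2 \<Longrightarrow>
    big I L S (Loop c d) s2 s3 \<Longrightarrow> big I L S (Loop c d) s s3"

section \<open>Encoding by tracks and generation of code\<close>

definition put :: "nat \<Rightarrow> bool \<Rightarrow> nat \<Rightarrow> nat" where
  "put d c v = (if c then set_bit d v else unset_bit d v)"

lemma bit_put: "bit (put d c v) r \<longleftrightarrow> (if r = d then c else bit v r)"
  by (auto simp: put_def bit_set_bit_iff bit_unset_bit_iff possible_bit_def)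

text \<open>A work symbol is a set of tracks. Track 0 marks the cells that hold the registers, track 1
  the leftmost cell and track 2 of the leftmost cell is the flag; register \<open>r\<close> occupies track
  \<open>r\<close>.\<close>

definition alu_row :: "nat \<Rightarrow> alu \<Rightarrow> nat \<Rightarrow> nat \<Rightarrow> nat \<Rightarrow> bool \<Rightarrow> nat \<Rightarrow> instruction" where
  "alu_row p f d a b c v =
     (if bit v 1 then Write v Right (p + of_bool (f = Unit))
      else if bit v 0 then Write (put d (alu_bit f c (bit v a) (bit v b)) v) Right
        (p + of_bool (alu_carry f c (bit v a) (bit v b)))
      else Write v Left (p + 2 + of_bool c))"

definition return_row :: "nat \<Rightarrow> nat \<Rightarrow> (nat \<Rightarrow> nat) \<Rightarrow> nat \<Rightarrow> instruction" where
  "return_row p e g v = (if bit v 0 then Write v Left p else Write (g v) Stay e)"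

text \<open>A bit that must survive a head move is kept in the control state: a carry selects
  between two adjacent states, on the way out as well as on the way back. In \<open>Fetch\<close>
  the end of the answer is treated like the bit 0, which pads short answers with zeros.\<close>

fun rows :: "nat \<Rightarrow> prim \<Rightarrow> (nat \<Rightarrow> instruction) list" where
  "rows p (Arith f d a b) =
     [alu_row p f d a b False, alu_row p f d a b True,
      return_row (p + 2) (p + 4) (put 2 False), return_row (p + 3) (p + 4) (put 2 True)]"
| "rows p (Push1 r) =
     [\<lambda>v. if bit v 1 then Write v Right p
          else if bit v 0 then Push_Query1 (bit v r) (p + 1) else Write v Left (p + 2),
      \<lambda>v. Write v Right p, return_row (p + 2) (p + 3) id]"
| "rows p (Push2 r) =
     [\<lambda>v. if bit v 1 then Write v Right p
          else if bit v 0 then Push_Query2 (bit v r) (p + 1) else Write v Left (p + 2),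
      \<lambda>v. Write v Right p, return_row (p + 2) (p + 3) id]"
| "rows p Look =
     [\<lambda>v. Read_Cell (p + 1) (p + 2), \<lambda>v. Write (put 2 False v) Stay (p + 3),
      \<lambda>v. Write (put 2 True v) Stay (p + 3)]"
| "rows p Poke = [\<lambda>v. Write_Cell (bit v 2) (p + 1)]"
| "rows p (Query q) =
     [\<lambda>v. Ask q (p + 2) (p + 1), \<lambda>v. Write (put 2 False v) Stay (p + 3),
      \<lambda>v. Write (put 2 True v) Stay (p + 3)]"
| "rows p (Fetch r) =
     [\<lambda>v. if bit v 1 then Write v Right p
          else if bit v 0 then Read_Answer (p + 1) (p + 2) (p + 1) else Write v Left (p + 3),
      \<lambda>v. Write (put r False v) Right p, \<lambda>v. Write (put r True v) Right p,
      return_row (p + 3) (p + 4) id]"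
| "rows p Flip =
     [\<lambda>v. Coin (p + 1) (p + 2), \<lambda>v. Write (put 2 False v) Stay (p + 3),
      \<lambda>v. Write (put 2 True v) Stay (p + 3)]"
| "rows p Emit = [\<lambda>v. Output (bit v 2) (p + 1)]"

definition branch :: "nat \<Rightarrow> nat \<Rightarrow> nat \<Rightarrow> instruction" where
  "branch p q v = Write v Stay (if bit v 2 then p else q)"

definition jump :: "nat \<Rightarrow> nat \<Rightarrow> instruction" where
  "jump p v = Write v Stay p"

text \<open>Every piece of code leaves through the state directly behind its last row, so pieces
  compose by concatenation and all targets follow from lengths.\<close>

fun compile :: "nat \<Rightarrow> com \<Rightarrow> (nat \<Rightarrow> instruction) list" where
  "compile p Skip = []"
| "compile p (Prim x) = rows p x"
| "compile p (Seq c d) = (let cs = compile p c in cs @ compile (p + length cs) d)"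
| "compile p (Cond c d) =
     (let cs = compile (p + 1) c; ds = compile (p + length cs + 2) d
      in branch (p + 1) (p + length cs + 2) # cs @ jump (p + length cs + length ds + 2) # ds)"
| "compile p (Loop c d) =
     (let cs = compile p c; ds = compile (p + length cs + 1) d
      in cs @ branch (p + length cs + 1) (p + length cs + length ds + 2) # ds @ [jump p])"

fun prim_regs :: "prim \<Rightarrow> nat set" where
  "prim_regs (Arith f d a b) = {d, a, b}"
| "prim_regs (Push1 r) = {r}"
| "prim_regs (Push2 r) = {r}"
| "prim_regs (Fetch r) = {r}"
| "prim_regs _ = {}"

fun com_regs :: "com \<Rightarrow> nat set" where
  "com_regs Skip = {}"
| "com_regs (Prim x) = prim_regs x"
| "com_regs (Seq c d) = com_regs c \<union> com_regs d"
| "com_regs (Cond c d) = com_regs c \<union> com_regs d"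
| "com_regs (Loop c d) = com_regs c \<union> com_regs d"

section \<open>Simulation of programs by the machine\<close>

locale simulation =
  fixes M :: machine and I :: st_input and L S :: nat
  assumes L_pos: "0 < L"
begin

abbreviation step :: "config \<Rightarrow> config" where
  "step x \<equiv> exec I (current M x) x"

text \<open>The constant is made up of the scanned position, at most \<open>L + 1\<close>, and two
  query tapes of at most \<open>L\<close> bits each.\<close>

definition good :: "config \<Rightarrow> bool" where
  "good x \<longleftrightarrow> pos x + length (query1 x) + length (query2 x) \<le> 3 * L + 1 \<and>
     (\<forall>a. accesses_cell M x a \<longrightarrow> a < S)"

text \<open>The last configuration is exempt from \<open>good\<close>, so that runs compose without
  checking a joint twice; the halting one is examined separately.\<close>

definition reaches :: "nat \<Rightarrow> config \<Rightarrow> config \<Rightarrow> bool" where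
  "reaches k x y \<longleftrightarrow> (\<exists>j\<le>k. (step ^^ j) x = y \<and> (\<forall>i<j. good ((step ^^ i) x)))"

lemma reaches_refl: "reaches k x x"
  unfolding reaches_def by (rule exI[of _ 0]) simp

lemma reaches_trans [trans]:
  assumes "reaches k x y" "reaches l y z"
  shows "reaches (k + l) x z"
proof -
  obtain i where i: "i \<le> k" "(step ^^ i) x = y" "\<forall>h<i. good ((step ^^ h) x)"
    using assms(1) unfolding reaches_def by blast
  obtain j where j: "j \<le> l" "(step ^^ j) y = z" "\<forall>h<j. good ((step ^^ h) y)"
    using assms(2) unfolding reaches_def by blast
  have *: "(step ^^ (h + i)) x = (step ^^ h) y" for h
    by (simp add: funpow_add i(2))
  have "good ((step ^^ h) x)" if "h < j + i" for h
  proof (cases "h < i")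
    case True then show ?thesis using i(3) by blast
  next
    case False
    then have "good ((step ^^ (h - i)) y)" using j(3) that by auto
    then show ?thesis using *[of "h - i"] False by simp
  qed
  then show ?thesis
    unfolding reaches_def using i(1) j(1) j(2) * by (intro exI[of _ "j + i"]) auto
qed

lemma reaches_mono: "reaches k x y \<Longrightarrow> k \<le> l \<Longrightarrow> reaches l x y"
  unfolding reaches_def using le_trans by blast

lemma reaches_step: "good x \<Longrightarrow> step x = y \<Longrightarrow> reaches 1 x y"
  unfolding reaches_def by (intro exI[of _ 1]) auto

lemma reaches_Cons: "good x \<Longrightarrow> reaches k (step x) y \<Longrightarrow> reaches (Suc k) x y"
  using reaches_trans[OF reaches_step[OF _ refl]] by fastforce

lemma reaches_chain:
  assumes "\<And>j. j < n \<Longrightarrow> reaches t (X j) (X (Suc j))"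
  shows "reaches (n * t) (X 0) (X n)"
  using assms
proof (induction n)
  case 0 then show ?case by (simp add: reaches_refl)
next
  case (Suc n)
  then have "reaches (n * t) (X 0) (X n)" "reaches t (X n) (X (Suc n))" by auto
  from reaches_trans[OF this] show ?case by (simp add: add.commute)
qed

definition code :: "nat \<Rightarrow> (nat \<Rightarrow> instruction) list \<Rightarrow> bool" where
  "code p cs \<longleftrightarrow> (\<forall>i<length cs. delta M (p + i) = cs ! i)"

lemma code_Nil [simp]: "code p []"
  by (simp add: code_def)

lemma code_Cons [simp]: "code p (c # cs) \<longleftrightarrow> delta M p = c \<and> code (Suc p) cs"
  by (auto simp: code_def less_Suc_eq_0_disj)

lemma code_append [simp]: "code p (cs @ ds) \<longleftrightarrow> code p cs \<and> code (p + length cs) ds"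
  by (induction cs arbitrary: p) auto

text \<open>The cell to the right of the registers carries neither mark; by this a sweep recognises
  where to turn.\<close>

definition well_formed :: "(nat \<Rightarrow> nat) \<Rightarrow> nat \<Rightarrow> bool" where
  "well_formed w l \<longleftrightarrow> \<not> bit (w 0) 0 \<and> bit (w 0) 1 \<and> (\<forall>j<l. bit (w (Suc j)) 0 \<and> \<not> bit (w (Suc j)) 1) \<and>
     \<not> bit (w (Suc l)) 0 \<and> \<not> bit (w (Suc l)) 1"

text \<open>Tracks below 3 are reserved for the marks and the flag, hence the bound on
  \<open>r\<close>. The control state is left out, so the relation survives jumps.\<close>

definition rep :: "config \<Rightarrow> store \<Rightarrow> bool" where
  "rep x s \<longleftrightarrow> well_formed (work x) L \<and> bit (work x 0) 2 = flag s \<and>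
     (\<forall>j<L. \<forall>r\<ge>3. bit (work x (Suc j)) r = bit (regs s r) j) \<and> (\<forall>r. regs s r < 2 ^ L) \<and>
     pos x = 0 \<and> query1 x = index1 s \<and> query2 x = index2 s \<and>
     length (index1 s) \<le> L \<and> length (index2 s) \<le> L \<and>
     answer x = reply s \<and> cat x = tape s \<and> coins x = flips s \<and> out x = verdict s"

lemma good_Write:
  assumes "current M x = Write v d q" "pos x \<le> Suc L" "length (query1 x) \<le> L" "length (query2 x) \<le> L"
  shows "good x"
  using assms by (auto simp: good_def accesses_cell_def)

lemma reaches_back:
  assumes "\<And>v. bit v 0 \<Longrightarrow> delta M q v = Write v Left q"
    and "well_formed (work x) L" "j \<le> L" "length (query1 x) \<le> L" "length (query2 x) \<le> L"
  shows "reaches j (x\<lparr>control := q, pos := j\<rparr>) (x\<lparr>control := q, pos := 0\<rparr>)"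
  using assms(3)
proof (induction j)
  case 0 show ?case by (rule reaches_refl)
next
  case (Suc j)
  let ?x = "x\<lparr>control := q, pos := Suc j\<rparr>"
  have c: "current M ?x = Write (work x (Suc j)) Left q"
    using assms(1,2) Suc.prems by (simp add: current_def well_formed_def)
  have "good ?x" by (rule good_Write[OF c]) (use assms Suc.prems in auto)
  moreover have "step ?x = x\<lparr>control := q, pos := j\<rparr>" by (simp add: c)
  ultimately show ?case using Suc by (auto intro: reaches_Cons)
qed

lemma reaches_return:
  assumes "delta M q = return_row q e g" "delta M p (work x (Suc L)) = Write (work x (Suc L)) Left q"
    and "well_formed (work x) L" "length (query1 x) \<le> L" "length (query2 x) \<le> L"
  shows "reaches (L + 2) (x\<lparr>control := p, pos := Suc L\<rparr>)
    (x\<lparr>control := e, pos := 0, work := (work x)(0 := g (work x 0))\<rparr>)"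
proof -
  let ?x = "x\<lparr>control := p, pos := Suc L\<rparr>" and ?y = "x\<lparr>control := q, pos := 0\<rparr>"
  have c: "current M ?x = Write (work x (Suc L)) Left q"
    using assms by (simp add: current_def)
  have c': "current M ?y = Write (g (work x 0)) Stay e"
    using assms by (simp add: current_def return_row_def well_formed_def)
  have "reaches 1 ?x (x\<lparr>control := q, pos := L\<rparr>)"
    by (rule reaches_step, rule good_Write[OF c]) (use assms c in auto)
  also have "reaches L \<dots> ?y"
    by (rule reaches_back) (use assms in \<open>auto simp: return_row_def\<close>)
  also have "reaches 1 ?y (x\<lparr>control := e, pos := 0, work := (work x)(0 := g (work x 0))\<rparr>)"
    by (rule reaches_step, rule good_Write[OF c']) (use assms c' in auto)
  finally show ?thesis by simp
qed

text \<open>The work tape in the middle of a sweep, when \<open>j\<close> register cells have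
  received their new bit on track \<open>d\<close>.\<close>

definition fill :: "(nat \<Rightarrow> nat) \<Rightarrow> nat \<Rightarrow> (nat \<Rightarrow> bool) \<Rightarrow> nat \<Rightarrow> nat \<Rightarrow> nat" where
  "fill w d u j i = (if 0 < i \<and> i \<le> j then put d (u (i - 1)) (w i) else w i)"

lemma fill_0: "fill w d u 0 = w"
  by (auto simp: fill_def)

lemma fill_Suc: "fill w d u (Suc j) = (fill w d u j)(Suc j := put d (u j) (w (Suc j)))"
  by (auto simp: fill_def fun_eq_iff)

lemma fill_beyond: "j < i \<Longrightarrow> fill w d u j i = w i"
  by (simp add: fill_def)

lemma well_formed_fill: "well_formed w L \<Longrightarrow> 3 \<le> d \<Longrightarrow> j \<le> L \<Longrightarrow> well_formed (fill w d u j) L"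
  by (auto simp: well_formed_def fill_def bit_put)

text \<open>The sweep invariant \<open>X j\<close> holds \<open>carry_in\<close> in the control
  state. One step leaves the left end, \<open>L\<close> steps process the cells, and
  \<open>L + 2\<close> steps turn, walk back and record the flag.\<close>

lemma sim_Arith:
  assumes "rep x s" "code p (rows p (Arith f d a b))" "control x = p" "{d, a, b} \<subseteq> {3..}"
  shows "\<exists>y. reaches (2 * L + 3) x y \<and> rep y (prim_step I L (Arith f d a b) s) \<and> control y = p + 4"
proof -
  define A B where "A = regs s a" and "B = regs s b"
  define u where "u = bit (alu_val L f A B)"
  define X where "X j = x\<lparr>control := p + of_bool (carry_in f A B j), pos := Suc j,
    work := fill (work x) d u j\<rparr>" for j
  define x' where "x' = x\<lparr>work := fill (work x) d u L\<rparr>"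
  define c where "c = carry_in f A B L"
  note rep = assms(1)[unfolded rep_def]
  have AB: "A < 2 ^ L" "B < 2 ^ L" using rep by (auto simp: A_def B_def)
  have row: "delta M (p + of_bool c) = alu_row p f d a b c" for c
    using assms(2) by (cases c) simp_all
  have c0: "current M x = Write (work x 0) Right (p + of_bool (f = Unit))"
    using rep assms(3) row[of False] by (simp add: current_def alu_row_def well_formed_def)
  have "reaches 1 x (X 0)"
    by (rule reaches_step, rule good_Write[OF c0])
      (use rep c0 in \<open>auto simp: X_def carry_in_0 fill_0\<close>)
  also have "reaches (L * 1) (X 0) (X L)"
  proof (rule reaches_chain)
    fix j assume j: "j < L"
    let ?v = "work x (Suc j)"
    have v: "bit ?v 0" "\<not> bit ?v 1" "bit ?v a = bit A j" "bit ?v b = bit B j"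
      using rep j assms(4) by (auto simp: well_formed_def A_def B_def)
    have cj: "current M (X j) = Write (put d (u j) ?v) Right (p + of_bool (carry_in f A B (Suc j)))"
      using v j AB by (simp add: current_def X_def row alu_row_def fill_beyond carry_in_Suc u_def bit_alu_val)
    show "reaches 1 (X j) (X (Suc j))"
      by (rule reaches_step, rule good_Write[OF cj])
        (use rep cj j in \<open>auto simp: X_def fill_Suc\<close>)
  qed
  also have "X L = x'\<lparr>control := p + of_bool c, pos := Suc L\<rparr>"
    by (simp add: X_def x'_def c_def)
  also have "reaches (L + 2) \<dots>
      (x'\<lparr>control := p + 4, pos := 0, work := (work x')(0 := put 2 c (work x' 0))\<rparr>)" (is "reaches _ _ ?y")
  proof (rule reaches_return[where q = "p + 2 + of_bool c"])
    show "delta M (p + 2 + of_bool c) = return_row (p + 2 + of_bool c) (p + 4) (put 2 c)"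
      using assms(2) by (cases c) (simp_all add: numeral_3_eq_3)
    show "delta M (p + of_bool c) (work x' (Suc L)) = Write (work x' (Suc L)) Left (p + 2 + of_bool c)"
      using rep by (simp add: x'_def fill_beyond row alu_row_def well_formed_def)
    show "well_formed (work x') L"
      using rep assms(4) by (simp add: x'_def well_formed_fill)
  qed (use rep in \<open>auto simp: x'_def\<close>)
  finally have "reaches (2 * L + 3) x ?y" by (simp add: mult_2 eval_nat_numeral)
  moreover have "rep ?y (prim_step I L (Arith f d a b) s)"
    using rep assms(4) AB L_pos well_formed_fill[of "work x" d L u]
    by (auto simp: rep_def x'_def c_def carry_out alu_val_less A_def B_def well_formed_def bit_put fill_def u_def)
  ultimately show ?thesis by (intro exI[of _ ?y]) simp
qed

text \<open>Pushing does not move the head, so each cell costs two steps on the way out. Such sweeps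
  are the slowest ones and fix \<open>3 * L + 3\<close> as the length of a tick.\<close>

lemma sim_Push1:
  assumes "rep x s" "code p (rows p (Push1 r))" "control x = p" "3 \<le> r" "index1 s = []"
  shows "\<exists>y. reaches (3 * L + 3) x y \<and> rep y (prim_step I L (Push1 r) s) \<and> control y = p + 3"
proof -
  define u where "u = bit (regs s r)"
  define X where "X j = x\<lparr>control := p, pos := Suc j, query1 := map u [0..<j]\<rparr>" for j
  define x' where "x' = x\<lparr>query1 := map u [0..<L]\<rparr>"
  note rep = assms(1)[unfolded rep_def]
  have q1: "query1 x = []" using rep assms(5) by simp
  have c0: "current M x = Write (work x 0) Right p"
    using rep assms(2,3) by (simp add: current_def well_formed_def)
  have "reaches 1 x (X 0)"
    by (rule reaches_step, rule good_Write[OF c0]) (use rep c0 q1 in \<open>auto simp: X_def\<close>)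
  also have "reaches (L * 2) (X 0) (X L)"
  proof (rule reaches_chain)
    fix j assume j: "j < L"
    let ?v = "work x (Suc j)"
    let ?y = "(X j)\<lparr>control := p + 1, query1 := map u [0..<Suc j]\<rparr>"
    have v: "bit ?v 0" "\<not> bit ?v 1" "bit ?v r = u j"
      using rep j assms(4) by (auto simp: well_formed_def u_def)
    have cj: "current M (X j) = Push_Query1 (u j) (p + 1)"
      using v assms(2) by (simp add: current_def X_def)
    have cy: "current M ?y = Write ?v Right p"
      using assms(2) by (simp add: current_def X_def)
    have "reaches 1 (X j) ?y"
      by (rule reaches_step)
        (use rep cj j in \<open>auto simp: X_def good_def accesses_cell_def\<close>)
    also have "reaches 1 ?y (X (Suc j))"
      by (rule reaches_step, rule good_Write[OF cy]) (use rep cy j in \<open>auto simp: X_def\<close>)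
    finally show "reaches 2 (X j) (X (Suc j))" by (simp add: numeral_2_eq_2)
  qed
  also have "X L = x'\<lparr>control := p, pos := Suc L\<rparr>"
    by (simp add: X_def x'_def)
  also have "reaches (L + 2) \<dots> (x'\<lparr>control := p + 3, pos := 0, work := (work x')(0 := id (work x' 0))\<rparr>)"
      (is "reaches _ _ ?y")
    by (rule reaches_return[where q = "p + 2" and g = id])
      (use rep assms(2) in \<open>auto simp: x'_def well_formed_def\<close>)
  finally have "reaches (3 * L + 3) x ?y" by (simp add: eval_nat_numeral add.commute add.left_commute)
  moreover have "rep ?y (prim_step I L (Push1 r) s)"
    using rep by (auto simp: rep_def x'_def u_def)
  ultimately show ?thesis by (intro exI[of _ ?y]) simp
qed

lemma sim_Push2:
  assumes "rep x s" "code p (rows p (Push2 r))" "control x = p" "3 \<le> r" "index2 s = []"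
  shows "\<exists>y. reaches (3 * L + 3) x y \<and> rep y (prim_step I L (Push2 r) s) \<and> control y = p + 3"
proof -
  define u where "u = bit (regs s r)"
  define X where "X j = x\<lparr>control := p, pos := Suc j, query2 := map u [0..<j]\<rparr>" for j
  define x' where "x' = x\<lparr>query2 := map u [0..<L]\<rparr>"
  note rep = assms(1)[unfolded rep_def]
  have q1: "query2 x = []" using rep assms(5) by simp
  have c0: "current M x = Write (work x 0) Right p"
    using rep assms(2,3) by (simp add: current_def well_formed_def)
  have "reaches 1 x (X 0)"
    by (rule reaches_step, rule good_Write[OF c0]) (use rep c0 q1 in \<open>auto simp: X_def\<close>)
  also have "reaches (L * 2) (X 0) (X L)"
  proof (rule reaches_chain)
    fix j assume j: "j < L"
    let ?v = "work x (Suc j)"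
    let ?y = "(X j)\<lparr>control := p + 1, query2 := map u [0..<Suc j]\<rparr>"
    have v: "bit ?v 0" "\<not> bit ?v 1" "bit ?v r = u j"
      using rep j assms(4) by (auto simp: well_formed_def u_def)
    have cj: "current M (X j) = Push_Query2 (u j) (p + 1)"
      using v assms(2) by (simp add: current_def X_def)
    have cy: "current M ?y = Write ?v Right p"
      using assms(2) by (simp add: current_def X_def)
    have "reaches 1 (X j) ?y"
      by (rule reaches_step)
        (use rep cj j in \<open>auto simp: X_def good_def accesses_cell_def\<close>)
    also have "reaches 1 ?y (X (Suc j))"
      by (rule reaches_step, rule good_Write[OF cy]) (use rep cy j in \<open>auto simp: X_def\<close>)
    finally show "reaches 2 (X j) (X (Suc j))" by (simp add: numeral_2_eq_2)
  qed
  also have "X L = x'\<lparr>control := p, pos := Suc L\<rparr>"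
    by (simp add: X_def x'_def)
  also have "reaches (L + 2) \<dots> (x'\<lparr>control := p + 3, pos := 0, work := (work x')(0 := id (work x' 0))\<rparr>)"
      (is "reaches _ _ ?y")
    by (rule reaches_return[where q = "p + 2" and g = id])
      (use rep assms(2) in \<open>auto simp: x'_def well_formed_def\<close>)
  finally have "reaches (3 * L + 3) x ?y" by (simp add: eval_nat_numeral add.commute add.left_commute)
  moreover have "rep ?y (prim_step I L (Push2 r) s)"
    using rep by (auto simp: rep_def x'_def u_def)
  ultimately show ?thesis by (intro exI[of _ ?y]) simp
qed

lemma sim_Fetch:
  assumes "rep x s" "code p (rows p (Fetch r))" "control x = p" "3 \<le> r"
  shows "\<exists>y. reaches (3 * L + 3) x y \<and> rep y (prim_step I L (Fetch r) s) \<and> control y = p + 4"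
proof -
  define k where "k = number_of_bits (take L (reply s))"
  define u where "u = bit k"
  define X where "X j = x\<lparr>control := p, pos := Suc j, answer := drop j (reply s),
    work := fill (work x) r u j\<rparr>" for j
  define x' where "x' = x\<lparr>answer := drop L (reply s), work := fill (work x) r u L\<rparr>"
  note rep = assms(1)[unfolded rep_def]
  have u: "u j \<longleftrightarrow> j < length (reply s) \<and> reply s ! j" if "j < L" for j
    using that by (auto simp: u_def k_def bit_horner_sum_bit_iff)
  have c0: "current M x = Write (work x 0) Right p"
    using rep assms(2,3) by (simp add: current_def well_formed_def)
  have "reaches 1 x (X 0)"
    by (rule reaches_step, rule good_Write[OF c0]) (use rep c0 in \<open>auto simp: X_def fill_0\<close>)
  also have "reaches (L * 2) (X 0) (X L)"
  proof (rule reaches_chain)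
    fix j assume j: "j < L"
    let ?v = "work x (Suc j)"
    let ?y = "(X j)\<lparr>control := p + 1 + of_bool (u j), answer := drop (Suc j) (reply s)\<rparr>"
    have v: "bit ?v 0" "\<not> bit ?v 1"
      using rep j assms(4) by (auto simp: well_formed_def u_def)
    have cj: "current M (X j) = Read_Answer (p + 1) (p + 2) (p + 1)"
      using v assms(2) by (simp add: current_def X_def fill_beyond)
    have cy: "current M ?y = Write (put r (u j) ?v) Right p"
      using assms(2) by (cases "u j") (simp_all add: current_def X_def fill_beyond)
    have "reaches 1 (X j) ?y"
    proof (rule reaches_step)
      show "good (X j)" using rep cj j by (auto simp: X_def good_def accesses_cell_def)
      show "step (X j) = ?y"
      proof (cases "j < length (reply s)")
        case True
        then show ?thesis using cj u[OF j] by (simp add: X_def Cons_nth_drop_Suc[symmetric])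
      next
        case False
        then show ?thesis using cj u[OF j] by (simp add: X_def)
      qed
    qed
    also have "reaches 1 ?y (X (Suc j))"
      by (rule reaches_step, rule good_Write[OF cy]) (use rep cy j in \<open>auto simp: X_def fill_Suc\<close>)
    finally show "reaches 2 (X j) (X (Suc j))" by (simp add: numeral_2_eq_2)
  qed
  also have "X L = x'\<lparr>control := p, pos := Suc L\<rparr>"
    by (simp add: X_def x'_def)
  also have "reaches (L + 2) \<dots> (x'\<lparr>control := p + 4, pos := 0, work := (work x')(0 := id (work x' 0))\<rparr>)"
      (is "reaches _ _ ?y")
    by (rule reaches_return[where q = "p + 3" and g = id])
      (use rep assms(2,4) well_formed_fill[of "work x" r L u] in
        \<open>auto simp: x'_def well_formed_def fill_beyond numeral_3_eq_3\<close>)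
  finally have "reaches (3 * L + 3) x ?y" by (simp add: eval_nat_numeral add.commute add.left_commute)
  moreover have "rep ?y (prim_step I L (Fetch r) s)"
  proof -
    have "k < 2 ^ length (take L (reply s))" unfolding k_def by (rule horner_sum_of_bool_2_less)
    also have "\<dots> \<le> 2 ^ L" by (intro power_increasing) auto
    finally show ?thesis
      using rep assms(4) well_formed_fill[of "work x" r L u]
      by (auto simp: rep_def x'_def well_formed_def bit_put fill_def u_def k_def)
  qed
  ultimately show ?thesis by (intro exI[of _ ?y]) simp
qed

lemma rep_flag:
  assumes "rep x s" "current M x = Write (put 2 c (work x 0)) Stay e"
  shows "reaches 1 x (x\<lparr>control := e, work := (work x)(0 := put 2 c (work x 0))\<rparr>)"
    and "rep (x\<lparr>control := e, work := (work x)(0 := put 2 c (work x 0))\<rparr>) (s\<lparr>flag := c\<rparr>)"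
proof -
  note rep = assms(1)[unfolded rep_def]
  show "reaches 1 x (x\<lparr>control := e, work := (work x)(0 := put 2 c (work x 0))\<rparr>)"
    by (rule reaches_step, rule good_Write[OF assms(2)]) (use rep assms(2) in auto)
  show "rep (x\<lparr>control := e, work := (work x)(0 := put 2 c (work x 0))\<rparr>) (s\<lparr>flag := c\<rparr>)"
    using rep by (auto simp: rep_def well_formed_def bit_put)
qed

text \<open>Reading a cell, asking and tossing a coin deliver their outcome as a choice of control
  state; a second step, at the leftmost cell, turns it into the flag bit.\<close>

lemma sim_flag:
  assumes "rep y s" "good x" "step x = y" "control y = p + of_bool c"
    and "delta M p = (\<lambda>v. Write (put 2 False v) Stay e)" "delta M (Suc p) = (\<lambda>v. Write (put 2 True v) Stay e)"
  shows "\<exists>z. reaches 2 x z \<and> rep z (s\<lparr>flag := c\<rparr>) \<and> control z = e"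
proof -
  let ?z = "y\<lparr>control := e, work := (work y)(0 := put 2 c (work y 0))\<rparr>"
  have c: "current M y = Write (put 2 c (work y 0)) Stay e"
    using assms by (cases c) (auto simp: current_def rep_def)
  have "reaches 1 x y" by (rule reaches_step[OF assms(2,3)])
  also have "reaches 1 y ?z" by (rule rep_flag(1)[OF assms(1) c])
  finally have "reaches 2 x ?z" by (simp add: numeral_2_eq_2)
  then show ?thesis using rep_flag(2)[OF assms(1) c] by (intro exI[of _ ?z]) simp
qed

lemma sim_prim:
  assumes "rep x s" "code p (rows p q)" "control x = p" "prim_regs q \<subseteq> {3..}" "prim_ok S q s"
  shows "\<exists>y. reaches (3 * L + 3) x y \<and> rep y (prim_step I L q s) \<and> control y = p + length (rows p q)"
proof -
  note rep = assms(1)[unfolded rep_def]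
  have cur: "current M x = (rows p q ! 0) (work x 0)"
    using assms(2,3) rep by (cases q) (simp_all add: current_def)
  have fl: "\<exists>y. reaches (3 * L + 3) x y \<and> rep y s' \<and> control y = e"
    if "\<exists>y. reaches 2 x y \<and> rep y s' \<and> control y = e" for s' e
    using that reaches_mono[of 2 x _ "3 * L + 3"] by auto
  have one: "\<exists>y. reaches (3 * L + 3) x y \<and> rep y s' \<and> control y = e"
    if "good x" "rep (step x) s'" "control (step x) = e" for s' e
    using that reaches_mono[OF reaches_step[OF that(1) refl], of "3 * L + 3"] by auto
  show ?thesis
  proof (cases q)
    case (Arith f d a b)
    then show ?thesis
      using sim_Arith[of x s p f d a b] assms reaches_mono[of "2 * L + 3" x _ "3 * L + 3"] by fastforce
  next
    case (Push1 r)
    then show ?thesis using sim_Push1[of x s p r] assms by (simp add: eval_nat_numeral)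
  next
    case (Push2 r)
    then show ?thesis using sim_Push2[of x s p r] assms by (simp add: eval_nat_numeral)
  next
    case Look
    have "\<exists>z. reaches 2 x z \<and>
        rep z ((s\<lparr>index1 := []\<rparr>)\<lparr>flag := tape s (number_of_bits (index1 s))\<rparr>) \<and> control z = p + 3"
      by (rule sim_flag[where y = "step x" and p = "p + 1"])
        (use assms cur Look rep in \<open>auto simp: rep_def good_def accesses_cell_def\<close>)
    from fl[OF this] show ?thesis using Look by (simp add: eval_nat_numeral)
  next
    case Poke
    show ?thesis
      by (rule one) (use assms cur Poke rep in \<open>auto simp: rep_def good_def accesses_cell_def\<close>)
  next
    case (Query r)
    let ?k = "respond I r (number_of_bits (index1 s)) (number_of_bits (index2 s))"
    have "\<exists>z. reaches 2 x z \<and>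
        rep z ((s\<lparr>reply := (case ?k of None \<Rightarrow> [] | Some k \<Rightarrow> bits_of_number k),
          index1 := [], index2 := []\<rparr>)\<lparr>flag := ?k \<noteq> None\<rparr>) \<and> control z = p + 3"
      by (rule sim_flag[where y = "step x" and p = "p + 1"])
        (use assms cur Query rep in \<open>auto simp: rep_def good_def accesses_cell_def split: option.split\<close>)
    from fl[OF this] show ?thesis using Query by (cases ?k) (simp_all add: eval_nat_numeral)
  next
    case (Fetch r)
    then show ?thesis using sim_Fetch[of x s p r] assms by (simp add: eval_nat_numeral)
  next
    case Flip
    have "\<exists>z. reaches 2 x z \<and>
        rep z ((s\<lparr>flips := stl (flips s)\<rparr>)\<lparr>flag := shd (flips s)\<rparr>) \<and> control z = p + 3"
      by (rule sim_flag[where y = "step x" and p = "p + 1"])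
        (use assms cur Flip rep in \<open>auto simp: rep_def good_def accesses_cell_def\<close>)
    from fl[OF this] show ?thesis using Flip by (simp add: eval_nat_numeral)
  next
    case Emit
    show ?thesis
      by (rule one) (use assms cur Emit rep in \<open>auto simp: rep_def good_def accesses_cell_def\<close>)
  qed
qed

lemma rep_tick: "rep x (tick s) \<longleftrightarrow> rep x s"
  by (simp add: rep_def tick_def)

lemma clock_prim_step [simp]: "clock (prim_step I L q s) = clock s"
  by (cases q) (auto split: option.split)

lemma sim_jump:
  assumes "rep x s" "current M x = Write (work x 0) Stay e"
  shows "reaches 1 x (x\<lparr>control := e\<rparr>)" "rep (x\<lparr>control := e\<rparr>) s"
proof -
  note rep = assms(1)[unfolded rep_def]
  show "reaches 1 x (x\<lparr>control := e\<rparr>)"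
    by (rule reaches_step, rule good_Write[OF assms(2)]) (use rep assms(2) in auto)
  show "rep (x\<lparr>control := e\<rparr>) s" using rep by (simp add: rep_def)
qed

text \<open>The cost is stated with the clock as a potential, so that bounds telescope under
  sequencing without subtraction. The tick of a conditional or of a loop test pays for the branch
  and for the jump that may follow.\<close>

lemma sim_com:
  assumes "big I L S c s t" "rep x s" "code p (compile p c)" "control x = p" "com_regs c \<subseteq> {3..}"
  shows "\<exists>k y. k + (3 * L + 3) * clock s \<le> (3 * L + 3) * clock t \<and> reaches k x y \<and> rep y t \<and>
    control y = p + length (compile p c)"
  using assms
proof (induction arbitrary: x p rule: big.induct)
  case (big_Skip s)
  then show ?case by (intro exI[of _ 0] exI[of _ x]) (simp add: reaches_refl)
next
  case (big_Prim q s)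
  then obtain y where "reaches (3 * L + 3) x y" "rep y (prim_step I L q s)" "control y = p + length (rows p q)"
    using sim_prim[of x s p q] by auto
  then show ?case
    by (intro exI[of _ "3 * L + 3"] exI[of _ y]) (simp add: rep_tick, simp add: tick_def)
next
  case (big_Seq c s s1 d s2)
  let ?q = "p + length (compile p c)"
  have code: "code p (compile p c)" "code ?q (compile ?q d)"
    using big_Seq.prems by (simp_all add: Let_def)
  obtain k y where y: "k + (3 * L + 3) * clock s \<le> (3 * L + 3) * clock s1" "reaches k x y" "rep y s1"
    "control y = ?q"
    using big_Seq.IH(1)[of x p] big_Seq.prems code by auto
  obtain l z where z: "l + (3 * L + 3) * clock s1 \<le> (3 * L + 3) * clock s2" "reaches l y z" "rep z s2"
    "control z = ?q + length (compile ?q d)"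
    using big_Seq.IH(2)[of y ?q] big_Seq.prems code y by auto
  show ?case
    using y(1) z(1,3,4) reaches_trans[OF y(2) z(2)]
    by (intro exI[of _ "k + l"] exI[of _ z]) (simp add: Let_def)
next
  case (big_Cond s c d s1)
  let ?cs = "compile (p + 1) c"
  let ?q = "p + length ?cs + 2"
  let ?ds = "compile ?q d"
  let ?e = "?q + length ?ds"
  have code: "delta M p = branch (p + 1) ?q" "code (p + 1) ?cs" "delta M (p + length ?cs + 1) = jump ?e"
      "code ?q ?ds"
    using big_Cond.prems by (simp_all add: Let_def)
  have len: "p + length (compile p (Cond c d)) = ?e" by (simp add: Let_def)
  let ?x = "x\<lparr>control := if flag s then p + 1 else ?q\<rparr>"
  have cur: "current M x = Write (work x 0) Stay (if flag s then p + 1 else ?q)"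
    using big_Cond.prems code by (simp add: current_def rep_def branch_def)
  note x = sim_jump[OF big_Cond.prems(1) cur]
  show ?case
  proof (cases "flag s")
    case True
    then obtain k y where y: "k + (3 * L + 3) * clock (tick s) \<le> (3 * L + 3) * clock s1" "reaches k ?x y"
        "rep y s1" "control y = p + length ?cs + 1"
      using big_Cond.IH[of ?x "p + 1"] big_Cond.prems x code by (auto simp: rep_tick)
    have "current M y = Write (work y 0) Stay ?e"
      using y code by (simp add: current_def rep_def jump_def)
    note z = sim_jump[OF y(3) this]
    have "1 + k + 1 + (3 * L + 3) * clock s \<le> (3 * L + 3) * clock s1"
      using y(1) by (simp add: tick_def algebra_simps)
    then show ?thesis
      unfolding len using reaches_trans[OF reaches_trans[OF x(1) y(2)] z(1)] z(2) by fastforce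
  next
    case False
    then obtain k y where y: "k + (3 * L + 3) * clock (tick s) \<le> (3 * L + 3) * clock s1" "reaches k ?x y"
        "rep y s1" "control y = ?e"
      using big_Cond.IH[of ?x ?q] big_Cond.prems x code by (auto simp: rep_tick)
    have "1 + k + (3 * L + 3) * clock s \<le> (3 * L + 3) * clock s1"
      using y(1) by (simp add: tick_def algebra_simps)
    then show ?thesis
      unfolding len using reaches_trans[OF x(1) y(2)] y(3,4) by blast
  qed
next
  case (big_Stop c s s1 d)
  let ?cs = "compile p c"
  let ?q = "p + length ?cs + 1"
  let ?e = "?q + length (compile ?q d) + 1"
  have code: "code p ?cs" "delta M (p + length ?cs) = branch ?q ?e"
    using big_Stop.prems by (simp_all add: Let_def)
  have len: "p + length (compile p (Loop c d)) = ?e" by (simp add: Let_def)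
  obtain k y where y: "k + (3 * L + 3) * clock s \<le> (3 * L + 3) * clock s1" "reaches k x y" "rep y s1"
    "control y = p + length ?cs"
    using big_Stop.IH[of x p] big_Stop.prems code by auto
  have "current M y = Write (work y 0) Stay ?e"
    using y code big_Stop.hyps by (simp add: current_def rep_def branch_def)
  note z = sim_jump[OF y(3) this]
  have "k + 1 + (3 * L + 3) * clock s \<le> (3 * L + 3) * clock (tick s1)"
    using y(1) by (simp add: tick_def algebra_simps)
  then show ?case
    unfolding len using reaches_trans[OF y(2) z(1)] z(2) by (fastforce simp: rep_tick)
next
  case (big_Go c s s1 d s2 s3)
  let ?cs = "compile p c"
  let ?q = "p + length ?cs + 1"
  let ?ds = "compile ?q d"
  let ?e = "?q + length ?ds + 1"
  have code: "code p ?cs" "delta M (p + length ?cs) = branch ?q ?e" "code ?q ?ds"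
      "delta M (?q + length ?ds) = jump p"
    using big_Go.prems by (simp_all add: Let_def)
  obtain k y where y: "k + (3 * L + 3) * clock s \<le> (3 * L + 3) * clock s1" "reaches k x y" "rep y s1"
    "control y = p + length ?cs"
    using big_Go.IH(1)[of x p] big_Go.prems code by auto
  have "current M y = Write (work y 0) Stay ?q"
    using y code big_Go.hyps by (simp add: current_def rep_def branch_def)
  note z = sim_jump[OF y(3) this]
  obtain l v where v: "l + (3 * L + 3) * clock (tick s1) \<le> (3 * L + 3) * clock s2"
    "reaches l (y\<lparr>control := ?q\<rparr>) v" "rep v s2" "control v = ?q + length ?ds"
    using big_Go.IH(2)[of "y\<lparr>control := ?q\<rparr>" ?q] big_Go.prems code z by (auto simp: rep_tick)
  have "current M v = Write (work v 0) Stay p"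
    using v code by (simp add: current_def rep_def jump_def)
  note w = sim_jump[OF v(3) this]
  obtain h u where u: "h + (3 * L + 3) * clock s2 \<le> (3 * L + 3) * clock s3"
    "reaches h (v\<lparr>control := p\<rparr>) u" "rep u s3" "control u = p + length (compile p (Loop c d))"
    using big_Go.IH(3)[of "v\<lparr>control := p\<rparr>" p] big_Go.prems w by auto
  have "k + 1 + l + 1 + h + (3 * L + 3) * clock s \<le> (3 * L + 3) * clock s3"
    using y(1) v(1) u(1) by (simp add: tick_def algebra_simps)
  then show ?case
    using reaches_trans[OF reaches_trans[OF reaches_trans[OF reaches_trans[OF y(2) z(1)] v(2)] w(1)] u(2)]
      u(3,4) by blast
qed

end

text \<open>The program is fixed while \<open>L\<close> depends on the input, so the registers are
  laid out at run time: each bit of \<open>n\<close>, whatever its value, marks eight more cells.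
  Symbol 2 is the mark of the left end and symbol 1 the mark of a register cell.\<close>

definition preamble :: "(nat \<Rightarrow> instruction) list" where
  "preamble =
     [\<lambda>v. Write 2 Right 1, \<lambda>v. Ask Num_Vertices 2 2, \<lambda>v. Read_Answer 3 3 11,
      \<lambda>v. Write 1 Right 4, \<lambda>v. Write 1 Right 5, \<lambda>v. Write 1 Right 6, \<lambda>v. Write 1 Right 7,
      \<lambda>v. Write 1 Right 8, \<lambda>v. Write 1 Right 9, \<lambda>v. Write 1 Right 10, \<lambda>v. Write 1 Right 2,
      \<lambda>v. Write v Left 12, return_row 12 13 id]"

definition machine_of :: "nat \<Rightarrow> com \<Rightarrow> machine" where
  "machine_of K c = (let prog = preamble @ compile 13 c in
     \<lparr>states = Suc (length prog), symbols = 2 ^ K,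
      delta = (\<lambda>q v. if q < length prog then (prog ! q) v else Halt)\<rparr>)"

definition row_ok :: "nat \<Rightarrow> nat \<Rightarrow> (nat \<Rightarrow> instruction) \<Rightarrow> bool" where
  "row_ok K e h \<longleftrightarrow> (\<forall>v<2 ^ K. successors (h v) \<subseteq> {..e} \<and>
     (\<forall>b d q. h v = Write b d q \<longrightarrow> b < 2 ^ K))"

lemma row_ok_mono: "row_ok K e h \<Longrightarrow> e \<le> e' \<Longrightarrow> row_ok K e' h"
  by (fastforce simp: row_ok_def)

lemma put_less:
  assumes "v < 2 ^ K" "d < K"
  shows "put d c v < 2 ^ K"
proof -
  have v: "bit v i \<Longrightarrow> i < K" for i
    using assms(1) by (metis bit_take_bit_iff take_bit_nat_eq_self)
  have "take_bit K (put d c v) = put d c v"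
    by (rule bit_eqI) (use v assms(2) in \<open>auto simp: bit_take_bit_iff bit_put\<close>)
  then show ?thesis by (metis take_bit_nat_less_exp)
qed

lemma row_ok_return: "p \<le> e' \<Longrightarrow> e \<le> e' \<Longrightarrow> (\<And>v. v < 2 ^ K \<Longrightarrow> g v < 2 ^ K) \<Longrightarrow> row_ok K e' (return_row p e g)"
  by (auto simp: row_ok_def return_row_def)

lemma rows_ok:
  assumes "prim_regs q \<subseteq> {..<K}" "3 \<le> K" "h \<in> set (rows p q)"
  shows "row_ok K (p + length (rows p q)) h"
  using assms
  by (cases q)
    (auto simp: alu_row_def row_ok_return put_less, auto simp: row_ok_def put_less alu_row_def)

lemma compile_ok:
  assumes "com_regs c \<subseteq> {..<K}" "3 \<le> K" "h \<in> set (compile p c)"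
  shows "row_ok K (p + length (compile p c)) h"
  using assms
proof (induction c arbitrary: p)
  case (Prim q)
  then show ?case using rows_ok by simp
next
  case (Seq c d)
  then show ?case by (fastforce simp: Let_def intro: row_ok_mono)
next
  case (Cond c d)
  then show ?case
    by (fastforce simp: Let_def branch_def jump_def row_ok_def)
next
  case (Loop c d)
  then show ?case
    by (fastforce simp: Let_def branch_def jump_def row_ok_def)
qed simp

lemma catalytic_machine_of:
  assumes "com_regs c \<subseteq> {..<K}" "3 \<le> K"
  shows "catalytic_machine (machine_of K c)"
proof -
  define prog where "prog = preamble @ compile 13 c"
  have len: "length prog = 13 + length (compile 13 c)" by (simp add: prog_def preamble_def)
  have two: "2 < (2::nat) ^ K"
    using assms(2) power_strict_increasing[of 1 K "2::nat"] by simp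
  have "row_ok K (length prog) h" if "h \<in> set preamble" for h
    using that two row_ok_return[of 12 "length prog" 13 K id]
    by (auto simp: preamble_def row_ok_def prog_def)
  moreover have "row_ok K (length prog) h" if "h \<in> set (compile 13 c)" for h
    using compile_ok[OF assms that] len by simp
  ultimately have "row_ok K (length prog) (prog ! q)" if "q < length prog" for q
    using that nth_mem[OF that] by (auto simp: prog_def)
  then show ?thesis
    unfolding catalytic_machine_def machine_of_def Let_def prog_def[symmetric]
    by (auto simp: row_ok_def less_Suc_eq_le) blast+
qed

definition start :: "(nat \<Rightarrow> bool) \<Rightarrow> bool stream \<Rightarrow> store" where
  "start \<tau> \<omega> = \<lparr>regs = (\<lambda>_. 0), flag = False, index1 = [], index2 = [], reply = [], tape = \<tau>,
     flips = \<omega>, verdict = [], clock = 0\<rparr>"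

context simulation
begin

lemma sim_preamble:
  assumes "code 0 preamble" "L = 8 * length (bits_of_number (vertices I))"
  shows "\<exists>y. reaches (3 * L + 5) (initial \<tau> \<omega>) y \<and> rep y (start \<tau> \<omega>) \<and> control y = 13"
proof -
  define bs where "bs = bits_of_number (vertices I)"
  define W where "W k p = (if p = 0 then 2 else if p \<le> k then 1 else (0::nat))" for k p :: nat
  define x0 where "x0 = initial \<tau> \<omega>"
  define X where "X j = x0\<lparr>control := 2, pos := 8 * j + 1, answer := drop j bs, work := W (8 * j)\<rparr>" for j
  define Z where "Z j k = x0\<lparr>control := (if k = 8 then 2 else 3 + k), pos := 8 * j + k + 1,
    answer := drop (Suc j) bs, work := W (8 * j + k)\<rparr>" for j k
  have pre: "delta M k = preamble ! k" if "k < 13" for k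
    using assms(1) that by (simp add: code_def preamble_def)
  have W0: "(\<lambda>_. 0)(0 := 2) = W 0" by (auto simp: W_def fun_eq_iff)
  have W: "(W k)(Suc k := Suc 0) = W (Suc k)" for k by (auto simp: W_def fun_eq_iff)
  have x0: "query1 x0 = []" "query2 x0 = []" "pos x0 = 0" "control x0 = 0" "work x0 = (\<lambda>_. 0)"
    "answer x0 = []" "cat x0 = \<tau>" "coins x0 = \<omega>" "out x0 = []"
    by (simp_all add: x0_def initial_def)
  have L: "8 * length bs = L" by (simp add: assms(2) bs_def)
  let ?x1 = "x0\<lparr>control := Suc 0, pos := Suc 0, work := W 0\<rparr>"
  have c0: "current M x0 = Write 2 Right 1"
    by (simp add: current_def x0 pre preamble_def)
  have c1: "current M ?x1 = Ask Num_Vertices 2 2"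
    by (simp add: current_def pre preamble_def)
  have "reaches 1 x0 ?x1"
    by (rule reaches_step, rule good_Write[OF c0]) (auto simp: x0 c0 W0)
  also have "reaches 1 ?x1 (X 0)"
    by (rule reaches_step) (auto simp: c1 x0 good_def accesses_cell_def X_def bs_def)
  also have "reaches (length bs * 9) (X 0) (X (length bs))"
  proof (rule reaches_chain)
    fix j assume j: "j < length bs"
    have cj: "current M (X j) = Read_Answer 3 3 11"
      by (simp add: current_def X_def pre preamble_def)
    have "reaches 1 (X j) (Z j 0)"
    proof (rule reaches_step)
      show "good (X j)" using j L cj by (simp add: good_def X_def x0 accesses_cell_def)
      show "step (X j) = Z j 0" using j unfolding cj by (simp add: X_def Z_def Cons_nth_drop_Suc[symmetric])
    qed
    also have "reaches (8 * 1) (Z j 0) (Z j 8)"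
    proof (rule reaches_chain)
      fix k :: nat assume k: "k < 8"
      have "delta M (3 + k) = (\<lambda>v. Write 1 Right (if k = 7 then 2 else 4 + k))"
        using k pre[of "3 + k"] by (auto simp: preamble_def eval_nat_numeral less_Suc_eq)
      then have ck: "current M (Z j k) = Write 1 Right (if k = 7 then 2 else 4 + k)"
        using k by (simp add: current_def Z_def)
      show "reaches 1 (Z j k) (Z j (Suc k))"
        by (rule reaches_step, rule good_Write[OF ck]) (use k j L ck in \<open>auto simp: Z_def x0 W\<close>)
    qed
    also have "Z j 8 = X (Suc j)" by (simp add: Z_def X_def algebra_simps)
    finally show "reaches 9 (X j) (X (Suc j))" by (simp add: eval_nat_numeral)
  qed
  also have "reaches 1 (X (length bs)) ((X (length bs))\<lparr>control := 11\<rparr>)"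
  proof -
    have c: "current M (X (length bs)) = Read_Answer 3 3 11"
      by (simp add: current_def X_def pre preamble_def)
    show ?thesis
      by (rule reaches_step) (use L c in \<open>auto simp: good_def X_def x0 accesses_cell_def\<close>)
  qed
  also have "(X (length bs))\<lparr>control := 11\<rparr> = x0\<lparr>work := W L, control := 11, pos := Suc L\<rparr>"
    by (simp add: X_def L x0)
  also have "reaches (L + 2) \<dots> ((x0\<lparr>work := W L\<rparr>)\<lparr>control := 13, pos := 0,
      work := (work (x0\<lparr>work := W L\<rparr>))(0 := id (work (x0\<lparr>work := W L\<rparr>) 0))\<rparr>)" (is "reaches _ _ ?y")
    by (rule reaches_return[where q = 12 and g = id])
      (auto simp: pre preamble_def x0 W_def well_formed_def bit_Suc_0_iff bit_2_iff)
  finally have "reaches (1 + 1 + length bs * 9 + 1 + (L + 2)) x0 ?y" .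
  then have "reaches (3 * L + 5) x0 ?y"
    by (rule reaches_mono) (simp flip: L)
  moreover have "rep ?y (start \<tau> \<omega>)"
    by (auto simp: rep_def start_def x0 W_def well_formed_def bit_Suc_0_iff bit_2_iff)
  moreover have "control ?y = 13" by simp
  ultimately show ?thesis unfolding x0_def[symmetric] by blast
qed

end

text \<open>The \<open>+ 1\<close> beside the clock pays for the preamble. The space bounds hold for
  every \<open>i\<close>, also after halting, where the configuration just repeats.\<close>

lemma machine_of_correct:
  assumes "big I L S c (start \<tau> \<omega>) t" and L: "L = 8 * length (bits_of_number (vertices I))" "0 < L"
    and "com_regs c \<subseteq> {3..}" and "M = machine_of K c"
  obtains j y where "j \<le> (3 * L + 5) * (clock t + 1)" "run M I \<tau> \<omega> j = y" "current M y = Halt"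
    "cat y = tape t" "out y = verdict t"
    "\<And>i. pos (run M I \<tau> \<omega> i) + length (query1 (run M I \<tau> \<omega> i)) +
       length (query2 (run M I \<tau> \<omega> i)) \<le> 3 * L + 1"
    "\<And>i a. accesses_cell M (run M I \<tau> \<omega> i) a \<Longrightarrow> a < S"
proof -
  interpret simulation M I L S using L by unfold_locales
  define prog where "prog = preamble @ compile 13 c"
  have len: "length preamble = 13" by (simp add: preamble_def)
  have "code 0 prog"
    unfolding code_def prog_def by (simp add: assms(5) machine_of_def Let_def fun_eq_iff)
  then have code: "code 0 preamble" "code 13 (compile 13 c)"
    by (simp_all add: prog_def len)
  obtain x where x: "reaches (3 * L + 5) (initial \<tau> \<omega>) x" "rep x (start \<tau> \<omega>)" "control x = 13"
    using sim_preamble[OF code(1) L(1)] by blast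
  obtain k y where y: "k + (3 * L + 3) * clock (start \<tau> \<omega>) \<le> (3 * L + 3) * clock t" "reaches k x y" "rep y t"
    "control y = 13 + length (compile 13 c)"
    using sim_com[OF assms(1) x(2) code(2) x(3) assms(4)] by blast
  have "reaches ((3 * L + 5) * (clock t + 1)) (initial \<tau> \<omega>) y"
    by (rule reaches_mono[OF reaches_trans[OF x(1) y(2)]]) (use y(1) in \<open>simp add: start_def algebra_simps\<close>)
  then obtain j where j: "j \<le> (3 * L + 5) * (clock t + 1)" "(step ^^ j) (initial \<tau> \<omega>) = y"
    "\<forall>i<j. good ((step ^^ i) (initial \<tau> \<omega>))"
    unfolding reaches_def by blast
  have halt: "current M y = Halt"
    using y(4) assms(5) by (simp add: current_def machine_of_def Let_def len)
  have run: "run M I \<tau> \<omega> i = (step ^^ i) (initial \<tau> \<omega>)" for i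
    by (simp add: run_def)
  have fix_y: "(step ^^ i) y = y" for i by (induction i) (auto simp: halt)
  have "good y" using y(3) halt by (auto simp: rep_def good_def accesses_cell_def)
  have "good (run M I \<tau> \<omega> i)" for i
  proof (cases "i < j")
    case True then show ?thesis using j(3) run by simp
  next
    case False
    then have "run M I \<tau> \<omega> i = (step ^^ (i - j)) ((step ^^ j) (initial \<tau> \<omega>))"
      by (simp add: run flip: funpow_add[THEN fun_cong, unfolded comp_def])
    then show ?thesis using \<open>good y\<close> by (simp add: j(2) fix_y)
  qed
  then show ?thesis
    using that[of j y] j(1,2) halt y(3) by (auto simp: run good_def rep_def)
qed

section \<open>Register programs on the catalytic tape\<close>

lemma number_of_bits_of_number: "number_of_bits (bits_of_number k) = k"
proof (induction k rule: bits_of_number.induct)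
  case (1 k)
  show ?case
  proof (cases "k = 0")
    case True
    then show ?thesis by (simp add: bits_of_number.simps[of 0])
  next
    case False
    have "of_bool (odd k) + k div 2 * 2 = k" by (cases "even k") (auto elim!: oddE)
    then show ?thesis using False 1 by (simp add: bits_of_number.simps[of k])
  qed
qed

lemma length_bits_of_number_le: "length (bits_of_number k) \<le> l \<longleftrightarrow> k < 2 ^ l"
proof (induction k arbitrary: l rule: bits_of_number.induct)
  case (1 k)
  show ?case
  proof (cases "k = 0")
    case True then show ?thesis by (simp add: bits_of_number.simps[of 0])
  next
    case False
    then have *: "bits_of_number k = odd k # bits_of_number (k div 2)"
      by (simp add: bits_of_number.simps[of k])
    show ?thesis
    proof (cases l)
      case 0 then show ?thesis using False * by simp
    next
      case (Suc l')
      then show ?thesis using False * 1[of l'] by (simp add: div_less_iff_less_mult mult.commute)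
    qed
  qed
qed

lemma number_of_bits_map_bit: "k < 2 ^ L \<Longrightarrow> number_of_bits (map (bit k) [0..<L]) = k"
  by (simp add: horner_sum_bit_eq_take_bit take_bit_nat_eq_self)

abbreviation "clear d \<equiv> Prim (Arith Clear d d d)"
abbreviation "one d \<equiv> Prim (Arith Unit d d d)"
abbreviation "copy d a \<equiv> Prim (Arith Move d a a)"
abbreviation "add d a b \<equiv> Prim (Arith Plus d a b)"
abbreviation "sub d a b \<equiv> Prim (Arith Minus d a b)"
abbreviation "below a b \<equiv> Prim (Arith Compare a a b)"
abbreviation "test a \<equiv> Prim (Arith Test a a a)"
abbreviation "meet a b \<equiv> Prim (Arith Meet a a b)"

text \<open>Roles: \<open>rN\<close>, \<open>rS\<close>, \<open>rT\<close> hold the input;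
  \<open>rV\<close>, \<open>rU\<close>, \<open>rJ\<close>, \<open>rR\<close> the current vertex, the
  accessed vertex, the neighbour index and the round; \<open>rAdr\<close>, \<open>rCur\<close> cell
  address and bit mask; \<open>rX\<close>, \<open>rY\<close> the loaded value and the neighbour sum;
  \<open>rAl\<close>, \<open>rD\<close>, \<open>rQ\<close>, \<open>rH\<close> the shift,
  \<open>\<Delta>\<close>, \<open>q\<close> and \<open>2 ^ L - \<Delta>\<close>; \<open>rA\<close>,
  \<open>rB\<close> the two readings at the target. The others are auxiliary. Numbering starts
  behind the three reserved tracks.\<close>

abbreviation "rN \<equiv> 3::nat"
abbreviation "rV \<equiv> 4::nat"
abbreviation "rU \<equiv> 5::nat"
abbreviation "rJ \<equiv> 6::nat"
abbreviation "rR \<equiv> 7::nat"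
abbreviation "rAdr \<equiv> 8::nat"
abbreviation "rCur \<equiv> 9::nat"
abbreviation "rX \<equiv> 10::nat"
abbreviation "rY \<equiv> 11::nat"
abbreviation "rAl \<equiv> 12::nat"
abbreviation "rD \<equiv> 13::nat"
abbreviation "rQ \<equiv> 14::nat"
abbreviation "rP \<equiv> 15::nat"
abbreviation "rA \<equiv> 16::nat"
abbreviation "rS \<equiv> 17::nat"
abbreviation "rT \<equiv> 18::nat"
abbreviation "rE \<equiv> 19::nat"
abbreviation "rH \<equiv> 20::nat"
abbreviation "rB \<equiv> 21::nat"

text \<open>The register \<open>rCur\<close> holds the bit mask \<open>2 ^ i\<close> in round \<open>i\<close>; it overflows to 0 after the last bit.\<close>

definition "load = copy rAdr rU ;; one rCur ;; clear rX ;;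
  Loop (test rCur) (Prim (Push1 rAdr) ;; Prim Look ;; Cond (add rX rX rCur) Skip ;;
    add rAdr rAdr rN ;; add rCur rCur rCur) ;;
  add rX rX rAl"

definition "save = sub rX rX rAl ;; copy rAdr rU ;; one rCur ;;
  Loop (test rCur) (Prim (Push1 rAdr) ;; meet rX rCur ;; Prim Poke ;;
    add rAdr rAdr rN ;; add rCur rCur rCur)"

definition "addmod d a = add d d a ;;
  Cond (sub d d rQ) (below d rQ ;; Cond Skip (sub d d rQ))"

definition "submod d a = sub d d a ;; Cond (add d d rQ) Skip"

text \<open>The loop ends when the query for the next in-neighbour yields \<open>\<bottom>\<close>:
  \<open>Fetch\<close> leaves the flag set by the query untouched.\<close>

definition "gather = clear rY ;; clear rJ ;;
  Loop (Prim (Push1 rV) ;; Prim (Push2 rJ) ;; Prim (Query In_Neighbour) ;; Prim (Fetch rU))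
    (load ;; addmod rY rX ;; one rE ;; add rJ rJ rE)"

definition "update f = gather ;; copy rU rV ;; load ;; f rX rY ;; save"

definition "round_up = clear rV ;;
  Loop (below rV rN) (update addmod ;; one rE ;; add rV rV rE)"

definition "round_down = copy rV rN ;;
  Loop (test rV) (one rE ;; sub rV rV rE ;; update submod)"

definition "pass c = clear rR ;; Loop (below rR rN) (c ;; one rE ;; add rR rR rE)"

inductive_cases big_SkipE: "big I L S Skip s t"
inductive_cases big_PrimE: "big I L S (Prim p) s t"
inductive_cases big_SeqE: "big I L S (c ;; d) s t"
inductive_cases big_CondE: "big I L S (Cond c d) s t"

text \<open>A frame condition; tape, flag, reply and clock stay open and are described separately
  for each program.\<close>

definition keeps :: "nat set \<Rightarrow> store \<Rightarrow> store \<Rightarrow> bool" where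
  "keeps A s t \<longleftrightarrow> (\<forall>r. r \<notin> A \<longrightarrow> regs t r = regs s r) \<and> flips t = flips s \<and> verdict t = verdict s \<and>
     index1 t = [] \<and> index2 t = []"

lemma keeps_trans:
  assumes "keeps A s t" "keeps B t u" "A \<subseteq> C" "B \<subseteq> C"
  shows "keeps C s u"
proof -
  have "regs u r = regs s r" if "r \<notin> C" for r
  proof -
    have "r \<notin> A" "r \<notin> B" using assms(3,4) that by auto
    then show ?thesis using assms(1,2) by (simp add: keeps_def)
  qed
  then show ?thesis using assms(1,2) by (simp add: keeps_def)
qed

text \<open>Taken over the integers, where \<open>N\<close> does not depend on \<open>q\<close>;
  only \<open>reduce\<close> relates such a vector to the tape.\<close>

definition relax :: "(nat \<Rightarrow> nat list) \<Rightarrow> nat \<Rightarrow> (nat \<Rightarrow> int) \<Rightarrow> nat \<Rightarrow> int" where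
  "relax nbs v y = y(v := y v + (\<Sum>u\<leftarrow>nbs v. y u))"

definition unrelax :: "(nat \<Rightarrow> nat list) \<Rightarrow> nat \<Rightarrow> (nat \<Rightarrow> int) \<Rightarrow> nat \<Rightarrow> int" where
  "unrelax nbs v y = y(v := y v - (\<Sum>u\<leftarrow>nbs v. y u))"

definition reduce :: "nat \<Rightarrow> (nat \<Rightarrow> int) \<Rightarrow> nat \<Rightarrow> nat" where
  "reduce q y u = nat (y u mod int q)"

lemma mod_complement:
  fixes x a :: nat
  assumes "x < p" "a < p"
  shows "((x + p - a) mod p + a) mod p = x" "((x + a) mod p + p - a) mod p = x"
proof -
  show "((x + p - a) mod p + a) mod p = x"
    using assms by (simp add: mod_add_left_eq)
  show "((x + a) mod p + p - a) mod p = x"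
    using assms by (cases "x + a < p") (simp_all add: le_mod_geq)
qed

section \<open>Memory layout and a calculus for total correctness\<close>

text \<open>Bit \<open>j\<close> of the register of vertex \<open>u\<close> is kept in cell \<open>u + n * j\<close>. All register values are
  shifted by \<open>a\<close>, so \<open>memory a x\<close> is the tape on which \<open>load\<close> and \<open>save\<close> see the registers
  \<open>x\<close>.\<close>

locale layout =
  fixes I :: st_input and n L :: nat and \<tau> :: "nat \<Rightarrow> bool"
  assumes n_pos: "0 < n" and L_pos: "0 < L" and n_L: "n * (L + 1) < 2 ^ L"
begin

text \<open>Equal bit positions of all vertices lie side by side, so the address of the next bit is
  found by adding \<open>n\<close>, without multiplication.\<close>

definition encode :: "(nat \<Rightarrow> nat) \<Rightarrow> nat \<Rightarrow> bool" where
  "encode r a = (if a < n * L then bit (r (a mod n)) (a div n) else \<tau> a)"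

definition memory :: "nat \<Rightarrow> (nat \<Rightarrow> nat) \<Rightarrow> nat \<Rightarrow> bool" where
  "memory a x = encode (\<lambda>u. (x u + 2 ^ L - a) mod 2 ^ L)"

text \<open>Total correctness: the derivation includes termination. The laws for straight-line code
  are equations, so that simplification executes such code symbolically.\<close>

definition wp :: "com \<Rightarrow> (store \<Rightarrow> bool) \<Rightarrow> store \<Rightarrow> bool" where
  "wp c Q s \<longleftrightarrow> (\<exists>t. big I L (n * L) c s t \<and> Q t)"

lemma wp_Skip [simp]: "wp Skip Q s \<longleftrightarrow> Q s"
  unfolding wp_def by (metis big_Skip big_SkipE)

lemma wp_Prim [simp]: "wp (Prim p) Q s \<longleftrightarrow> prim_ok (n * L) p s \<and> Q (tick (prim_step I L p s))"
  unfolding wp_def by (metis big_Prim big_PrimE)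

lemma wp_Seq [simp]: "wp (c ;; d) Q s \<longleftrightarrow> wp c (wp d Q) s"
  unfolding wp_def by (metis big_Seq big_SeqE)

lemma wp_Cond [simp]: "wp (Cond c d) Q s \<longleftrightarrow> wp (if flag s then c else d) Q (tick s)"
proof -
  have "big I L (n * L) (Cond c d) s t \<longleftrightarrow> big I L (n * L) (if flag s then c else d) (tick s) t" for t
    by (auto elim: big_CondE intro: big_Cond simp del: if_split)
  then show ?thesis by (simp add: wp_def)
qed

lemma wp_mono: "wp c P s \<Longrightarrow> (\<And>t. P t \<Longrightarrow> Q t) \<Longrightarrow> wp c Q s"
  unfolding wp_def by blast

text \<open>The number \<open>k\<close> of rounds is fixed in advance and the invariant is indexed
  by the round. Hence \<open>k - i\<close> serves as termination measure, and the clock bound can be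
  part of the invariant.\<close>

lemma wp_Loop:
  assumes "P 0 s"
    and "\<And>i s. i < k \<Longrightarrow> P i s \<Longrightarrow> wp c (\<lambda>t. flag t \<and> wp d (P (Suc i)) (tick t)) s"
    and "\<And>s. P k s \<Longrightarrow> wp c (\<lambda>t. \<not> flag t \<and> Q (tick t)) s"
  shows "wp (Loop c d) Q s"
proof -
  have "wp (Loop c d) Q s" if "i \<le> k" "P i s" for i s
    using that
  proof (induction "k - i" arbitrary: i s)
    case 0
    then have "P k s" by simp
    from assms(3)[OF this] show ?case unfolding wp_def by (blast intro: big_Stop)
  next
    case (Suc l)
    then have i: "i < k" by linarith
    from assms(2)[OF this Suc.prems(2)] obtain t u where
      "big I L (n * L) c s t" "flag t" "big I L (n * L) d (tick t) u" "P (Suc i) u"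
      unfolding wp_def by blast
    moreover have "wp (Loop c d) Q u"
      using Suc.hyps(1)[of "Suc i" u] Suc.hyps(2) i calculation(4) by simp
    ultimately show ?case unfolding wp_def by (blast intro: big_Go)
  qed
  then show ?thesis using assms(1) by blast
qed

lemma cell_less:
  assumes "u < n" "i < L"
  shows "u + n * i < n * L" "(u + n * i) mod n = u" "(u + n * i) div n = i"
proof -
  have "u + n * i < n * Suc i" using assms by simp
  also have "\<dots> \<le> n * L" using assms by (intro mult_le_mono2) simp
  finally show "u + n * i < n * L" .
qed (use assms in simp_all)

text \<open>The case \<open>i = L\<close> matters: the address advances once more after the last bit
  and must not wrap around then.\<close>

lemma cell_bound:
  assumes "u < n" "i \<le> L"
  shows "u + n * i < 2 ^ L"
proof -
  have "u + n * i < n * Suc i" using assms by simp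
  also have "\<dots> \<le> n * (L + 1)" using assms by (intro mult_le_mono2) simp
  finally show ?thesis using n_L by simp
qed

lemma double_power_mod: "i < L \<Longrightarrow> (2 ^ i + 2 ^ i) mod 2 ^ L = (if Suc i = L then 0 else 2 ^ Suc i :: nat)"
proof (cases "Suc i = L")
  case True
  then show ?thesis by (auto simp: mult_2[symmetric])
next
  case False
  assume "i < L"
  with False have "(2::nat) ^ Suc i < 2 ^ L" by (intro power_strict_increasing) auto
  then show ?thesis using False by (simp add: mult_2)
qed


text \<open>Each round takes at most 8 ticks and extends \<open>rX\<close> by one bit of the raw
  content \<open>z\<close>; the shift is added once, at the end.\<close>

lemma wp_load:
  assumes "tape s = memory a x" "regs s rU = u" "u < n" "x u < 2 ^ L" "a < 2 ^ L"
    "regs s rN = n" "regs s rAl = a" "index1 s = []" "index2 s = []"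
  shows "wp load (\<lambda>t. keeps {rAdr, rCur, rX} s t \<and> tape t = tape s \<and> regs t rX = x u \<and>
    clock t \<le> clock s + 8 * L + 8) s"
proof -
  define z where "z = (x u + 2 ^ L - a) mod 2 ^ L"
  have z: "z < 2 ^ L" "(z + a) mod 2 ^ L = x u"
    unfolding z_def using mod_complement(1)[OF assms(4,5)] by simp_all
  let ?body = "Prim (Push1 rAdr) ;; Prim Look ;; Cond (add rX rX rCur) Skip ;;
    add rAdr rAdr rN ;; add rCur rCur rCur"
  define P where "P i t \<longleftrightarrow> keeps {rAdr, rCur, rX} s t \<and> tape t = tape s \<and> regs t rAdr = u + n * i \<and>
    regs t rCur = (if i = L then 0 else 2 ^ i) \<and> regs t rX = take_bit i z \<and> clock t \<le> clock s + 8 * i + 3" for i t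
  define Q where "Q t \<longleftrightarrow> keeps {rAdr, rCur, rX} s t \<and> tape t = tape s \<and> regs t rX = x u \<and>
    clock t \<le> clock s + 8 * L + 8" for t
  have loop: "wp (Loop (test rCur) ?body) (wp (add rX rX rAl) Q) t" if "P 0 t" for t
    using that
  proof (rule wp_Loop)
    fix i t assume i: "i < L" and t: "P i t"
    have a: "number_of_bits (map (bit (u + n * i)) [0..<L]) = u + n * i"
      by (rule number_of_bits_map_bit, rule cell_bound) (use i assms(3) in auto)
    have m: "tape s (u + n * i) = bit z i"
      unfolding assms(1) memory_def encode_def z_def using cell_less[OF assms(3) i] by simp
    have b: "(u + n * i + n) mod 2 ^ L = u + n * Suc i"
      using cell_bound[of u "Suc i"] i assms(3) by (simp add: algebra_simps)
    have "take_bit i z + 2 ^ i < 2 ^ i + 2 ^ i" by simp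
    also have "\<dots> \<le> 2 ^ L" using i power_increasing[of "Suc i" L "2::nat"] by (simp add: mult_2)
    finally have c: "(take_bit i z + 2 ^ i) mod 2 ^ L = take_bit i z + 2 ^ i" by simp
    show "wp (test rCur) (\<lambda>t. flag t \<and> wp ?body (P (Suc i)) (tick t)) t"
      using t i assms(6-) cell_less(1)[OF assms(3) i] double_power_mod[OF i] b c
      by (cases "bit z i") (simp_all add: P_def keeps_def tick_def a m take_bit_Suc_from_most add.commute)
  next
    fix t assume "P L t"
    then show "wp (test rCur) (\<lambda>t. \<not> flag t \<and> wp (add rX rX rAl) Q (tick t)) t"
      using assms z by (auto simp: P_def Q_def keeps_def tick_def take_bit_nat_eq_self)
  qed
  have "wp load Q s"
    unfolding load_def by (simp, rule loop) (use assms L_pos in \<open>auto simp: P_def keeps_def tick_def\<close>)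
  then show ?thesis by (simp add: Q_def[abs_def])
qed

end

lemma mod_plus_self: "(z::nat) < p \<Longrightarrow> w = z + p \<Longrightarrow> w mod p = z"
  by simp

text \<open>The three cases are the paths through \<open>addmod\<close>. After an overflow the
  wrapped sum is less than \<open>q\<close>, so subtracting \<open>q\<close> wraps back in the other
  direction.\<close>

lemma mod_reduce_add:
  fixes x y q p :: nat
  assumes "x < q" "y < q" "q < p"
  shows "p \<le> x + y \<Longrightarrow> ((x + y) mod p + p - q) mod p = (x + y) mod q"
    and "x + y < p \<Longrightarrow> q \<le> x + y \<Longrightarrow> (x + y + p - q) mod p = (x + y) mod q"
    and "x + y < q \<Longrightarrow> (x + y) mod p = (x + y) mod q"
proof -
  have q: "(x + y) mod q = x + y - q" if "q \<le> x + y"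
    by (rule mod_plus_self) (use assms that in linarith)+
  { assume 1: "p \<le> x + y"
    have "(x + y) mod p = x + y - p" by (rule mod_plus_self) (use assms 1 in linarith)+
    moreover have "x + y - p + p - q = x + y - q" "x + y - q < p" using assms 1 by linarith+
    ultimately show "((x + y) mod p + p - q) mod p = (x + y) mod q" using q 1 assms by simp }
  { assume 2: "x + y < p" "q \<le> x + y"
    have "(x + y + p - q) mod p = x + y - q" by (rule mod_plus_self) (use assms 2 in linarith)+
    then show "(x + y + p - q) mod p = (x + y) mod q" using q 2 by simp }
  show "(x + y) mod p = (x + y) mod q" if "x + y < q" using assms that by simp
qed

lemma mod_reduce_diff:
  fixes x y q p :: nat
  assumes "x < q" "y < q" "q < p"
  shows "x < y \<Longrightarrow> ((x + p - y) mod p + q) mod p = (x + q - y) mod q"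
    and "\<not> x < y \<Longrightarrow> (x + p - y) mod p = (x + q - y) mod q"
proof -
  { assume 1: "x < y"
    then have a: "(x + p - y) mod p = x + p - y" using assms by simp
    have b: "(x + p - y + q) mod p = x + q - y"
      by (rule mod_plus_self) (use assms 1 in linarith)+
    have "(x + q - y) mod q = x + q - y" using 1 assms by simp
    then show "((x + p - y) mod p + q) mod p = (x + q - y) mod q" by (simp only: a b) }
  { assume 2: "\<not> x < y"
    have "(x + p - y) mod p = x - y" "(x + q - y) mod q = x - y"
      by (rule mod_plus_self; use assms 2 in linarith)+
    then show "(x + p - y) mod p = (x + q - y) mod q" by simp }
qed

context layout
begin

lemma wp_save:
  assumes "tape s = memory a x" "regs s rU = u" "u < n" "regs s rX = w" "w < 2 ^ L" "a < 2 ^ L"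
    "regs s rN = n" "regs s rAl = a" "index1 s = []" "index2 s = []"
  shows "wp save (\<lambda>t. keeps {rAdr, rCur, rX} s t \<and> tape t = memory a (x(u := w)) \<and>
    clock t \<le> clock s + 8 * L + 8) s"
proof -
  define z where "z = (w + 2 ^ L - a) mod 2 ^ L"
  let ?body = "Prim (Push1 rAdr) ;; meet rX rCur ;; Prim Poke ;; add rAdr rAdr rN ;; add rCur rCur rCur"
  \<comment> \<open>The half-written tape: in the register of \<open>u\<close> only the bits below
    \<open>i\<close> are new.\<close>
  define T where "T i b \<longleftrightarrow>
    (if b < n * L \<and> b mod n = u \<and> b div n < i then bit z (b div n) else memory a x b)" for i b
  have T_0: "T 0 = memory a x" by (simp add: T_def fun_eq_iff)
  have T_L: "T L = memory a (x(u := w))"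
  proof
    fix b
    have "b div n < L" if "b < n * L" using that by (simp add: less_mult_imp_div_less mult.commute)
    then show "T L b = memory a (x(u := w)) b"
      by (simp add: T_def memory_def encode_def z_def)
  qed
  have T_Suc: "(T i)(u + n * i := bit z i) = T (Suc i)" if "i < L" for i
  proof
    fix b
    show "((T i)(u + n * i := bit z i)) b = T (Suc i) b"
    proof (cases "b = u + n * i")
      case True
      then show ?thesis using cell_less[OF assms(3) that] by (simp add: T_def)
    next
      case False
      then have "\<not> (b mod n = u \<and> b div n = i)"
        using mod_mult_div_eq[of b n] by metis
      then show ?thesis using False by (auto simp: T_def less_Suc_eq)
    qed
  qed
  define P where "P i t \<longleftrightarrow> keeps {rAdr, rCur, rX} s t \<and> regs t rX = z \<and> regs t rAdr = u + n * i \<and>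
    regs t rCur = (if i = L then 0 else 2 ^ i) \<and> clock t \<le> clock s + 8 * i + 3 \<and> tape t = T i" for i t
  define Q where "Q t \<longleftrightarrow> keeps {rAdr, rCur, rX} s t \<and> tape t = memory a (x(u := w)) \<and>
    clock t \<le> clock s + 8 * L + 8" for t
  have loop: "wp (Loop (test rCur) ?body) Q t" if "P 0 t" for t
    using that
  proof (rule wp_Loop)
    fix i t assume i: "i < L" and t: "P i t"
    have a: "number_of_bits (map (bit (u + n * i)) [0..<L]) = u + n * i"
      by (rule number_of_bits_map_bit, rule cell_bound) (use i assms(3) in auto)
    \<comment> \<open>Meeting \<open>rX\<close> with the one-bit mask is how bit \<open>i\<close> of
      \<open>z\<close> gets into the flag, from where \<open>Poke\<close> writes it.\<close>
    have m: "(\<exists>j<L. bit z j \<and> bit ((2::nat) ^ i) j) \<longleftrightarrow> bit z i"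
      using i by (auto simp: bit_exp_iff)
    have b: "(u + n * i + n) mod 2 ^ L = u + n * Suc i"
      using cell_bound[of u "Suc i"] i assms(3) by (simp add: algebra_simps)
    show "wp (test rCur) (\<lambda>t. flag t \<and> wp ?body (P (Suc i)) (tick t)) t"
      using t i assms(7-) cell_less(1)[OF assms(3) i] double_power_mod[OF i] b
      by (simp add: P_def keeps_def tick_def a m T_Suc)
  next
    fix t assume "P L t"
    then show "wp (test rCur) (\<lambda>t. \<not> flag t \<and> Q (tick t)) t"
      by (simp add: P_def Q_def keeps_def tick_def T_L)
  qed
  have "wp save Q s"
    unfolding save_def
    by (simp, rule loop) (use assms L_pos in \<open>simp add: P_def keeps_def tick_def z_def T_0\<close>)
  then show ?thesis by (simp add: Q_def[abs_def])
qed

lemma wp_addmod: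
  assumes "regs s d = x" "regs s a = y" "x < q" "y < q" "q < 2 ^ L" "regs s rQ = q" "d \<noteq> rQ"
    "index1 s = []" "index2 s = []"
  shows "wp (addmod d a) (\<lambda>t. keeps {d} s t \<and> tape t = tape s \<and> regs t d = (x + y) mod q \<and>
    clock t \<le> clock s + 5) s"
proof -
  note m = mod_reduce_add[OF assms(3-5)]
  show ?thesis
    using assms(6-) m by (simp add: addmod_def keeps_def tick_def assms(1,2))
qed

lemma wp_submod:
  assumes "regs s d = x" "regs s a = y" "x < q" "y < q" "q < 2 ^ L" "regs s rQ = q" "d \<noteq> rQ"
    "index1 s = []" "index2 s = []"
  shows "wp (submod d a) (\<lambda>t. keeps {d} s t \<and> tape t = tape s \<and> regs t d = (x + q - y) mod q \<and>
    clock t \<le> clock s + 5) s"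
proof -
  note m = mod_reduce_diff[OF assms(3-5)]
  show ?thesis
    using assms(6-) m by (simp add: submod_def keeps_def tick_def assms(1,2))
qed

end

lemma reduce_less: "0 < q \<Longrightarrow> reduce q y u < q"
  by (simp add: reduce_def nat_less_iff)

lemma reduce_add:
  assumes "0 < q"
  shows "(nat (y mod int q) + nat (z mod int q)) mod q = nat ((y + z) mod int q)"
proof -
  have "int ((nat (y mod int q) + nat (z mod int q)) mod q) = (y mod int q + z mod int q) mod int q"
    using assms by (simp add: zmod_int)
  also have "\<dots> = (y + z) mod int q" by (rule mod_add_eq)
  finally show ?thesis by linarith
qed

lemma reduce_diff:
  assumes "0 < q"
  shows "(nat (y mod int q) + q - nat (z mod int q)) mod q = nat ((y - z) mod int q)"
proof -
  have "z mod int q < int q" using assms by simp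
  then have "nat (z mod int q) \<le> nat (y mod int q) + q" by linarith
  then have "int ((nat (y mod int q) + q - nat (z mod int q)) mod q) = (y mod int q + int q - z mod int q) mod int q"
    using assms by (simp add: zmod_int of_nat_diff)
  also have "\<dots> = (y mod int q - z mod int q + int q) mod int q" by (simp add: algebra_simps)
  also have "\<dots> = (y mod int q - z mod int q) mod int q" by (rule mod_add_self2)
  also have "\<dots> = (y - z) mod int q" by (rule mod_diff_eq)
  finally show ?thesis by linarith
qed

section \<open>Arithmetic modulo \<open>q\<close> and sweeps over the graph\<close>

locale network = layout +
  assumes vertices: "vertices I = n"
    and nbs_less: "v < n \<Longrightarrow> u \<in> set (in_nbs I v) \<Longrightarrow> u < n"
    and degree_less: "v < n \<Longrightarrow> length (in_nbs I v) < n"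
    and no_loop: "v < n \<Longrightarrow> v \<notin> set (in_nbs I v)"
begin

abbreviation "nbs \<equiv> in_nbs I"

definition ready :: "nat \<Rightarrow> nat \<Rightarrow> store \<Rightarrow> bool" where
  "ready q a s \<longleftrightarrow> regs s rN = n \<and> regs s rQ = q \<and> regs s rAl = a \<and> index1 s = [] \<and> index2 s = [] \<and>
     0 < q \<and> q < 2 ^ L \<and> a < 2 ^ L"

lemma ready_keeps: "ready q a s \<Longrightarrow> keeps A s t \<Longrightarrow> {rN, rAl, rQ} \<inter> A = {} \<Longrightarrow> ready q a t"
  by (simp add: ready_def keeps_def)

lemma n_less: "n < 2 ^ L"
  using n_L by (metis add.commute le_add1 le_less_trans mult.right_neutral mult_le_mono2 add_leD1 order_refl add_mult_distrib2)

lemma load_reduce: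
  assumes "ready q a s" "tape s = memory a (reduce q y)" "regs s rU = u" "u < n"
  shows "wp load (\<lambda>t. keeps {rAdr, rCur, rX} s t \<and> ready q a t \<and> tape t = tape s \<and>
    regs t rX = reduce q y u \<and> clock t \<le> clock s + 8 * L + 8) s"
proof -
  have "reduce q y u < 2 ^ L"
    using assms(1) reduce_less[of q y u] by (simp add: ready_def)
  then have "wp load (\<lambda>t. keeps {rAdr, rCur, rX} s t \<and> tape t = tape s \<and>
    regs t rX = reduce q y u \<and> clock t \<le> clock s + 8 * L + 8) s"
    using assms by (intro wp_load) (auto simp: ready_def)
  then show ?thesis
    by (rule wp_mono) (use ready_keeps[OF assms(1)] in auto)
qed

lemma save_reduce:
  assumes "ready q a s" "tape s = memory a (reduce q y)" "regs s rU = u" "u < n"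
    "regs s rX = nat (w mod int q)"
  shows "wp save (\<lambda>t. keeps {rAdr, rCur, rX} s t \<and> ready q a t \<and> tape t = memory a (reduce q (y(u := w))) \<and>
    clock t \<le> clock s + 8 * L + 8) s"
proof -
  have "nat (w mod int q) < 2 ^ L"
    using assms(1) reduce_less[of q "\<lambda>_. w" u] unfolding ready_def reduce_def by linarith
  then have "wp save (\<lambda>t. keeps {rAdr, rCur, rX} s t \<and> tape t = memory a ((reduce q y)(u := nat (w mod int q))) \<and>
    clock t \<le> clock s + 8 * L + 8) s"
    using assms by (intro wp_save) (auto simp: ready_def)
  moreover have "(reduce q y)(u := nat (w mod int q)) = reduce q (y(u := w))"
    by (auto simp: reduce_def fun_eq_iff)
  ultimately show ?thesis
    using ready_keeps[OF assms(1)] by (auto elim!: wp_mono)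
qed

lemma addmod_reduce:
  assumes "ready q a s" "regs s d = nat (y mod int q)" "regs s b = nat (z mod int q)" "d \<notin> {rN, rAl, rQ}"
  shows "wp (addmod d b) (\<lambda>t. keeps {d} s t \<and> ready q a t \<and> tape t = tape s \<and>
    regs t d = nat ((y + z) mod int q) \<and> clock t \<le> clock s + 5) s"
proof -
  have "wp (addmod d b) (\<lambda>t. keeps {d} s t \<and> tape t = tape s \<and>
    regs t d = (nat (y mod int q) + nat (z mod int q)) mod q \<and> clock t \<le> clock s + 5) s"
    using assms by (intro wp_addmod) (auto simp: ready_def nat_less_iff)
  then show ?thesis
    by (rule wp_mono) (use assms ready_keeps[OF assms(1)] in \<open>auto simp: reduce_add ready_def\<close>)
qed

lemma submod_reduce:
  assumes "ready q a s" "regs s d = nat (y mod int q)" "regs s b = nat (z mod int q)" "d \<notin> {rN, rAl, rQ}"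
  shows "wp (submod d b) (\<lambda>t. keeps {d} s t \<and> ready q a t \<and> tape t = tape s \<and>
    regs t d = nat ((y - z) mod int q) \<and> clock t \<le> clock s + 5) s"
proof -
  have "wp (submod d b) (\<lambda>t. keeps {d} s t \<and> tape t = tape s \<and>
    regs t d = (nat (y mod int q) + q - nat (z mod int q)) mod q \<and> clock t \<le> clock s + 5) s"
    using assms by (intro wp_submod) (auto simp: ready_def nat_less_iff)
  then show ?thesis
    by (rule wp_mono) (use assms ready_keeps[OF assms(1)] in \<open>auto simp: reduce_diff ready_def\<close>)
qed

abbreviation "scratch \<equiv> {rY, rJ, rU, rAdr, rCur, rX, rE}"

text \<open>The index \<open>rJ\<close> rises to the degree itself, which is less than
  \<open>n\<close> and so fits in a register. The unit \<open>8 * L + 25\<close> is a rounded bound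
  for one load together with the arithmetic around it.\<close>

lemma wp_gather:
  assumes "ready q a s" "tape s = memory a (reduce q y)" "regs s rV = v" "v < n"
  shows "wp gather (\<lambda>t. keeps scratch s t \<and> ready q a t \<and> tape t = tape s \<and>
    regs t rY = nat ((\<Sum>u\<leftarrow>nbs v. y u) mod int q) \<and>
    clock t \<le> clock s + (length (nbs v) + 1) * (8 * L + 25)) s"
proof -
  let ?cond = "Prim (Push1 rV) ;; Prim (Push2 rJ) ;; Prim (Query In_Neighbour) ;; Prim (Fetch rU)"
  let ?body = "load ;; addmod rY rX ;; one rE ;; add rJ rJ rE"
  define G where "G = 8 * L + 25"
  define P where "P i t \<longleftrightarrow> keeps scratch s t \<and> ready q a t \<and> tape t = tape s \<and> regs t rJ = i \<and>
    regs t rY = nat ((\<Sum>u\<leftarrow>take i (nbs v). y u) mod int q) \<and> clock t \<le> clock s + 2 + i * G" for i t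
  define Q where "Q t \<longleftrightarrow> keeps scratch s t \<and> ready q a t \<and> tape t = tape s \<and>
    regs t rY = nat ((\<Sum>u\<leftarrow>nbs v. y u) mod int q) \<and>
    clock t \<le> clock s + (length (nbs v) + 1) * G" for t
  have v: "number_of_bits (map (bit v) [0..<L]) = v"
    by (rule number_of_bits_map_bit) (use assms(4) n_less in linarith)
  have loop: "wp (Loop ?cond ?body) Q t" if "P 0 t" for t
    using that
  proof (rule wp_Loop)
    fix i t assume i: "i < length (nbs v)" and t: "P i t"
    define u where "u = nbs v ! i"
    have u: "u < n" using nbs_less[OF assms(4)] i by (simp add: u_def)
    have j: "number_of_bits (map (bit i) [0..<L]) = i"
      by (rule number_of_bits_map_bit) (use i degree_less[OF assms(4)] n_less in linarith)
    have "length (bits_of_number u) \<le> L"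
      unfolding length_bits_of_number_le using u n_less by linarith
    then have f: "number_of_bits (take L (bits_of_number u)) = u"
      by (simp add: number_of_bits_of_number)
    have r: "respond I In_Neighbour v i = Some u"
      using i assms(4) by (simp add: vertices u_def)
    have body: "wp load (wp (addmod rY rX ;; one rE ;; add rJ rJ rE) (P (Suc i))) t'"
      if t': "keeps scratch s t'" "ready q a t'" "tape t' = tape s" "regs t' rJ = i"
        "regs t' rY = nat ((\<Sum>u\<leftarrow>take i (nbs v). y u) mod int q)" "regs t' rU = u"
        "clock t' \<le> clock s + 2 + i * G + 5" for t'
    proof (rule wp_mono[OF load_reduce[OF t'(2) _ t'(6) u]])
      show "tape t' = memory a (reduce q y)" using t'(3) assms(2) by simp
      fix t2 assume t2: "keeps {rAdr, rCur, rX} t' t2 \<and> ready q a t2 \<and> tape t2 = tape t' \<and>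
        regs t2 rX = reduce q y u \<and> clock t2 \<le> clock t' + 8 * L + 8"
      then have Y: "regs t2 rY = nat ((\<Sum>u\<leftarrow>take i (nbs v). y u) mod int q)" "regs t2 rX = nat (y u mod int q)"
        using t' by (auto simp: keeps_def reduce_def)
      show "wp (addmod rY rX ;; one rE ;; add rJ rJ rE) (P (Suc i)) t2"
        unfolding wp_Seq
      proof (rule wp_mono[OF addmod_reduce[OF _ Y]])
        fix t3 assume t3: "keeps {rY} t2 t3 \<and> ready q a t3 \<and> tape t3 = tape t2 \<and>
          regs t3 rY = nat (((\<Sum>u\<leftarrow>take i (nbs v). y u) + y u) mod int q) \<and> clock t3 \<le> clock t2 + 5"
        have "(i + 1) mod 2 ^ L = Suc i"
          using i degree_less[OF assms(4)] n_less by simp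
        then show "wp (one rE) (wp (add rJ rJ rE) (P (Suc i))) t3"
          using t2 t3 t' i
          by (simp add: P_def keeps_def tick_def ready_def take_Suc_conv_app_nth u_def G_def)
      qed (use t2 in auto)
    qed
    show "wp ?cond (\<lambda>t. flag t \<and> wp ?body (P (Suc i)) (tick t)) t"
    proof -
      have t': "keeps scratch s t" "ready q a t" "tape t = tape s" "regs t rJ = i" "regs t rV = v"
        "regs t rY = nat ((\<Sum>u\<leftarrow>take i (nbs v). y u) mod int q)" "clock t \<le> clock s + 2 + i * G"
        "index1 t = []" "index2 t = []"
        using t assms(3) by (simp_all add: P_def keeps_def)
      show ?thesis
        using t'(4,5,8,9)
        by (simp add: v j r f tick_def del: respond.simps)
          (rule body; use t' in \<open>simp add: keeps_def ready_def\<close>)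
    qed
  next
    fix t assume t: "P (length (nbs v)) t"
    have j: "number_of_bits (map (bit (length (nbs v))) [0..<L]) = length (nbs v)"
      by (rule number_of_bits_map_bit) (use degree_less[OF assms(4)] n_less in linarith)
    have r: "respond I In_Neighbour v (length (nbs v)) = None" by simp
    show "wp ?cond (\<lambda>t. \<not> flag t \<and> Q (tick t)) t"
      using t assms(3) unfolding wp_Seq wp_Prim P_def
      by (simp add: v j r keeps_def ready_def tick_def Q_def G_def del: respond.simps)
  qed
  have "wp gather Q s"
    unfolding gather_def
    by (simp, rule loop) (use assms in \<open>simp add: P_def keeps_def ready_def tick_def\<close>)
  then show ?thesis by (simp add: Q_def[abs_def] G_def)
qed

text \<open>The operation \<open>h\<close> is left abstract so that one proof covers the forward
  update and its inverse.\<close>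

lemma wp_update:
  assumes f: "\<And>s y z. ready q a s \<Longrightarrow> regs s rX = nat (y mod int q) \<Longrightarrow> regs s rY = nat (z mod int q) \<Longrightarrow>
      wp (f rX rY) (\<lambda>t. keeps {rX} s t \<and> ready q a t \<and> tape t = tape s \<and>
        regs t rX = nat (h y z mod int q) \<and> clock t \<le> clock s + 5) s"
    and s: "ready q a s" "tape s = memory a (reduce q y)" "regs s rV = v" "v < n"
  shows "wp (update f) (\<lambda>t. keeps scratch s t \<and> ready q a t \<and>
    tape t = memory a (reduce q (y(v := h (y v) (\<Sum>u\<leftarrow>nbs v. y u)))) \<and>
    clock t \<le> clock s + (length (nbs v) + 3) * (8 * L + 25)) s"
  unfolding update_def wp_Seq
proof (rule wp_mono[OF wp_gather[OF s]])
  let ?z = "\<Sum>u\<leftarrow>nbs v. y u"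
  fix t assume t: "keeps scratch s t \<and> ready q a t \<and> tape t = tape s \<and>
    regs t rY = nat (?z mod int q) \<and> clock t \<le> clock s + (length (nbs v) + 1) * (8 * L + 25)"
  define t1 where "t1 = tick (prim_step I L (Arith Move rU rV rV) t)"
  have t1: "keeps scratch s t1" "ready q a t1" "tape t1 = tape s" "regs t1 rY = nat (?z mod int q)"
    "regs t1 rU = v" "clock t1 \<le> clock s + (length (nbs v) + 1) * (8 * L + 25) + 1"
    using t s(3) by (simp_all add: t1_def tick_def keeps_def ready_def)
  have "wp load (wp (f rX rY) (wp save (\<lambda>t. keeps scratch s t \<and> ready q a t \<and>
    tape t = memory a (reduce q (y(v := h (y v) ?z))) \<and>
    clock t \<le> clock s + (length (nbs v) + 3) * (8 * L + 25)))) t1"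
  proof (rule wp_mono[OF load_reduce[OF t1(2) _ t1(5) s(4)]])
    show "tape t1 = memory a (reduce q y)" using t1(3) s(2) by simp
    fix t2 assume t2: "keeps {rAdr, rCur, rX} t1 t2 \<and> ready q a t2 \<and> tape t2 = tape t1 \<and>
      regs t2 rX = reduce q y v \<and> clock t2 \<le> clock t1 + 8 * L + 8"
    then have "regs t2 rX = nat (y v mod int q)" "regs t2 rY = nat (?z mod int q)" "ready q a t2"
      using t1(4) by (auto simp: keeps_def reduce_def)
    from f[OF this(3,1,2)] show "wp (f rX rY) (wp save (\<lambda>t. keeps scratch s t \<and> ready q a t \<and>
      tape t = memory a (reduce q (y(v := h (y v) ?z))) \<and>
      clock t \<le> clock s + (length (nbs v) + 3) * (8 * L + 25))) t2"
    proof (rule wp_mono)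
      fix t3 assume t3: "keeps {rX} t2 t3 \<and> ready q a t3 \<and> tape t3 = tape t2 \<and>
        regs t3 rX = nat (h (y v) ?z mod int q) \<and> clock t3 \<le> clock t2 + 5"
      have "wp save (\<lambda>t. keeps {rAdr, rCur, rX} t3 t \<and> ready q a t \<and>
        tape t = memory a (reduce q (y(v := h (y v) ?z))) \<and> clock t \<le> clock t3 + 8 * L + 8) t3"
        by (rule save_reduce) (use t1 t2 t3 s in \<open>auto simp: keeps_def\<close>)
      then show "wp save (\<lambda>t. keeps scratch s t \<and> ready q a t \<and>
        tape t = memory a (reduce q (y(v := h (y v) ?z))) \<and>
        clock t \<le> clock s + (length (nbs v) + 3) * (8 * L + 25)) t3"
      proof (rule wp_mono, goal_cases)
        case (1 t4)
        then have "keeps scratch s t4"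
          using t1(1) t2 t3 by (auto simp: keeps_def)
        then show ?case using 1 t1(6) t2 t3 by (simp add: algebra_simps)
      qed
    qed
  qed
  then show "wp (copy rU rV) (wp load (wp (f rX rY) (wp save (\<lambda>t. keeps scratch s t \<and> ready q a t \<and>
    tape t = memory a (reduce q (y(v := h (y v) ?z))) \<and>
    clock t \<le> clock s + (length (nbs v) + 3) * (8 * L + 25))))) t"
    by (simp add: t1_def)
qed

lemma wp_update_add:
  assumes "ready q a s" "tape s = memory a (reduce q y)" "regs s rV = v" "v < n"
  shows "wp (update addmod) (\<lambda>t. keeps scratch s t \<and> ready q a t \<and>
    tape t = memory a (reduce q (relax nbs v y)) \<and>
    clock t \<le> clock s + (length (nbs v) + 3) * (8 * L + 25)) s"
  unfolding relax_def
  by (rule wp_update[OF _ assms, where h = "(+)"]) (rule addmod_reduce; simp)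

lemma wp_update_sub:
  assumes "ready q a s" "tape s = memory a (reduce q y)" "regs s rV = v" "v < n"
  shows "wp (update submod) (\<lambda>t. keeps scratch s t \<and> ready q a t \<and>
    tape t = memory a (reduce q (unrelax nbs v y)) \<and>
    clock t \<le> clock s + (length (nbs v) + 3) * (8 * L + 25)) s"
  unfolding unrelax_def
  by (rule wp_update[OF _ assms, where h = "(-)"]) (rule submod_reduce; simp)

definition "edges = (\<Sum>v<n. length (nbs v))"

lemma wp_round_up:
  assumes "ready q a s" "tape s = memory a (reduce q y)"
  shows "wp round_up (\<lambda>t. keeps (insert rV scratch) s t \<and> ready q a t \<and>
    tape t = memory a (reduce q (fold (relax nbs) [0..<n] y)) \<and>
    clock t \<le> clock s + (edges + 4 * n) * (8 * L + 25) + 3) s"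
proof -
  define G where "G = 8 * L + 25"
  define P where "P i t \<longleftrightarrow> keeps (insert rV scratch) s t \<and> ready q a t \<and> regs t rV = i \<and>
    tape t = memory a (reduce q (fold (relax nbs) [0..<i] y)) \<and>
    clock t \<le> clock s + 1 + (\<Sum>v<i. (length (nbs v) + 4) * G)" for i t
  define Q where "Q t \<longleftrightarrow> keeps (insert rV scratch) s t \<and> ready q a t \<and>
    tape t = memory a (reduce q (fold (relax nbs) [0..<n] y)) \<and>
    clock t \<le> clock s + (edges + 4 * n) * G + 3" for t
  have loop: "wp (Loop (below rV rN) (update addmod ;; one rE ;; add rV rV rE)) Q t" if "P 0 t" for t
    using that
  proof (rule wp_Loop)
    fix i t assume i: "i < n" and t: "P i t"
    let ?y = "fold (relax nbs) [0..<i] y"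
    have body: "wp (update addmod) (wp (one rE ;; add rV rV rE) (P (Suc i))) t'"
      if t': "keeps (insert rV scratch) s t'" "ready q a t'" "regs t' rV = i" "tape t' = memory a (reduce q ?y)"
        "clock t' \<le> clock s + 3 + (\<Sum>v<i. (length (nbs v) + 4) * G)" for t'
    proof (rule wp_mono[OF wp_update_add[OF t'(2,4,3) i]], goal_cases)
      case (1 t2)
      have "(i + 1) mod 2 ^ L = Suc i" using i n_less by simp
      then show ?case
        using 1 t' by (simp add: P_def keeps_def ready_def tick_def G_def algebra_simps)
    qed
    have "regs t rV = i" "regs t rN = n" using t by (simp_all add: P_def ready_def)
    then show "wp (below rV rN) (\<lambda>t. flag t \<and> wp (update addmod ;; one rE ;; add rV rV rE) (P (Suc i)) (tick t)) t"
      using i by (simp add: tick_def) (rule body; use t in \<open>simp add: P_def keeps_def ready_def\<close>)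
  next
    fix t assume t: "P n t"
    have "(\<Sum>v<n. (length (nbs v) + 4) * G) = (edges + 4 * n) * G"
      by (simp add: edges_def sum.distrib flip: sum_distrib_right)
    then show "wp (below rV rN) (\<lambda>t. \<not> flag t \<and> Q (tick t)) t"
      using t by (simp add: P_def Q_def keeps_def ready_def tick_def)
  qed
  have "wp round_up Q s"
    unfolding round_up_def
    by (simp, rule loop) (use assms in \<open>simp add: P_def keeps_def ready_def tick_def\<close>)
  then show ?thesis by (simp add: Q_def[abs_def] G_def)
qed

lemma wp_round_down:
  assumes "ready q a s" "tape s = memory a (reduce q y)"
  shows "wp round_down (\<lambda>t. keeps (insert rV scratch) s t \<and> ready q a t \<and>
    tape t = memory a (reduce q (fold (unrelax nbs) (rev [0..<n]) y)) \<and>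
    clock t \<le> clock s + (edges + 4 * n) * (8 * L + 25) + 3) s"
proof -
  define G where "G = 8 * L + 25"
  define P where "P i t \<longleftrightarrow> keeps (insert rV scratch) s t \<and> ready q a t \<and> regs t rV = n - i \<and>
    tape t = memory a (reduce q (fold (unrelax nbs) (rev [n - i..<n]) y)) \<and>
    clock t \<le> clock s + 1 + (\<Sum>v=n-i..<n. (length (nbs v) + 4) * G)" for i t
  define Q where "Q t \<longleftrightarrow> keeps (insert rV scratch) s t \<and> ready q a t \<and>
    tape t = memory a (reduce q (fold (unrelax nbs) (rev [0..<n]) y)) \<and>
    clock t \<le> clock s + (edges + 4 * n) * G + 3" for t
  have loop: "wp (Loop (test rV) (one rE ;; sub rV rV rE ;; update submod)) Q t" if "P 0 t" for t
    using that
  proof (rule wp_Loop)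
    fix i t assume i: "i < n" and t: "P i t"
    let ?y = "fold (unrelax nbs) (rev [n - i..<n]) y"
    define v where "v = n - Suc i"
    have v: "v < n" "n - i = Suc v" using i by (auto simp: v_def)
    have body: "wp (update submod) (P (Suc i)) t'"
      if t': "keeps (insert rV scratch) s t'" "ready q a t'" "regs t' rV = v" "tape t' = memory a (reduce q ?y)"
        "clock t' \<le> clock s + 5 + (\<Sum>v=n-i..<n. (length (nbs v) + 4) * G)" for t'
    proof (rule wp_mono[OF wp_update_sub[OF t'(2,4,3) v(1)]], goal_cases)
      case (1 t2)
      have "[v..<n] = v # [Suc v..<n]" "(\<Sum>v=v..<n. (length (nbs v) + 4) * G) =
          (length (nbs v) + 4) * G + (\<Sum>v=Suc v..<n. (length (nbs v) + 4) * G)"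
        using v(1) by (simp_all add: upt_conv_Cons sum.atLeast_Suc_lessThan)
      then show ?case
        using 1 t' by (simp add: P_def keeps_def ready_def tick_def v v_def[symmetric] G_def algebra_simps)
    qed
    have "(Suc v + 2 ^ L - 1) mod 2 ^ L = v" using v(1) n_less by simp
    moreover have "regs t rV = Suc v" using t v by (simp add: P_def)
    ultimately show "wp (test rV) (\<lambda>t. flag t \<and> wp (one rE ;; sub rV rV rE ;; update submod) (P (Suc i)) (tick t)) t"
      by (simp add: tick_def) (rule body; use t in \<open>simp add: P_def keeps_def ready_def\<close>)
  next
    fix t assume t: "P n t"
    have "(\<Sum>v=0..<n. (length (nbs v) + 4) * G) = (edges + 4 * n) * G"
      by (simp add: edges_def sum.distrib atLeast0LessThan flip: sum_distrib_right)
    then show "wp (test rV) (\<lambda>t. \<not> flag t \<and> Q (tick t)) t"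
      using t by (simp add: P_def Q_def keeps_def ready_def tick_def)
  qed
  have "wp round_down Q s"
    unfolding round_down_def
    by (simp, rule loop) (use assms in \<open>simp add: P_def keeps_def ready_def tick_def\<close>)
  then show ?thesis by (simp add: Q_def[abs_def] G_def)
qed

lemma wp_pass:
  assumes c: "\<And>s y. ready q a s \<Longrightarrow> tape s = memory a (reduce q y) \<Longrightarrow>
      wp c (\<lambda>t. keeps (insert rV scratch) s t \<and> ready q a t \<and> tape t = memory a (reduce q (h y)) \<and>
        clock t \<le> clock s + T) s"
    and s: "ready q a s" "tape s = memory a (reduce q y)"
  shows "wp (pass c) (\<lambda>t. keeps ({rR, rV} \<union> scratch) s t \<and> ready q a t \<and>
    tape t = memory a (reduce q ((h ^^ n) y)) \<and> clock t \<le> clock s + n * (T + 4) + 3) s"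
proof -
  define P where "P i t \<longleftrightarrow> keeps ({rR, rV} \<union> scratch) s t \<and> ready q a t \<and> regs t rR = i \<and>
    tape t = memory a (reduce q ((h ^^ i) y)) \<and> clock t \<le> clock s + 1 + i * (T + 4)" for i t
  define Q where "Q t \<longleftrightarrow> keeps ({rR, rV} \<union> scratch) s t \<and> ready q a t \<and>
    tape t = memory a (reduce q ((h ^^ n) y)) \<and> clock t \<le> clock s + n * (T + 4) + 3" for t
  have loop: "wp (Loop (below rR rN) (c ;; one rE ;; add rR rR rE)) Q t" if "P 0 t" for t
    using that
  proof (rule wp_Loop)
    fix i t assume i: "i < n" and t: "P i t"
    have body: "wp c (wp (one rE ;; add rR rR rE) (P (Suc i))) t'"
      if t': "keeps ({rR, rV} \<union> scratch) s t'" "ready q a t'" "regs t' rR = i"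
        "tape t' = memory a (reduce q ((h ^^ i) y))" "clock t' \<le> clock s + 3 + i * (T + 4)" for t'
    proof (rule wp_mono[OF c[OF t'(2,4)]], goal_cases)
      case (1 t2)
      have "(i + 1) mod 2 ^ L = Suc i" using i n_less by simp
      then show ?case
        using 1 t' by (simp add: P_def keeps_def ready_def tick_def)
    qed
    have "regs t rR = i" "regs t rN = n" using t by (simp_all add: P_def ready_def)
    then show "wp (below rR rN) (\<lambda>t. flag t \<and> wp (c ;; one rE ;; add rR rR rE) (P (Suc i)) (tick t)) t"
      using i by (simp add: tick_def) (rule body; use t in \<open>simp add: P_def keeps_def ready_def\<close>)
  next
    fix t assume t: "P n t"
    then show "wp (below rR rN) (\<lambda>t. \<not> flag t \<and> Q (tick t)) t"
      by (simp add: P_def Q_def keeps_def ready_def tick_def)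
  qed
  have "wp (pass c) Q s"
    unfolding pass_def
    by (simp, rule loop) (use s in \<open>simp add: P_def keeps_def ready_def tick_def\<close>)
  then show ?thesis by (simp add: Q_def[abs_def])
qed

end

section \<open>Random modulus, search for the shift, and the complete program\<close>

fun draw :: "nat \<Rightarrow> bool stream \<Rightarrow> nat \<Rightarrow> nat" where
  "draw 0 \<omega> acc = acc"
| "draw (Suc k) \<omega> acc = draw k (stl \<omega>) (2 * acc + of_bool (shd \<omega>))"

text \<open>The recursion of \<open>draw\<close> splits off the first coin, as the stream measure
  does; the program appends the newest coin. This equation reconciles the two.\<close>

lemma draw_snoc: "draw (Suc k) \<omega> acc = 2 * draw k \<omega> acc + of_bool (\<omega> !! k)"
proof (induction k arbitrary: \<omega> acc)
  case (Suc k)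
  show ?case
    by (subst draw.simps(2), subst Suc) simp
qed simp

lemma draw_less: "draw k \<omega> 0 < 2 ^ k"
proof (induction k)
  case (Suc k)
  then show ?case unfolding draw_snoc by simp
qed simp

text \<open>If all \<open>n + 1\<close> shifts failed, some register would block two of them. These
  differ by at least \<open>D\<close>, which carries a value from the top \<open>D\<close> numbers
  past the wrap, and by at most \<open>n * D \<le> p - D\<close>, which stops it short of the top
  again.\<close>

lemma exists_clear_shift:
  fixes r :: "nat \<Rightarrow> nat"
  assumes "0 < D" "n * D + D \<le> p"
  shows "\<exists>i\<le>n. \<forall>u<n. (r u + i * D) mod p < p - D"
proof (rule ccontr)
  assume "\<not> ?thesis"
  then have "\<forall>i. \<exists>u. i \<le> n \<longrightarrow> u < n \<and> p - D \<le> (r u + i * D) mod p"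
    by (auto simp: not_less)
  then obtain f where f: "\<And>i. i \<le> n \<Longrightarrow> f i < n \<and> p - D \<le> (r (f i) + i * D) mod p" by metis
  have "card (f ` {..n}) \<le> card {..<n}"
    by (rule card_mono) (use f in auto)
  then have "\<not> inj_on f {..n}"
    using card_image[of f "{..n}"] by auto
  then obtain i j where ij: "i < j" "j \<le> n" "f i = f j"
    unfolding inj_on_def by (metis atMost_iff linorder_neqE_nat)
  define w where "w = (r (f i) + i * D) mod p"
  have w: "p - D \<le> w" "w < p" using f[of i] ij assms by (auto simp: w_def)
  obtain d where d: "j = i + d" "0 < d" using ij(1) less_imp_add_positive by blast
  have "(r (f j) + j * D) mod p = (w + d * D) mod p"
    unfolding w_def ij(3)[symmetric] by (simp add: d(1) mod_add_left_eq add_mult_distrib add.assoc)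
  moreover have dD: "D \<le> d * D" "d * D \<le> n * D"
    using ij d by (auto intro: mult_le_mono1)
  have "(w + d * D) mod p = w + d * D - p"
    by (rule mod_plus_self) (use w dD assms in linarith)+
  moreover have "w + d * D - p < p - D"
    using w dD assms by linarith
  ultimately have "(r (f j) + j * D) mod p < p - D" by simp
  then show False using f[of j] ij by auto
qed

definition "read_input =
  Prim (Query Num_Vertices) ;; Prim (Fetch rN) ;; Prim (Query Source) ;; Prim (Fetch rS) ;;
  Prim (Query Target) ;; Prim (Fetch rT)"

definition "draw_bit = add rQ rQ rQ ;; Prim Flip ;; Cond (one rH ;; add rQ rQ rH) Skip"

text \<open>The loop runs once for each bit of \<open>n\<close>, since \<open>rP\<close> is doubled while it is at most \<open>n\<close>. Until the
  last instruction, \<open>rQ\<close> holds \<open>\<delta>\<close>.\<close>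

definition "choose_modulus =
  one rP ;; one rD ;; clear rQ ;; one rE ;; add rE rE rN ;;
  Loop (below rP rE) (add rP rP rP ;; draw_bit ;; draw_bit ;; add rD rD rD ;; add rD rD rD) ;;
  clear rH ;; sub rH rH rD ;; one rE ;; add rQ rQ rE ;; clear rP ;; sub rQ rP rQ"

text \<open>The threshold in \<open>rH\<close> does not exceed any candidate modulus, so the shift
  that passes the scan is valid for every \<open>\<delta>\<close>.\<close>

definition "scan = clear rB ;; clear rU ;;
  Loop (below rU rN) (load ;; below rX rH ;; Cond Skip (one rB) ;; one rE ;; add rU rU rE) ;; test rB"

definition "choose_shift = clear rAl ;; Loop scan (add rAl rAl rD)"

definition "probe d = pass round_up ;; copy rU rT ;; load ;; copy d rX ;; pass round_down"

definition "perturb f = copy rU rS ;; load ;; one rY ;; f rX rY ;; save"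

definition "decide = read_input ;; choose_modulus ;; choose_shift ;;
  probe rA ;; perturb addmod ;; probe rB ;; perturb submod ;; sub rA rA rB ;; test rA ;; Prim Emit"

context layout
begin

definition content :: "nat \<Rightarrow> nat" where
  "content u = number_of_bits (map (\<lambda>j. \<tau> (u + n * j)) [0..<L])"

lemma content_less: "content u < 2 ^ L"
  unfolding content_def using horner_sum_of_bool_2_less[of "map (\<lambda>j. \<tau> (u + n * j)) [0..<L]"] by simp

text \<open>A shift is only a change of view: for every \<open>a\<close> the untouched tape already
  is a memory image. This is why the search for \<open>a\<close> writes nothing.\<close>

lemma memory_content: "a < 2 ^ L \<Longrightarrow> memory a (\<lambda>u. (content u + a) mod 2 ^ L) = \<tau>"
proof
  fix b assume a: "a < 2 ^ L"
  have "b div n < L" if "b < n * L" using that by (simp add: less_mult_imp_div_less mult.commute)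
  then show "memory a (\<lambda>u. (content u + a) mod 2 ^ L) b = \<tau> b"
    using mod_complement(2)[OF content_less a]
    by (simp add: memory_def encode_def) (simp add: content_def bit_horner_sum_bit_iff)
qed

lemma memory_cong: "(\<And>u. u < n \<Longrightarrow> x u = y u) \<Longrightarrow> memory a x = memory a y"
  using n_pos by (simp add: memory_def encode_def fun_eq_iff)

end

text \<open>Additivity makes the unknown initial content cancel in the difference of the two
  readings.\<close>

lemma fold_relax_add: "fold (relax nbs) vs (\<lambda>u. y u + z u) = (\<lambda>u. fold (relax nbs) vs y u + fold (relax nbs) vs z u)"
proof (induction vs arbitrary: y z)
  case (Cons v vs)
  have "relax nbs v (\<lambda>u. y u + z u) = (\<lambda>u. relax nbs v y u + relax nbs v z u)"
    by (auto simp: relax_def fun_eq_iff sum_list_addf)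
  then show ?case by (simp add: Cons)
qed simp

text \<open>Without a loop at \<open>v\<close>, the neighbour sum is the same before and after the
  update and can be subtracted again.\<close>

lemma unrelax_relax: "v \<notin> set (nbs v) \<Longrightarrow> unrelax nbs v (relax nbs v y) = y"
proof -
  assume "v \<notin> set (nbs v)"
  then have "map (relax nbs v y) (nbs v) = map y (nbs v)"
    unfolding relax_def by (intro map_cong) auto
  then have "unrelax nbs v (relax nbs v y) = (relax nbs v y)(v := relax nbs v y v - sum_list (map y (nbs v)))"
    by (simp only: unrelax_def)
  then show ?thesis by (simp add: relax_def)
qed

lemma fold_unrelax_relax:
  "\<forall>v\<in>set vs. v \<notin> set (nbs v) \<Longrightarrow> fold (unrelax nbs) (rev vs) (fold (relax nbs) vs y) = y"
  by (induction vs arbitrary: y) (simp_all add: unrelax_relax)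

lemma funpow_inverse:
  fixes f g :: "'a \<Rightarrow> 'a"
  assumes "\<And>y. g (f y) = y"
  shows "(g ^^ k) ((f ^^ k) y) = y"
proof (induction k)
  case (Suc k)
  have "(g ^^ Suc k) z = (g ^^ k) (g z)" for z
    by (simp add: funpow_swap1)
  then show ?case using Suc assms by simp
qed simp

context network
begin

abbreviation "sweep \<equiv> fold (relax nbs) [0..<n]"

lemma wp_pass_up:
  assumes "ready q a s" "tape s = memory a (reduce q y)"
  shows "wp (pass round_up) (\<lambda>t. keeps ({rR, rV} \<union> scratch) s t \<and> ready q a t \<and>
    tape t = memory a (reduce q ((sweep ^^ n) y)) \<and>
    clock t \<le> clock s + n * ((edges + 4 * n) * (8 * L + 25) + 7) + 3) s"
proof -
  have "wp (pass round_up) (\<lambda>t. keeps ({rR, rV} \<union> scratch) s t \<and> ready q a t \<and>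
    tape t = memory a (reduce q ((sweep ^^ n) y)) \<and>
    clock t \<le> clock s + n * ((edges + 4 * n) * (8 * L + 25) + 3 + 4) + 3) s"
    using wp_pass[where T = "(edges + 4 * n) * (8 * L + 25) + 3", OF _ assms] wp_round_up
    by (simp only: add.assoc)
  then show ?thesis by (simp add: add.assoc)
qed

lemma wp_pass_down:
  assumes "ready q a s" "tape s = memory a (reduce q y)"
  shows "wp (pass round_down) (\<lambda>t. keeps ({rR, rV} \<union> scratch) s t \<and> ready q a t \<and>
    tape t = memory a (reduce q ((fold (unrelax nbs) (rev [0..<n]) ^^ n) y)) \<and>
    clock t \<le> clock s + n * ((edges + 4 * n) * (8 * L + 25) + 7) + 3) s"
proof -
  have "wp (pass round_down) (\<lambda>t. keeps ({rR, rV} \<union> scratch) s t \<and> ready q a t \<and>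
    tape t = memory a (reduce q ((fold (unrelax nbs) (rev [0..<n]) ^^ n) y)) \<and>
    clock t \<le> clock s + n * ((edges + 4 * n) * (8 * L + 25) + 3 + 4) + 3) s"
    using wp_pass[where T = "(edges + 4 * n) * (8 * L + 25) + 3", OF _ assms] wp_round_down
    by (simp only: add.assoc)
  then show ?thesis by (simp add: add.assoc)
qed

text \<open>The pass is undone already on integer vectors, so the tape returns to its former state
  while \<open>d\<close> retains the reading.\<close>

lemma wp_probe:
  assumes "ready q a s" "tape s = memory a (reduce q y)" "regs s rT = v" "v < n" "d \<in> {rA, rB}"
  shows "wp (probe d) (\<lambda>t. keeps ({d, rR, rV} \<union> scratch) s t \<and> ready q a t \<and> tape t = tape s \<and>
    regs t d = reduce q ((sweep ^^ n) y) v \<and>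
    clock t \<le> clock s + 2 * n * ((edges + 4 * n) * (8 * L + 25) + 7) + (8 * L + 25)) s"
  unfolding probe_def wp_Seq
proof (rule wp_mono[OF wp_pass_up[OF assms(1,2)]], goal_cases)
  case (1 t)
  define T where "T = n * ((edges + 4 * n) * (8 * L + 25) + 7)"
  let ?y = "(sweep ^^ n) y"
  have inv: "((fold (unrelax nbs) (rev [0..<n])) ^^ n) ?y = y"
    by (rule funpow_inverse, rule fold_unrelax_relax) (use no_loop in auto)
  define t1 where "t1 = tick (prim_step I L (Arith Move rU rT rT) t)"
  have t1: "keeps ({d, rR, rV} \<union> scratch) s t1" "ready q a t1" "tape t1 = memory a (reduce q ?y)"
    "regs t1 rU = v" "clock t1 \<le> clock s + T + 4"
    using 1 assms(3,5) by (auto simp add: t1_def tick_def keeps_def ready_def T_def algebra_simps)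
  have "wp load (wp (copy d rX) (wp (pass round_down) (\<lambda>t. keeps ({d, rR, rV} \<union> scratch) s t \<and> ready q a t \<and>
    tape t = tape s \<and> regs t d = reduce q ((sweep ^^ n) y) v \<and>
    clock t \<le> clock s + 2 * n * ((edges + 4 * n) * (8 * L + 25) + 7) + (8 * L + 25)))) t1"
  proof (rule wp_mono[OF load_reduce[OF t1(2,3,4) assms(4)]], goal_cases)
    case (1 t2)
    define t3 where "t3 = tick (prim_step I L (Arith Move d rX rX) t2)"
    have t3: "keeps ({d, rR, rV} \<union> scratch) s t3" "ready q a t3" "tape t3 = memory a (reduce q ?y)"
      "regs t3 d = reduce q ?y v" "clock t3 \<le> clock s + T + 8 * L + 13"
      using 1 t1 assms(5) by (auto simp add: t3_def tick_def keeps_def ready_def)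
    have "wp (pass round_down) (\<lambda>t. keeps ({d, rR, rV} \<union> scratch) s t \<and> ready q a t \<and>
      tape t = tape s \<and> regs t d = reduce q ((sweep ^^ n) y) v \<and>
      clock t \<le> clock s + 2 * n * ((edges + 4 * n) * (8 * L + 25) + 7) + (8 * L + 25)) t3"
    proof (rule wp_mono[OF wp_pass_down[OF t3(2,3)]], goal_cases)
      case (1 t4)
      have "keeps ({d, rR, rV} \<union> scratch) s t4"
        by (rule keeps_trans[OF t3(1)]) (use 1 in auto)
      moreover have "regs t4 d = reduce q ?y v"
        using 1 t3(4) assms(5) by (auto simp: keeps_def)
      moreover have "clock t4 \<le> clock t3 + T + 3" using 1 by (simp add: T_def algebra_simps)
      moreover have "2 * n * ((edges + 4 * n) * (8 * L + 25) + 7) = 2 * T" by (simp add: T_def)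
      ultimately show ?case using 1 t3(5) assms(2) inv by simp
    qed
    then show ?case by (simp add: t3_def)
  qed
  then show ?case by (simp add: t1_def)
qed

lemma wp_perturb:
  assumes f: "\<And>s y z. ready q a s \<Longrightarrow> regs s rX = nat (y mod int q) \<Longrightarrow> regs s rY = nat (z mod int q) \<Longrightarrow>
      wp (f rX rY) (\<lambda>t. keeps {rX} s t \<and> ready q a t \<and> tape t = tape s \<and>
        regs t rX = nat (h y z mod int q) \<and> clock t \<le> clock s + 5) s"
    and s: "ready q a s" "tape s = memory a (reduce q y)" "regs s rS = v" "v < n" "1 < q"
  shows "wp (perturb f) (\<lambda>t. keeps scratch s t \<and> ready q a t \<and>
    tape t = memory a (reduce q (y(v := h (y v) 1))) \<and> clock t \<le> clock s + 2 * (8 * L + 25)) s"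
  unfolding perturb_def wp_Seq
proof -
  let ?Q = "\<lambda>t. keeps scratch s t \<and> ready q a t \<and>
    tape t = memory a (reduce q (y(v := h (y v) 1))) \<and> clock t \<le> clock s + 2 * (8 * L + 25)"
  define t1 where "t1 = tick (prim_step I L (Arith Move rU rS rS) s)"
  have t1: "keeps scratch s t1" "ready q a t1" "tape t1 = memory a (reduce q y)"
    "regs t1 rU = v" "clock t1 \<le> clock s + 1"
    using s by (simp_all add: t1_def tick_def keeps_def ready_def)
  have "wp load (wp (one rY) (wp (f rX rY) (wp save ?Q))) t1"
  proof (rule wp_mono[OF load_reduce[OF t1(2,3,4) s(4)]], goal_cases)
    case (1 t2)
    define t3 where "t3 = tick (prim_step I L (Arith Unit rY rY rY) t2)"
    \<comment> \<open>Here \<open>1 < q\<close> enters: the constant 1 in \<open>rY\<close> must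
      itself be a residue.\<close>
    have t3: "keeps scratch s t3" "ready q a t3" "tape t3 = memory a (reduce q y)" "regs t3 rU = v"
      "regs t3 rX = nat (y v mod int q)" "regs t3 rY = nat (1 mod int q)" "clock t3 \<le> clock s + 8 * L + 10"
      using 1 t1 s(5) by (auto simp: t3_def tick_def keeps_def ready_def reduce_def)
    have "wp (f rX rY) (wp save ?Q) t3"
    proof (rule wp_mono[OF f[OF t3(2,5,6)]], goal_cases)
      case (1 t4)
      have "wp save (\<lambda>t. keeps {rAdr, rCur, rX} t4 t \<and> ready q a t \<and>
        tape t = memory a (reduce q (y(v := h (y v) 1))) \<and> clock t \<le> clock t4 + 8 * L + 8) t4"
        by (rule save_reduce) (use t3 1 s in \<open>auto simp: keeps_def\<close>)
      then show ?case
      proof (rule wp_mono, goal_cases)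
        case (1 t5)
        then have "keeps scratch s t5"
          using t3(1) \<open>keeps {rX} t3 t4 \<and> _\<close> by (auto simp: keeps_def)
        then show ?case using 1 t3(7) \<open>keeps {rX} t3 t4 \<and> _\<close> by simp
      qed
    qed
    then show ?case by (simp add: t3_def)
  qed
  then show "wp (copy rU rS) (wp load (wp (one rY) (wp (f rX rY) (wp save ?Q)))) s"
    by (simp add: t1_def)
qed

end

context layout
begin

lemma wp_draw_bit:
  assumes "regs s rQ = draw k \<omega> 0" "flips s = sdrop k \<omega>" "Suc k < L"
  shows "wp draw_bit (\<lambda>t. (\<forall>r. r \<notin> {rQ, rH} \<longrightarrow> regs t r = regs s r) \<and> regs t rQ = draw (Suc k) \<omega> 0 \<and>
    flips t = sdrop (Suc k) \<omega> \<and> tape t = tape s \<and> verdict t = verdict s \<and> index1 t = index1 s \<and>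
    index2 t = index2 s \<and> clock t \<le> clock s + 5) s"
proof -
  have "draw (Suc k) \<omega> 0 < 2 ^ Suc k" by (rule draw_less)
  also have "\<dots> < 2 ^ L" using assms(3) by (rule power_strict_increasing) simp
  finally have "(draw k \<omega> 0 + draw k \<omega> 0) mod 2 ^ L = 2 * draw k \<omega> 0"
    "(2 * draw k \<omega> 0 + of_bool (\<omega> !! k)) mod 2 ^ L = draw (Suc k) \<omega> 0"
    unfolding draw_snoc by simp_all
  then show ?thesis
    using assms(1,2) by (cases "\<omega> !! k") (simp_all add: draw_bit_def tick_def draw_snoc del: draw.simps)
qed

lemma wp_choose_modulus:
  fixes b :: nat and s :: store
  defines "\<delta> \<equiv> draw (2 * b) (flips s) 0"
  assumes b: "b = length (bits_of_number n)" "L = 8 * b"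
    and s: "regs s rN = n" "index1 s = []" "index2 s = []"
  shows "wp choose_modulus (\<lambda>t. (\<forall>r. r \<notin> {rP, rD, rQ, rE, rH} \<longrightarrow> regs t r = regs s r) \<and>
    regs t rD = 4 ^ b \<and> regs t rH = 2 ^ L - 4 ^ b \<and> regs t rQ = 2 ^ L - 1 - \<delta> \<and>
    tape t = tape s \<and> verdict t = verdict s \<and> index1 t = [] \<and> index2 t = [] \<and>
    clock t \<le> clock s + 15 * b + 13) s"
proof -
  have b_le: "2 ^ i \<le> n \<longleftrightarrow> i < b" for i
    using length_bits_of_number_le[of n i] b(1) by linarith
  have b0: "0 < b" using L_pos b(2) by simp
  have n_b: "n < 2 ^ b" using b_le[of b] by simp
  let ?body = "add rP rP rP ;; draw_bit ;; draw_bit ;; add rD rD rD ;; add rD rD rD"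
  let ?rest = "clear rH ;; sub rH rH rD ;; one rE ;; add rQ rQ rE ;; clear rP ;; sub rQ rP rQ"
  define P where "P i t \<longleftrightarrow> (\<forall>r. r \<notin> {rP, rD, rQ, rE, rH} \<longrightarrow> regs t r = regs s r) \<and>
    regs t rP = 2 ^ i \<and> regs t rD = 4 ^ i \<and> regs t rQ = draw (2 * i) (flips s) 0 \<and> regs t rE = Suc n \<and>
    flips t = sdrop (2 * i) (flips s) \<and> tape t = tape s \<and> verdict t = verdict s \<and> index1 t = [] \<and> index2 t = [] \<and>
    clock t \<le> clock s + 15 * i + 5" for i and t :: store
  define Q where "Q t \<longleftrightarrow> (\<forall>r. r \<notin> {rP, rD, rQ, rE, rH} \<longrightarrow> regs t r = regs s r) \<and>
    regs t rD = 4 ^ b \<and> regs t rH = 2 ^ L - 4 ^ b \<and> regs t rQ = 2 ^ L - 1 - \<delta> \<and>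
    tape t = tape s \<and> verdict t = verdict s \<and> index1 t = [] \<and> index2 t = [] \<and>
    clock t \<le> clock s + 15 * b + 13" for t :: store
  have four: "(4::nat) ^ b = 2 ^ (2 * b)" by (simp add: power_mult)
  have four_less: "(4::nat) ^ b < 2 ^ L"
    unfolding four using b(2) b0 by (intro power_strict_increasing) auto
  have loop: "wp (Loop (below rP rE) ?body) (wp ?rest Q) t" if "P 0 t" for t
    using that
  proof (rule wp_Loop)
    fix i t assume i: "i < b" and t: "P i t"
    have "(2::nat) ^ Suc i < 2 ^ L" using i b(2) by (intro power_strict_increasing) auto
    then have m1: "(2 ^ i + 2 ^ i) mod 2 ^ L = (2::nat) ^ Suc i" by (simp add: mult_2)
    have "(4::nat) ^ Suc i \<le> 4 ^ b" using i by (intro power_increasing) auto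
    then have "(4::nat) ^ Suc i < 2 ^ L" using four_less by (rule le_less_trans)
    then have m2: "(4 ^ i + 4 ^ i) mod 2 ^ L = 2 * (4::nat) ^ i"
      "(2 * 4 ^ i + 2 * 4 ^ i) mod 2 ^ L = (4::nat) ^ Suc i" by simp_all
    have body: "wp draw_bit (wp (draw_bit ;; add rD rD rD ;; add rD rD rD) (P (Suc i))) t'"
      if t': "\<forall>r. r \<notin> {rP, rD, rQ, rE, rH} \<longrightarrow> regs t' r = regs s r"
    "regs t' rP = 2 ^ Suc i" "regs t' rD = 4 ^ i" "regs t' rQ = draw (2 * i) (flips s) 0" "regs t' rE = Suc n"
    "flips t' = sdrop (2 * i) (flips s)" "tape t' = tape s" "verdict t' = verdict s" "index1 t' = []" "index2 t' = []"
    "clock t' \<le> clock s + 15 * i + 8" for t' :: store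
    proof (rule wp_mono[OF wp_draw_bit[OF t'(4,6)]], goal_cases)
      case 1
      then show ?case using i b(2) by simp
    next
      case (2 t1)
      show ?case
        unfolding wp_Seq
      proof (rule wp_mono[OF wp_draw_bit[where k = "Suc (2 * i)" and \<omega> = "flips s"]], goal_cases)
        case (4 t2)
        then show ?case
          using 2 t' m2 by (simp add: P_def tick_def del: draw.simps sdrop.simps)
      qed (use 2 i b(2) in \<open>simp_all del: draw.simps sdrop.simps\<close>)
    qed
    have "2 ^ i < Suc n" using b_le[of i] i by simp
    moreover have "regs t rP = 2 ^ i" "regs t rE = Suc n" using t by (simp_all add: P_def)
    ultimately show "wp (below rP rE) (\<lambda>t. flag t \<and> wp ?body (P (Suc i)) (tick t)) t"
      using m1 by (simp add: tick_def) (rule body; use t in \<open>simp add: P_def\<close>)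
  next
    fix t assume t: "P b t"
    have "\<delta> < 4 ^ b" unfolding \<delta>_def four by (rule draw_less)
    \<comment> \<open>\<open>2 ^ L\<close> does not fit in a register, so \<open>rH\<close> and
      \<open>rQ\<close> are formed as the negatives of \<open>\<Delta>\<close> and of
      \<open>\<delta> + 1\<close> modulo \<open>2 ^ L\<close>.\<close>
    then have d: "(\<delta> + 1) mod 2 ^ L = \<delta> + 1" "(2 ^ L - 4 ^ b) mod 2 ^ L = (2 ^ L - 4 ^ b :: nat)"
      "(2 ^ L - (\<delta> + 1)) mod 2 ^ L = 2 ^ L - 1 - \<delta>" using four_less by simp_all
    have "\<not> 2 ^ b < Suc n" using n_b by simp
    then show "wp (below rP rE) (\<lambda>t. \<not> flag t \<and> wp ?rest Q (tick t)) t"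
      using t d by (simp add: P_def Q_def tick_def \<delta>_def[symmetric])
  qed
  have e: "(1 + n) mod 2 ^ L = Suc n"
  proof -
    have "n + 1 < 2 ^ L"
      using n_L n_pos L_pos by (cases n; cases L) simp_all
    then show ?thesis by simp
  qed
  have "wp choose_modulus Q s"
    unfolding choose_modulus_def
    by (simp, rule loop) (use e s in \<open>simp add: P_def tick_def\<close>)
  then show ?thesis by (simp add: Q_def[abs_def])
qed

end

context network
begin

lemma wp_scan:
  assumes "tape s = memory a x" "\<And>u. u < n \<Longrightarrow> x u < 2 ^ L" "a < 2 ^ L"
    "regs s rN = n" "regs s rAl = a" "regs s rH = h" "index1 s = []" "index2 s = []"
  shows "wp scan (\<lambda>t. keeps {rB, rU, rE, rAdr, rCur, rX} s t \<and> tape t = tape s \<and>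
    (flag t \<longleftrightarrow> (\<exists>u<n. h \<le> x u)) \<and> clock t \<le> clock s + n * (8 * L + 15) + 5) s"
proof -
  define P where "P i t \<longleftrightarrow> keeps {rB, rU, rE, rAdr, rCur, rX} s t \<and> tape t = tape s \<and>
    regs t rU = i \<and> regs t rB = of_bool (\<exists>u<i. h \<le> x u) \<and> clock t \<le> clock s + i * (8 * L + 15) + 2" for i t
  define Q where "Q t \<longleftrightarrow> keeps {rB, rU, rE, rAdr, rCur, rX} s t \<and> tape t = tape s \<and>
    (flag t \<longleftrightarrow> (\<exists>u<n. h \<le> x u)) \<and> clock t \<le> clock s + n * (8 * L + 15) + 5" for t
  have loop: "wp (Loop (below rU rN) (load ;; below rX rH ;; Cond Skip (one rB) ;; one rE ;; add rU rU rE))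
    (wp (test rB) Q) t" if "P 0 t" for t
    using that
  proof (rule wp_Loop)
    fix i t assume i: "i < n" and t: "P i t"
    have m: "(i + 1) mod 2 ^ L = Suc i" using i n_less by simp
    have body: "wp load (wp (below rX rH ;; Cond Skip (one rB) ;; one rE ;; add rU rU rE) (P (Suc i))) t'"
      if t': "keeps {rB, rU, rE, rAdr, rCur, rX} s t'" "tape t' = tape s"
    "regs t' rU = i" "regs t' rB = of_bool (\<exists>u<i. h \<le> x u)" "clock t' \<le> clock s + i * (8 * L + 15) + 4" for t'
    proof (rule wp_mono[OF wp_load[of _ a x i]], goal_cases)
      case (10 t2)
      have "(\<exists>u<Suc i. h \<le> x u) \<longleftrightarrow> h \<le> x i \<or> (\<exists>u<i. h \<le> x u)" by (auto simp: less_Suc_eq)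
      then show ?case
        using 10 t' m assms(6) by (simp add: P_def keeps_def tick_def not_less)
    qed (use i t' assms in \<open>auto simp: keeps_def\<close>)
    have "regs t rU = i" "regs t rN = n" using t assms(4) by (simp_all add: P_def keeps_def)
    then show "wp (below rU rN) (\<lambda>t. flag t \<and> wp (load ;; below rX rH ;; Cond Skip (one rB) ;; one rE ;; add rU rU rE)
        (P (Suc i)) (tick t)) t"
      using i by (simp add: tick_def) (rule body; use t in \<open>simp add: P_def keeps_def\<close>)
  next
    fix t assume "P n t"
    then show "wp (below rU rN) (\<lambda>t. \<not> flag t \<and> wp (test rB) Q (tick t)) t"
      using assms(4) by (simp add: P_def Q_def keeps_def tick_def)
  qed
  have "wp scan Q s"
    unfolding scan_def
    by (simp, rule loop) (use assms in \<open>simp add: P_def keeps_def tick_def\<close>)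
  then show ?thesis by (simp add: Q_def[abs_def])
qed

lemma wp_choose_shift:
  assumes "tape s = \<tau>" "regs s rN = n" "regs s rD = D" "regs s rH = 2 ^ L - D" "index1 s = []" "index2 s = []"
    and D: "0 < D" "n * D + D \<le> 2 ^ L"
  shows "wp choose_shift (\<lambda>t. \<exists>a<2 ^ L. keeps {rAl, rB, rU, rE, rAdr, rCur, rX} s t \<and> tape t = \<tau> \<and>
    regs t rAl = a \<and> (\<forall>u<n. (content u + a) mod 2 ^ L < 2 ^ L - D) \<and>
    clock t \<le> clock s + (n + 1) * (n * (8 * L + 15) + 7) + 1) s"
proof -
  define clr where "clr i \<longleftrightarrow> (\<forall>u<n. (content u + i * D) mod 2 ^ L < 2 ^ L - D)" for i
  \<comment> \<open>The machine stops at the first clear shift, so the least one is the exact number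
    of rounds.\<close>
  define k where "k = (LEAST i. clr i)"
  have ex: "\<exists>i\<le>n. clr i" unfolding clr_def by (rule exists_clear_shift[OF D])
  then have k: "clr k" "k \<le> n"
    unfolding k_def by (auto intro: LeastI Least_le order_trans)
  have k_least: "\<not> clr i" if "i < k" for i using that not_less_Least unfolding k_def by blast
  have a_less: "i * D < 2 ^ L" if "i \<le> n" for i
    using D mult_le_mono1[OF that, of D] by linarith
  define P where "P i t \<longleftrightarrow> keeps {rAl, rB, rU, rE, rAdr, rCur, rX} s t \<and> tape t = \<tau> \<and>
    regs t rAl = i * D \<and> clock t \<le> clock s + i * (n * (8 * L + 15) + 7) + 1" for i t
  define Q where "Q t \<longleftrightarrow> (\<exists>a<2 ^ L. keeps {rAl, rB, rU, rE, rAdr, rCur, rX} s t \<and> tape t = \<tau> \<and>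
    regs t rAl = a \<and> (\<forall>u<n. (content u + a) mod 2 ^ L < 2 ^ L - D) \<and>
    clock t \<le> clock s + (n + 1) * (n * (8 * L + 15) + 7) + 1)" for t
  have scan: "wp scan (\<lambda>t2. keeps {rB, rU, rE, rAdr, rCur, rX} t t2 \<and> tape t2 = tape t \<and>
      (flag t2 \<longleftrightarrow> \<not> clr i) \<and> clock t2 \<le> clock t + n * (8 * L + 15) + 5) t"
    if i: "i \<le> n" and t: "P i t" for i t
  proof -
    have "wp scan (\<lambda>t2. keeps {rB, rU, rE, rAdr, rCur, rX} t t2 \<and> tape t2 = tape t \<and>
      (flag t2 \<longleftrightarrow> (\<exists>u<n. 2 ^ L - D \<le> (content u + i * D) mod 2 ^ L)) \<and>
      clock t2 \<le> clock t + n * (8 * L + 15) + 5) t"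
    proof (rule wp_scan)
      show "tape t = memory (i * D) (\<lambda>u. (content u + i * D) mod 2 ^ L)"
        using t by (simp add: P_def memory_content[OF a_less[OF i]])
    qed (use t a_less[OF i] assms in \<open>auto simp: P_def keeps_def\<close>)
    moreover have "\<not> clr i \<longleftrightarrow> (\<exists>u<n. 2 ^ L - D \<le> (content u + i * D) mod 2 ^ L)"
      by (auto simp: clr_def not_less)
    ultimately show ?thesis by simp
  qed
  have loop: "wp (Loop scan (add rAl rAl rD)) Q t" if "P 0 t" for t
    using that
  proof (rule wp_Loop)
    fix i t assume i: "i < k" and t: "P i t"
    have "i \<le> n" using i k(2) by simp
    show "wp scan (\<lambda>t. flag t \<and> wp (add rAl rAl rD) (P (Suc i)) (tick t)) t"
    proof (rule wp_mono[OF scan[OF \<open>i \<le> n\<close> t]], goal_cases)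
      case (1 t2)
      have "(i * D + D) mod 2 ^ L = Suc i * D" using a_less[of "Suc i"] i k(2) by (simp add: add.commute)
      then show ?case
        using 1 t k_least[OF i] assms(3) by (simp add: P_def keeps_def tick_def add.commute)
    qed
  next
    fix t assume t: "P k t"
    show "wp scan (\<lambda>t. \<not> flag t \<and> Q (tick t)) t"
    proof (rule wp_mono[OF scan[OF k(2) t]], goal_cases)
      case (1 t2)
      define Z where "Z = n * (8 * L + 15) + 7"
      have "k * Z \<le> n * Z" using k(2) by (rule mult_le_mono1)
      moreover have "clock t \<le> clock s + k * Z + 1" using t by (simp add: P_def Z_def)
      moreover have "clock t2 + 1 \<le> clock t + Z" using 1 by (simp add: Z_def)
      moreover have "(n + 1) * Z = n * Z + Z" by simp
      ultimately have "clock t2 + 1 \<le> clock s + (n + 1) * Z + 1" by linarith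
      then have "clock t2 + 1 \<le> clock s + (n + 1) * (n * (8 * L + 15) + 7) + 1" unfolding Z_def .
      moreover have "regs t2 rAl = k * D" using 1 t by (simp add: P_def keeps_def)
      ultimately show ?case
        using 1 t k(1) a_less[OF k(2)] by (simp add: P_def Q_def keeps_def tick_def clr_def)
    qed
  qed
  have "wp choose_shift Q s"
    unfolding choose_shift_def
    by (simp, rule loop) (use assms in \<open>simp add: P_def keeps_def tick_def\<close>)
  then show ?thesis by (simp add: Q_def[abs_def])
qed

end

lemma sum_mod_eq_iff:
  fixes x y :: nat
  assumes "x < p" "y < p"
  shows "(x + p - y) mod p = 0 \<longleftrightarrow> x = y"
proof (cases "y \<le> x")
  case True
  then have "(x + p - y) mod p = x - y"
    using assms by (intro mod_plus_self) linarith+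
  then show ?thesis using True by simp
next
  case False
  then have "(x + p - y) mod p = x + p - y" using assms by simp
  then show ?thesis using False assms by simp
qed

lemma reduce_eq_iff: "0 < q \<Longrightarrow> reduce q y u = reduce q z u \<longleftrightarrow> int q dvd y u - z u"
proof -
  assume "0 < q"
  then have "y u mod int q \<ge> 0" "z u mod int q \<ge> 0" by simp_all
  then have "reduce q y u = reduce q z u \<longleftrightarrow> y u mod int q = z u mod int q"
    unfolding reduce_def by linarith
  also have "\<dots> \<longleftrightarrow> int q dvd y u - z u" by (rule mod_eq_dvd_iff)
  finally show ?thesis .
qed

context network
begin

lemma sweeps_add: "(sweep ^^ k) (\<lambda>u. y u + z u) = (\<lambda>u. (sweep ^^ k) y u + (sweep ^^ k) z u)"
  by (induction k) (simp_all add: fold_relax_add)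

text \<open>Writing \<open>F\<close> for \<open>sweep ^^ n\<close>, the readings are
  \<open>F y\<close> and \<open>F (y + e)\<close> at the target, both modulo \<open>q\<close>, so
  they agree iff \<open>q\<close> divides \<open>F e\<close> there. Two passes up and two down give
  the factor 4 in the time bound.\<close>

lemma wp_decide:
  fixes \<omega> :: "bool stream" and b \<delta> q :: nat
  defines "b \<equiv> length (bits_of_number n)"
  defines "\<delta> \<equiv> draw (2 * b) \<omega> 0"
  defines "q \<equiv> 2 ^ L - 1 - \<delta>"
  assumes L: "L = 8 * b" and st: "source I < n" "target I < n"
  shows "wp decide (\<lambda>t. tape t = \<tau> \<and>
    verdict t = [\<not> int q dvd (sweep ^^ n) (\<lambda>u. of_bool (u = source I)) (target I)] \<and>
    clock t \<le> (n + 1) * (n * (8 * L + 15) + 7) + 4 * n * ((edges + 4 * n) * (8 * L + 25) + 7) +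
      6 * (8 * L + 25) + 15 * b + 25) (start \<tau> \<omega>)"
proof -
  define v where "v = source I"
  define w where "w = target I"
  define e where "e u = (of_bool (u = v) :: int)" for u
  have b_le: "n < 2 ^ b" using length_bits_of_number_le[of n b] by (simp add: b_def)
  have b0: "0 < b" using L_pos L by simp
  have four: "(4::nat) ^ b = 2 ^ (2 * b)" by (simp add: power_mult)
  have d: "\<delta> < 4 ^ b" unfolding \<delta>_def four by (rule draw_less)
  have "(4::nat) ^ 1 \<le> 4 ^ b" using b0 by (intro power_increasing) auto
  then have b4: "4 \<le> (4::nat) ^ b" by simp
  have "n * 4 ^ b + 4 ^ b = (n + 1) * 4 ^ b" by simp
  also have "\<dots> \<le> 2 ^ b * 4 ^ b" using b_le by (intro mult_le_mono1) simp
  also have "\<dots> = 2 ^ (3 * b)" unfolding four by (simp flip: power_add)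
  also have "\<dots> \<le> 2 ^ L" using L by (intro power_increasing) auto
  finally have room: "n * 4 ^ b + 4 ^ b \<le> (2::nat) ^ L" .
  moreover have "1 * 4 ^ b \<le> n * 4 ^ b" using n_pos by (intro mult_le_mono1) simp
  ultimately have room2: "2 * 4 ^ b \<le> (2::nat) ^ L" by linarith
  have q: "1 < q" "q < 2 ^ L" "2 ^ L - 4 ^ b \<le> q"
    using d b4 room2 unfolding q_def by linarith+
  have f: "number_of_bits (take L (bits_of_number u)) = u" if "u \<le> n" for u
  proof -
    have "length (bits_of_number u) \<le> L"
      unfolding length_bits_of_number_le using that n_less by linarith
    then show ?thesis by (simp add: number_of_bits_of_number)
  qed
  define Q where "Q t \<longleftrightarrow> tape t = \<tau> \<and>
    verdict t = [\<not> int q dvd (sweep ^^ n) e w] \<and>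
    clock t \<le> (n + 1) * (n * (8 * L + 15) + 7) + 4 * n * ((edges + 4 * n) * (8 * L + 25) + 7) +
      6 * (8 * L + 25) + 15 * b + 25" for t :: store
  let ?c6 = "sub rA rA rB ;; test rA ;; Prim Emit"
  let ?c5 = "perturb submod ;; ?c6"
  let ?c4 = "probe rB ;; ?c5"
  let ?c3 = "perturb addmod ;; ?c4"
  let ?c2 = "probe rA ;; ?c3"
  let ?c1 = "choose_shift ;; ?c2"
  define s0 where "s0 = (start \<tau> \<omega>)\<lparr>flag := True, reply := drop L (bits_of_number w),
    regs := (\<lambda>_. 0)(rN := n, rS := v, rT := w), clock := Suc (Suc (Suc (Suc (Suc (Suc 0)))))\<rparr>"
  have main: "wp (choose_modulus ;; ?c1) Q s0"
    unfolding wp_Seq[of choose_modulus]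
  proof (rule wp_mono[OF wp_choose_modulus[OF meta_eq_to_obj_eq[OF b_def] L]], goal_cases)
    case (4 s1)
    have fl: "flips s0 = \<omega>" by (simp add: s0_def start_def)
    from 4 have s1: "regs s1 rN = n" "regs s1 rS = v" "regs s1 rT = w" "regs s1 rD = 4 ^ b"
      "regs s1 rH = 2 ^ L - 4 ^ b" "regs s1 rQ = q" "tape s1 = \<tau>" "verdict s1 = []" "index1 s1 = []"
      "index2 s1 = []" "clock s1 \<le> 15 * b + 19"
      unfolding fl \<delta>_def[symmetric] q_def[symmetric] by (auto simp: s0_def start_def)
    show ?case
      unfolding wp_Seq[of choose_shift]
    proof (rule wp_mono[OF wp_choose_shift[OF s1(7,1,4,5,9,10) _ room]], goal_cases)
      case (2 s2)
      then obtain a where a: "a < 2 ^ L" "keeps {rAl, rB, rU, rE, rAdr, rCur, rX} s1 s2" "tape s2 = \<tau>"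
        "regs s2 rAl = a" "\<And>u. u < n \<Longrightarrow> (content u + a) mod 2 ^ L < 2 ^ L - 4 ^ b"
        "clock s2 \<le> clock s1 + (n + 1) * (n * (8 * L + 15) + 7) + 1" by blast
      define y where "y u = int ((content u + a) mod 2 ^ L)" for u
      \<comment> \<open>All shifted contents lie below \<open>2 ^ L - 4 ^ b \<le> q\<close>, so
        reduction leaves them alone and the arbitrary initial tape represents the vector
        \<open>y\<close>.\<close>
      have ymem: "\<tau> = memory a (reduce q y)"
      proof -
        have "reduce q y u = (content u + a) mod 2 ^ L" if "u < n" for u
          using a(5)[OF that] q(3) by (simp add: reduce_def y_def)
        then show ?thesis using memory_cong[of "reduce q y"] memory_content[OF a(1)] by metis
      qed
      have s2: "ready q a s2" "tape s2 = memory a (reduce q y)" "regs s2 rS = v" "regs s2 rT = w" "verdict s2 = []"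
        using a(2,3,4) a(1) s1 q ymem by (auto simp: ready_def keeps_def)
      define T where "T = 2 * n * ((edges + 4 * n) * (8 * L + 25) + 7) + (8 * L + 25)"
      show ?case
        unfolding wp_Seq[of "probe rA"]
      proof (rule wp_mono[OF wp_probe[OF s2(1,2,4)]], goal_cases)
        case 1 then show ?case using st(2) by (simp add: w_def)
      next
        case 2 show ?case by simp
      next
        case (3 s3)
        then have s3: "ready q a s3" "tape s3 = memory a (reduce q y)" "regs s3 rS = v" "regs s3 rT = w" "verdict s3 = []"
          "regs s3 rA = reduce q ((sweep ^^ n) y) w" "clock s3 \<le> clock s2 + T"
          using s2 by (auto simp: keeps_def T_def)
        have ye: "y(v := y v + 1) = (\<lambda>u. y u + e u)" by (auto simp: e_def fun_eq_iff)
        show ?case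
          unfolding wp_Seq[of "perturb addmod"]
        proof (rule wp_mono[OF wp_perturb[where h = "(+)", OF _ s3(1,2,3)]], goal_cases)
          case (1 s y z) then show ?case by (intro addmod_reduce) simp_all
        next
          case 2 then show ?case using st(1) by (simp add: v_def)
        next
          case 3 show ?case by (rule q(1))
        next
          case (4 s4)
          then have s4: "ready q a s4" "tape s4 = memory a (reduce q (\<lambda>u. y u + e u))" "regs s4 rS = v" "regs s4 rT = w"
            "verdict s4 = []" "regs s4 rA = reduce q ((sweep ^^ n) y) w" "clock s4 \<le> clock s3 + 2 * (8 * L + 25)"
            using s3 unfolding ye by (auto simp: keeps_def)
          show ?case
            unfolding wp_Seq[of "probe rB"]
          proof (rule wp_mono[OF wp_probe[OF s4(1,2,4)]], goal_cases)
            case 1 then show ?case using st(2) by (simp add: w_def)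
          next
            case 2 show ?case by simp
          next
            case (3 s5)
            then have s5: "ready q a s5" "tape s5 = memory a (reduce q (\<lambda>u. y u + e u))" "regs s5 rS = v"
              "verdict s5 = []" "regs s5 rA = reduce q ((sweep ^^ n) y) w"
              "regs s5 rB = reduce q ((sweep ^^ n) (\<lambda>u. y u + e u)) w" "clock s5 \<le> clock s4 + T"
              using s4 by (auto simp: keeps_def T_def)
            have ye': "(\<lambda>u. y u + e u)(v := y v + e v - 1) = y" by (auto simp: e_def fun_eq_iff)
            show ?case
              unfolding wp_Seq[of "perturb submod"]
            proof (rule wp_mono[OF wp_perturb[where h = "(-)", OF _ s5(1,2,3)]], goal_cases)
              case (1 s y z) then show ?case by (intro submod_reduce) simp_all
            next
              case 2 then show ?case using st(1) by (simp add: v_def)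
            next
              case 3 show ?case by (rule q(1))
            next
              case (4 s6)
              then have s6: "tape s6 = \<tau>" "verdict s6 = []" "regs s6 rA = reduce q ((sweep ^^ n) y) w"
                "regs s6 rB = reduce q ((sweep ^^ n) (\<lambda>u. y u + e u)) w" "clock s6 \<le> clock s5 + 2 * (8 * L + 25)"
                using s5 ymem unfolding ye' by (auto simp: keeps_def)
              have less: "reduce q z w < 2 ^ L" for z
                using reduce_less[of q z w] q by linarith
              have "(regs s6 rA + 2 ^ L - regs s6 rB) mod 2 ^ L = 0 \<longleftrightarrow> regs s6 rA = regs s6 rB"
                unfolding s6 by (intro sum_mod_eq_iff less)
              also have "\<dots> \<longleftrightarrow> int q dvd (sweep ^^ n) e w"
                using q(1) unfolding s6 by (simp add: reduce_eq_iff sweeps_add)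
              finally have eq: "(regs s6 rA + 2 ^ L - regs s6 rB) mod 2 ^ L = 0 \<longleftrightarrow> int q dvd (sweep ^^ n) e w" .
              have clock: "clock s6 + 3 \<le> (n + 1) * (n * (8 * L + 15) + 7) + 2 * T + 4 * (8 * L + 25) + 15 * b + 25"
                using s6(5) s5(7) s4(7) s3(7) a(6) s1(11) by linarith
              have "2 * T = 4 * n * ((edges + 4 * n) * (8 * L + 25) + 7) + 2 * (8 * L + 25)"
                by (simp add: T_def)
              with clock have "clock s6 + 3 \<le> (n + 1) * (n * (8 * L + 15) + 7) +
                4 * n * ((edges + 4 * n) * (8 * L + 25) + 7) + 6 * (8 * L + 25) + 15 * b + 25"
                by linarith
              then show ?case
                using s6(1,2) eq by (simp add: Q_def tick_def numeral_3_eq_3)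
            qed
          qed
        qed
      qed
    qed (use b4 in simp)
  qed (simp_all add: s0_def start_def)
  have read: "wp read_input R (start \<tau> \<omega>)" if "R s0" for R
    using that unfolding read_input_def wp_Seq
    by (simp add: start_def tick_def f st less_imp_le vertices s0_def v_def w_def)
  have "wp decide Q (start \<tau> \<omega>)"
    unfolding decide_def wp_Seq[of read_input] by (rule read) (rule main)
  then show ?thesis by (simp add: Q_def[abs_def] e_def[abs_def] v_def w_def)
qed

end

section \<open>Random moduli and walk counts\<close>

text \<open>Leibniz' harmonic triangle: with \<open>A\<close>, \<open>B\<close>, \<open>X\<close> the three products below,
  \<open>1 / X = 1 / A - 1 / B\<close>.\<close>

lemma binomial_dvd_common_multiple:
  fixes m k d :: nat
  assumes "0 < m" "\<And>j. j \<in> {m..m + k} \<Longrightarrow> j dvd d"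
  shows "m * ((m + k) choose m) dvd d"
  using assms
proof (induction k arbitrary: m)
  case 0
  then show ?case by simp
next
  case (Suc k)
  define c where "c = (m + k) choose m"
  define X where "X = m * ((m + Suc k) choose m)"
  have "m * c dvd d" unfolding c_def using Suc.prems by (intro Suc.IH) auto
  then obtain a where a: "d = m * c * a" by (elim dvdE)
  have "Suc m * ((Suc m + k) choose Suc m) dvd d"
    using Suc.prems by (intro Suc.IH) auto
  moreover have "Suc m * ((Suc m + k) choose Suc m) = (m + k + 1) * c"
    using Suc_times_binomial[of m "m + k"] by (simp add: c_def)
  ultimately obtain b where b: "d = (m + k + 1) * c * b" by (metis dvdE)
  have "(k + 1) * X = m * ((k + 1) * ((m + Suc k) choose m))"
    unfolding X_def by (rule mult.left_commute)
  also have "(k + 1) * ((m + Suc k) choose m) = (m + k + 1) * c"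
    using binomial_absorb_comp[of "m + Suc k" m] unfolding c_def by simp
  finally have X: "(k + 1) * X = m * (m + k + 1) * c" by (simp only: mult.assoc)
  \<comment> \<open>With \<open>A = m * c\<close> and \<open>B = (m + k + 1) * c\<close> one has
    \<open>a = d / A\<close> and \<open>b = d / B\<close>, hence \<open>a - b = d / X\<close>. The
    factor \<open>k + 1\<close> clears the denominator in the formula for \<open>X\<close>.\<close>
  have "int (k + 1) * (int X * (int a - int b)) = int ((k + 1) * X) * (int a - int b)"
    by (simp only: of_nat_mult mult.assoc)
  also have "\<dots> = int (m + k + 1) * int (m * c * a) - int m * int ((m + k + 1) * c * b)"
    unfolding X by (simp add: algebra_simps)
  also have "\<dots> = int (m + k + 1) * int d - int m * int d"
    using a b by simp
  also have "\<dots> = int (k + 1) * int d" by (simp add: algebra_simps)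
  finally have "int (k + 1) * (int X * (int a - int b)) = int (k + 1) * int d" .
  then have "int X * (int a - int b) = int d" by simp
  then have "int X dvd int d" by (metis dvd_triv_left)
  then show ?case unfolding X_def by (simp only: int_dvd_int_iff)
qed

text \<open>The common multiple \<open>d\<close> is at most
  \<open>2 ^ (b * n * n + 8 * b * card G)\<close>, the binomial coefficient at least
  \<open>2 ^ (6 * b * (D - 1))\<close>. Since \<open>n * n < D\<close>, comparing exponents leaves
  \<open>5 * (D - 1) \<le> 8 * card G\<close>.\<close>

lemma many_non_divisors:
  fixes b n N :: nat
  assumes "2 \<le> b" "n < 2 ^ b" "0 < N" "N \<le> 2 ^ (b * n * n)"
  shows "4 ^ b \<le> 2 * card {\<delta>. \<delta> < 4 ^ b \<and> \<not> (2 ^ (8 * b) - 1 - \<delta>) dvd N}"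
proof -
  define p where "p = (2::nat) ^ (8 * b)"
  define D where "D = (4::nat) ^ b"
  define G where "G = {\<delta>. \<delta> < D \<and> \<not> (p - 1 - \<delta>) dvd N}"
  define d where "d = N * (\<Prod>\<delta>\<in>G. p - 1 - \<delta>)"
  have fin: "finite G" unfolding G_def by simp
  have four: "D = 2 ^ (2 * b)" by (simp add: D_def power_mult)
  have pD: "p = D * 2 ^ (6 * b)"
    unfolding four p_def by (simp flip: power_add)
  have "(4::nat) ^ 2 \<le> D" unfolding D_def using assms(1) by (intro power_increasing) auto
  then have D16: "16 \<le> D" by simp
  have "2 ^ 1 \<le> (2::nat) ^ (6 * b)" using assms(1) by (intro power_increasing) auto
  then have "D * 2 \<le> D * 2 ^ (6 * b)" by (intro mult_le_mono2) simp
  then have "2 * D \<le> p" using pD by linarith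
  then have Dp: "D < p" using D16 by linarith
  have pos: "0 < p - 1 - \<delta>" if "\<delta> < D" for \<delta> using that Dp \<open>2 * D \<le> p\<close> by linarith
  have d0: "0 < d"
    using assms(3) pos fin by (auto simp: d_def G_def prod_pos)
  have "j dvd d" if j: "j \<in> {p - D..p - D + (D - 1)}" for j
  proof -
    define \<delta> where "\<delta> = p - 1 - j"
    have \<delta>: "\<delta> < D" "j = p - 1 - \<delta>" using j Dp D16 by (auto simp: \<delta>_def)
    show ?thesis
    proof (cases "j dvd N")
      case True then show ?thesis by (simp add: d_def)
    next
      case False
      then have "\<delta> \<in> G" using \<delta> by (simp add: G_def)
      then have "j dvd (\<Prod>\<delta>\<in>G. p - 1 - \<delta>)" unfolding \<delta>(2) using fin by (intro dvd_prodI)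
      then show ?thesis by (simp add: d_def)
    qed
  qed
  then have "(p - D) * ((p - D + (D - 1)) choose (p - D)) dvd d"
    using Dp by (intro binomial_dvd_common_multiple) auto
  then have le: "(p - D) * ((p - D + (D - 1)) choose (p - D)) \<le> d" using d0 by (rule dvd_imp_le)
  have e: "p - D + (D - 1) = p - 1" using Dp D16 by simp
  \<comment> \<open>The lower bound \<open>(n / k) ^ k\<close> for \<open>n choose k\<close> is
    strong only for the smaller of the two complementary values of \<open>k\<close>.\<close>
  have "(p - 1) choose (p - D) = (p - 1) choose (D - 1)"
    using binomial_symmetric[of "D - 1" "p - 1"] Dp D16 by simp
  with le have "(p - D) * ((p - 1) choose (D - 1)) \<le> d" unfolding e by simp
  moreover have "1 * ((p - 1) choose (D - 1)) \<le> (p - D) * ((p - 1) choose (D - 1))"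
    using Dp by (intro mult_le_mono1) linarith
  ultimately have "(p - 1) choose (D - 1) \<le> d" by linarith
  also have "d \<le> 2 ^ (b * n * n) * p ^ card G"
  proof -
    have "(\<Prod>\<delta>\<in>G. p - 1 - \<delta>) \<le> (\<Prod>\<delta>\<in>G. p)" by (intro prod_mono) auto
    then show ?thesis unfolding d_def using assms(4) by (intro mult_le_mono) simp_all
  qed
  also have "\<dots> = 2 ^ (b * n * n + 8 * b * card G)"
    by (simp add: p_def power_add power_mult)
  finally have upper: "real ((p - 1) choose (D - 1)) \<le> 2 ^ (b * n * n + 8 * b * card G)"
    by (metis of_nat_le_iff of_nat_numeral of_nat_power)
  \<comment> \<open>Here \<open>p / D = 2 ^ (6 * b)\<close>, and lowering numerator and denominator
    of a fraction above 1 by one does not decrease it.\<close>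
  have "2 ^ (6 * b) \<le> real (p - 1) / real (D - 1)"
  proof -
    have "2 ^ (6 * b) * (D - 1) \<le> p - 1"
    proof -
      have "2 ^ (6 * b) * (D - 1) = p - 2 ^ (6 * b)"
        unfolding pD by (subst mult.commute, subst diff_mult_distrib) simp
      moreover have "1 \<le> (2::nat) ^ (6 * b)" by simp
      ultimately show ?thesis by linarith
    qed
    then have "real (2 ^ (6 * b) * (D - 1)) \<le> real (p - 1)" by (simp only: of_nat_le_iff)
    then show ?thesis using D16 by (simp add: pos_le_divide_eq)
  qed
  then have "(2 ^ (6 * b)) ^ (D - 1) \<le> (real (p - 1) / real (D - 1)) ^ (D - 1)"
    by (intro power_mono) auto
  also have "\<dots> \<le> real ((p - 1) choose (D - 1))"
    using Dp by (intro binomial_ge_n_over_k_pow_k) simp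
  finally have "(2 ^ (6 * b)) ^ (D - 1) \<le> (2::real) ^ (b * n * n + 8 * b * card G)"
    using upper by (rule order_trans)
  then have "(2::real) ^ (6 * b * (D - 1)) \<le> 2 ^ (b * n * n + 8 * b * card G)"
    by (simp only: power_mult)
  then have "6 * b * (D - 1) \<le> b * n * n + 8 * b * card G"
    by (rule power_le_imp_le_exp[rotated]) simp
  then have "b * (6 * (D - 1)) \<le> b * (n * n + 8 * card G)" by (simp add: algebra_simps)
  then have "6 * (D - 1) \<le> n * n + 8 * card G" using assms(1) by simp
  moreover have "n * n < D"
  proof -
    have "n * n < 2 ^ b * 2 ^ b" using assms(2) by (intro mult_strict_mono) auto
    then show ?thesis unfolding four by (simp add: mult_2 power_add)
  qed
  ultimately have "D \<le> 2 * card G" using D16 by linarith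
  then show ?thesis by (simp add: D_def G_def p_def)
qed

section \<open>Distribution of the drawn number\<close>

lemma measurable_draw: "(\<lambda>\<omega>. draw k \<omega> acc) \<in> coin_space \<rightarrow>\<^sub>M count_space UNIV"
proof (induction k arbitrary: acc)
  case (Suc k)
  note [measurable] = Suc
  have [measurable]: "shd \<in> coin_space \<rightarrow>\<^sub>M count_space UNIV" "stl \<in> coin_space \<rightarrow>\<^sub>M coin_space"
    unfolding coin_space_def using measurable_shd[of "measure_pmf (bernoulli_pmf (1/2))"]
    by (simp_all add: measurable_stl)
  have "(\<lambda>\<omega>. draw (Suc k) \<omega> acc) =
      (\<lambda>\<omega>. if shd \<omega> then draw k (stl \<omega>) (2 * acc + 1) else draw k (stl \<omega>) (2 * acc))"
    by (auto simp: fun_eq_iff)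
  then show ?case by simp
qed simp

text \<open>\<open>draw k \<omega> acc\<close> is uniform on the \<open>2 ^ k\<close> numbers that
  continue the binary digits of \<open>acc\<close>. The first coin selects a half of this interval,
  and integrating it out averages two instances of the induction hypothesis.\<close>

lemma measure_draw:
  "measure coin_space {\<omega> \<in> space coin_space. draw k \<omega> acc \<in> A} =
     card (A \<inter> {acc * 2 ^ k..<(acc + 1) * 2 ^ k}) / 2 ^ k"
proof (induction k arbitrary: acc)
  case 0
  interpret prob_space coin_space
    unfolding coin_space_def by (intro prob_space.prob_space_stream_space prob_space_measure_pmf)
  show ?case by (cases "acc \<in> A") (simp_all add: prob_space)
next
  case (Suc k)
  note B = prob_space_measure_pmf[of "bernoulli_pmf (1/2)"]
  interpret prob_space coin_space
    unfolding coin_space_def by (rule prob_space.prob_space_stream_space[OF B])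
  define I where "I c = real (card (A \<inter> {c * 2 ^ k..<(c + 1) * 2 ^ k}))" for c :: nat
  have IH: "measure coin_space {\<omega> \<in> space coin_space. draw k \<omega> c \<in> A} = I c / 2 ^ k" for c
    unfolding I_def by (rule Suc)
  have I0: "0 \<le> I c" for c by (simp add: I_def)
  have meas: "{\<omega> \<in> space coin_space. draw (Suc k) \<omega> acc \<in> A} \<in> sets coin_space"
    using measurable_sets[OF measurable_draw[of "Suc k" acc], of A]
    by (simp add: vimage_def Int_def conj_commute del: draw.simps)
  have "ennreal (measure coin_space {\<omega> \<in> space coin_space. draw (Suc k) \<omega> acc \<in> A}) =
      (\<integral>\<^sup>+c. measure coin_space {\<omega> \<in> space coin_space. draw (Suc k) (c ## \<omega>) acc \<in> A} \<partial>bernoulli_pmf (1/2))"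
    using prob_space.prob_stream_space[OF B, of "\<lambda>\<omega>. draw (Suc k) \<omega> acc \<in> A"] meas
    unfolding coin_space_def by blast
  also have "\<dots> = (\<integral>\<^sup>+c. ennreal (I (2 * acc + of_bool c) / 2 ^ k) \<partial>bernoulli_pmf (1/2))"
    by (simp only: draw.simps stream.sel IH)
  also have "\<dots> = ennreal (I (2 * acc + 1) / 2 ^ k) * ennreal (1/2) + ennreal (I (2 * acc) / 2 ^ k) * ennreal (1/2)"
    by (subst nn_integral_bernoulli_pmf) simp_all
  also have "\<dots> = ennreal (I (2 * acc + 1) / 2 ^ k * (1/2)) + ennreal (I (2 * acc) / 2 ^ k * (1/2))"
    using I0 by (subst (1 2) ennreal_mult) simp_all
  also have "\<dots> = ennreal (I (2 * acc + 1) / 2 ^ k * (1/2) + I (2 * acc) / 2 ^ k * (1/2))"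
    using I0 by (subst ennreal_plus) simp_all
  also have "I (2 * acc + 1) / 2 ^ k * (1/2) + I (2 * acc) / 2 ^ k * (1/2) = (I (2 * acc) + I (2 * acc + 1)) / 2 ^ Suc k"
    by (simp add: add_divide_distrib)
  finally have "measure coin_space {\<omega> \<in> space coin_space. draw (Suc k) \<omega> acc \<in> A} =
      (I (2 * acc) + I (2 * acc + 1)) / 2 ^ Suc k"
    using I0 by (subst (asm) ennreal_inj) simp_all
  moreover have "I (2 * acc) + I (2 * acc + 1) = card (A \<inter> {acc * 2 ^ Suc k..<(acc + 1) * 2 ^ Suc k})"
  proof -
    have "{acc * 2 ^ Suc k..<(acc + 1) * 2 ^ Suc k} =
        {2 * acc * 2 ^ k..<(2 * acc + 1) * 2 ^ k} \<union> {(2 * acc + 1) * 2 ^ k..<(2 * acc + 1 + 1) * 2 ^ k}"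
    proof -
      have e: "acc * 2 ^ Suc k = 2 * acc * 2 ^ k" "(acc + 1) * 2 ^ Suc k = (2 * acc + 1 + 1) * 2 ^ k"
        by (simp_all add: algebra_simps)
      show ?thesis unfolding e by (rule ivl_disj_un_two(3)[symmetric]) simp_all
    qed
    then have "A \<inter> {acc * 2 ^ Suc k..<(acc + 1) * 2 ^ Suc k} =
        (A \<inter> {2 * acc * 2 ^ k..<(2 * acc + 1) * 2 ^ k}) \<union>
        (A \<inter> {(2 * acc + 1) * 2 ^ k..<(2 * acc + 1 + 1) * 2 ^ k})"
      by (simp only: Int_Un_distrib)
    moreover have "(A \<inter> {2 * acc * 2 ^ k..<(2 * acc + 1) * 2 ^ k}) \<inter>
        (A \<inter> {(2 * acc + 1) * 2 ^ k..<(2 * acc + 1 + 1) * 2 ^ k}) = {}"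
      by (auto simp only: Int_iff atLeastLessThan_iff empty_iff)
    ultimately have "card (A \<inter> {acc * 2 ^ Suc k..<(acc + 1) * 2 ^ Suc k}) =
        card (A \<inter> {2 * acc * 2 ^ k..<(2 * acc + 1) * 2 ^ k}) +
        card (A \<inter> {(2 * acc + 1) * 2 ^ k..<(2 * acc + 1 + 1) * 2 ^ k})"
      by (metis card_Un_disjoint finite_Int finite_atLeastLessThan)
    then show ?thesis
      unfolding I_def by (simp only: of_nat_add)
  qed
  ultimately show ?case by (simp only:)
qed

section \<open>Positivity, support and size of the vectors under sweeps\<close>

lemma relax_ge:
  assumes "\<And>u. 0 \<le> y u"
  shows "y u \<le> relax nbs v y u"
  using assms by (auto simp: relax_def intro!: sum_list_nonneg)

lemma fold_relax_ge:
  assumes "\<And>u. 0 \<le> y u"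
  shows "y u \<le> fold (relax nbs) vs y u"
  using assms
proof (induction vs arbitrary: y)
  case (Cons v vs)
  have "0 \<le> relax nbs v y u" for u
  proof -
    have "y u \<le> relax nbs v y u" using Cons.prems by (rule relax_ge)
    then show ?thesis using Cons.prems[of u] by linarith
  qed
  then have "relax nbs v y u \<le> fold (relax nbs) vs (relax nbs v y) u" by (rule Cons.IH)
  moreover have "y u \<le> relax nbs v y u" using Cons.prems by (rule relax_ge)
  ultimately show ?case by simp
qed simp

lemma member_le_sum_list_map:
  fixes y :: "nat \<Rightarrow> int"
  assumes "\<And>u. 0 \<le> y u"
  shows "u \<in> set xs \<Longrightarrow> y u \<le> (\<Sum>u\<leftarrow>xs. y u)"
proof (induction xs)
  case (Cons x xs)
  have "0 \<le> (\<Sum>u\<leftarrow>xs. y u)" using assms by (intro sum_list_nonneg) auto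
  then show ?case using Cons assms[of x] by auto
qed simp

text \<open>The order of the vertices is irrelevant: entries of a non-negative vector never shrink,
  so \<open>u\<close> is still positive when the turn of \<open>v\<close> comes, and
  \<open>v\<close> stays positive afterwards.\<close>

lemma fold_relax_edge:
  assumes "\<And>u. 0 \<le> y u" "0 < y u" "u \<in> set (nbs v)" "v \<in> set vs"
  shows "0 < fold (relax nbs) vs y v"
  using assms
proof (induction vs arbitrary: y)
  case (Cons w vs)
  have nonneg: "0 \<le> relax nbs w y u" for u
  proof -
    have "y u \<le> relax nbs w y u" using Cons.prems(1) by (rule relax_ge)
    then show ?thesis using Cons.prems(1)[of u] by linarith
  qed
  have "y u \<le> relax nbs w y u" using Cons.prems(1) by (rule relax_ge)
  with Cons.prems(2) have pos: "0 < relax nbs w y u" by linarith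
  show ?case
  proof (cases "w = v")
    case True
    have "y u \<le> (\<Sum>u\<leftarrow>nbs v. y u)"
      using Cons.prems(1,3) by (rule member_le_sum_list_map)
    with Cons.prems(2) have "0 < (\<Sum>u\<leftarrow>nbs v. y u)" by linarith
    then have "0 < relax nbs v y v" using Cons.prems(1)[of v] by (simp add: relax_def)
    then show ?thesis using fold_relax_ge[where u = v and nbs = nbs and vs = vs and y = "relax nbs w y", OF nonneg] True by simp
  next
    case False
    then have "v \<in> set vs" using Cons.prems(4) by simp
    with nonneg pos Cons.prems(3) have "0 < fold (relax nbs) vs (relax nbs w y) v" by (rule Cons.IH)
    then show ?thesis by simp
  qed
qed simp

text \<open>Meant for the set of vertices reachable from the source, which is closed under
  edges.\<close>

lemma fold_relax_support:
  assumes "\<And>u v. u \<in> R \<Longrightarrow> v \<in> set vs \<Longrightarrow> u \<in> set (nbs v) \<Longrightarrow> v \<in> R" "\<And>u. u \<notin> R \<Longrightarrow> y u = 0"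
  shows "u \<notin> R \<Longrightarrow> fold (relax nbs) vs y u = 0"
  using assms
proof (induction vs arbitrary: y)
  case (Cons v vs)
  have "relax nbs v y u = 0" if "u \<notin> R" for u
  proof -
    have "(\<Sum>w\<leftarrow>nbs v. y w) = 0" if "v \<notin> R"
    proof -
      have "y w = 0" if "w \<in> set (nbs v)" for w
        using Cons.prems(2)[of w v] Cons.prems(3)[of w] that \<open>v \<notin> R\<close> by auto
      then show ?thesis by (simp cong: map_cong)
    qed
    then show ?thesis using that Cons.prems(3) by (cases "u = v") (simp_all add: relax_def)
  qed
  then show ?case using Cons by simp
qed simp

text \<open>An update sums \<open>1 + length (nbs v) \<le> n\<close> entries, the degree being less
  than \<open>n\<close>, so each visited vertex costs at most a factor \<open>n\<close>.\<close>

lemma fold_relax_bound: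
  assumes "\<And>v. v < n \<Longrightarrow> set (nbs v) \<subseteq> {..<n}" "\<And>v. v < n \<Longrightarrow> length (nbs v) < n" "set vs \<subseteq> {..<n}"
    "\<And>u. u < n \<Longrightarrow> 0 \<le> y u \<and> y u \<le> B"
  shows "u < n \<Longrightarrow> 0 \<le> fold (relax nbs) vs y u \<and> fold (relax nbs) vs y u \<le> int n ^ length vs * B"
  using assms(3,4)
proof (induction vs arbitrary: y B)
  case (Cons v vs)
  have v: "v < n" using Cons.prems by simp
  have "0 \<le> relax nbs v y u \<and> relax nbs v y u \<le> int n * B" if u: "u < n" for u
  proof -
    have B: "0 \<le> B" using Cons.prems(3)[OF u] by linarith
    have "1 * B \<le> int n * B" using u B by (intro mult_right_mono) auto
    then have uB: "y u \<le> int n * B" using Cons.prems(3)[OF u] by linarith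
    have mem: "0 \<le> y w \<and> y w \<le> B" if "w \<in> set (nbs v)" for w
      using Cons.prems(3)[of w] assms(1)[OF v] that by auto
    have s0: "0 \<le> (\<Sum>w\<leftarrow>nbs v. y w)" using mem by (intro sum_list_nonneg) auto
    have "(\<Sum>w\<leftarrow>nbs v. y w) \<le> (\<Sum>w\<leftarrow>nbs v. B)" using mem by (intro sum_list_mono) auto
    also have "\<dots> = int (length (nbs v)) * B" by (simp add: sum_list_triv)
    also have "y v + \<dots> \<le> B + \<dots>" using Cons.prems(3)[OF v] by simp
    finally have "y v + (\<Sum>w\<leftarrow>nbs v. y w) \<le> (1 + int (length (nbs v))) * B"
      by (simp add: algebra_simps)
    also have "\<dots> \<le> int n * B" using assms(2)[OF v] B by (intro mult_right_mono) auto
    finally show ?thesis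
      using uB s0 Cons.prems(3)[OF u] Cons.prems(3)[OF v] by (auto simp: relax_def)
  qed
  from Cons.IH[OF Cons.prems(1) _ this] Cons.prems(2) show ?case by (simp add: algebra_simps)
qed simp

section \<open>The main theorem\<close>

lemma run_halted:
  assumes "current M (run M I \<tau> \<omega> j) = Halt" "j \<le> k"
  shows "run M I \<tau> \<omega> k = run M I \<tau> \<omega> j"
proof -
  have "((\<lambda>c. exec I (current M c) c) ^^ i) (run M I \<tau> \<omega> j) = run M I \<tau> \<omega> j" for i
    by (induction i) (simp_all add: assms(1))
  moreover have "run M I \<tau> \<omega> k = ((\<lambda>c. exec I (current M c) c) ^^ (k - j)) (run M I \<tau> \<omega> j)"
    unfolding run_def using assms(2) by (simp flip: funpow_add[THEN fun_cong, unfolded comp_def])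
  ultimately show ?thesis by simp
qed

text \<open>Halted configurations are fixed points, so a run has only one of them. This turns the
  existential \<open>answers\<close> into an equivalence, as needed to compute the probability of
  the event.\<close>

lemma answers_iff:
  assumes "current M (run M I \<tau> \<omega> j) = Halt" "out (run M I \<tau> \<omega> j) = [a]"
  shows "answers M I \<tau> \<omega> b \<longleftrightarrow> b = a"
proof -
  have "run M I \<tau> \<omega> k = run M I \<tau> \<omega> j" if "current M (run M I \<tau> \<omega> k) = Halt" for k
    using run_halted[OF assms(1), of k] run_halted[OF that, of j] by (cases "j \<le> k") auto
  then have "halts_with M I \<tau> \<omega> c \<longleftrightarrow> c = run M I \<tau> \<omega> j" for c
    using assms(1) unfolding halts_with_def by metis
  then show ?thesis using assms(2) unfolding answers_def by auto
qed

lemma decide_regs: "com_regs decide \<subseteq> {3..<22}"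
  by (simp add: decide_def read_input_def choose_modulus_def draw_bit_def choose_shift_def scan_def probe_def
      perturb_def pass_def round_up_def round_down_def update_def gather_def load_def save_def addmod_def submod_def)

lemma relax_steps_ge:
  assumes "\<And>u. 0 \<le> y u"
  shows "y v \<le> (fold (relax nbs) vs ^^ k) y v"
proof -
  have "\<forall>v. y v \<le> (fold (relax nbs) vs ^^ k) y v"
  proof (induction k)
    case (Suc k)
    let ?y = "(fold (relax nbs) vs ^^ k) y"
    have "0 \<le> ?y v" for v using Suc[THEN spec, of v] assms[of v] by linarith
    then have "?y v \<le> fold (relax nbs) vs ?y v" for v by (rule fold_relax_ge)
    then show ?case using Suc by (auto intro: order_trans)
  qed simp
  then show ?thesis by blast
qed

lemma relax_steps_bound:
  assumes "\<And>v. v < n \<Longrightarrow> set (nbs v) \<subseteq> {..<n}" "\<And>v. v < n \<Longrightarrow> length (nbs v) < n"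
    "\<And>u. u < n \<Longrightarrow> 0 \<le> y u \<and> y u \<le> 1" "v < n"
  shows "(fold (relax nbs) [0..<n] ^^ k) y v \<le> int n ^ (k * n)"
proof -
  have "\<forall>v<n. 0 \<le> (fold (relax nbs) [0..<n] ^^ k) y v \<and> (fold (relax nbs) [0..<n] ^^ k) y v \<le> int n ^ (k * n)"
  proof (induction k)
    case 0 then show ?case using assms(3) by simp
  next
    case (Suc k)
    let ?y = "(fold (relax nbs) [0..<n] ^^ k) y"
    have "0 \<le> fold (relax nbs) [0..<n] ?y v \<and> fold (relax nbs) [0..<n] ?y v \<le> int n ^ length [0..<n] * int n ^ (k * n)"
      if "v < n" for v
      by (rule fold_relax_bound[OF assms(1,2) _ _ that]) (use Suc in auto)
    then show ?case by (simp add: power_add)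
  qed
  then show ?thesis using assms(4) by blast
qed

text \<open>A simple path has fewer than \<open>n\<close> arcs; each sweep makes the next vertex on
  it positive, and the sweeps left over preserve this. Conversely, the support never leaves the set
  of reachable vertices.\<close>

lemma relax_steps_pos_iff:
  fixes n :: nat and G :: "nat pair_pre_digraph"
  assumes "pair_fin_digraph G" and n: "pverts G = {0..<n}" "s \<in> pverts G"
    and nbs: "\<And>v. v < n \<Longrightarrow> set (nbs v) = {u. (u, v) \<in> parcs G}"
    and t: "t < n"
  shows "0 < (fold (relax nbs) [0..<n] ^^ n) (\<lambda>u. of_bool (u = s)) t \<longleftrightarrow> reachable (with_proj G) s t"
proof
  interpret pair_fin_digraph G by fact
  let ?F = "fold (relax nbs) [0..<n]"
  let ?e = "\<lambda>u. of_bool (u = s) :: int"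
  have e0: "0 \<le> ?e u" for u by simp
  assume "reachable (with_proj G) s t"
  then obtain p where p: "apath s p t" using reachable_apath by blast
  have len: "length p < n"
  proof -
    have "Suc (length p) = card (set (pawalk_verts s p))"
      using p length_awalk_verts[of s p] by (simp add: apath_def distinct_card)
    also have "\<dots> \<le> card (pverts G)"
    proof (rule card_mono)
      show "set (pawalk_verts s p) \<subseteq> pverts G"
        using p unfolding apath_def by (elim conjE awalkE')
    qed (simp add: n)
    finally show ?thesis using n by simp
  qed
  have "0 < (?F ^^ length p) y v" if "awalk u p v" "\<And>u. 0 \<le> y u" "0 < y u" for y u v p
    using that
  proof (induction p arbitrary: u y)
    case Nil
    then show ?case by (simp add: awalk_Nil_iff)
  next
    case (Cons a p)
    have a: "a \<in> parcs G" "u = fst a" "awalk (snd a) p v" using Cons.prems(1) by (auto simp: awalk_Cons_iff)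
    have sa: "snd a < n" using a(1) arc_snd_in_verts n by fastforce
    have "0 \<le> ?F y w" for w
    proof -
      have "y w \<le> ?F y w" using Cons.prems(2) by (rule fold_relax_ge)
      then show ?thesis using Cons.prems(2)[of w] by linarith
    qed
    moreover have "0 < ?F y (snd a)"
      using Cons.prems(2,3) by (rule fold_relax_edge) (use a sa nbs in auto)
    ultimately have "0 < (?F ^^ length p) (?F y) v" by (rule Cons.IH[OF a(3)])
    then show ?case by (simp add: funpow_swap1)
  qed
  from this[of s p t ?e] have pos: "0 < (?F ^^ length p) ?e t" using p by (simp add: apath_def)
  have "0 \<le> (?F ^^ length p) ?e u" for u
  proof -
    have "?e u \<le> (?F ^^ length p) ?e u" using e0 by (rule relax_steps_ge)
    then show ?thesis using e0[of u] by linarith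
  qed
  then have "(?F ^^ length p) ?e t \<le> (?F ^^ (n - length p)) ((?F ^^ length p) ?e) t"
    by (rule relax_steps_ge)
  also have "\<dots> = (?F ^^ n) ?e t"
    using funpow_add[of "n - length p" "length p" ?F] len by simp
  finally show "0 < (?F ^^ n) ?e t" using pos by linarith
next
  interpret pair_fin_digraph G by fact
  let ?F = "fold (relax nbs) [0..<n]"
  let ?e = "\<lambda>u. of_bool (u = s) :: int"
  let ?R = "{u. reachable (with_proj G) s u}"
  assume pos: "0 < (?F ^^ n) ?e t"
  have zero: "\<forall>u. u \<notin> ?R \<longrightarrow> (?F ^^ k) ?e u = 0" for k
  proof (induction k)
    case 0
    have "s \<in> ?R" using n(2) by simp
    then show ?case by auto
  next
    case (Suc k)
    have "?F ((?F ^^ k) ?e) u = 0" if "u \<notin> ?R" for u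
    proof (rule fold_relax_support[where R = ?R])
      fix u v assume "u \<in> ?R" "v \<in> set [0..<n]" "u \<in> set (nbs v)"
      then have "reachable (with_proj G) s u" "(u, v) \<in> parcs G" using nbs by auto
      then show "v \<in> ?R" using reachable_adj_trans by simp
    qed (use Suc that in auto)
    then show ?case by simp
  qed
  show "reachable (with_proj G) s t"
  proof (rule ccontr)
    assume "\<not> reachable (with_proj G) s t"
    then have "(?F ^^ n) ?e t = 0" using zero[of n] by blast
    with pos show False by simp
  qed
qed

lemma representsD:
  assumes "represents I G s t" "pverts G = {0..<n}"
  shows "vertices I = n" "source I = s" "target I = t"
    "v < n \<Longrightarrow> distinct (in_nbs I v) \<and> set (in_nbs I v) = {u. (u, v) \<in> parcs G}"
proof -
  note r = assms(1)[unfolded represents_def]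
  have "pverts G = {0..<vertices I}" using r by blast
  then have "card {0..<vertices I} = card {0..<n}" using assms(2) by (simp only:)
  then show "vertices I = n" by simp
  show "source I = s" "target I = t" using r by blast+
  show "distinct (in_nbs I v) \<and> set (in_nbs I v) = {u. (u, v) \<in> parcs G}" if "v < n"
  proof -
    have "v \<in> pverts G" using that unfolding assms(2) by simp
    then show ?thesis using r by blast
  qed
qed

text \<open>Without loops a single vertex has no arc, so \<open>n \<le> card (parcs G)\<close>
  forces two vertices. The resource bounds rely on this, since it makes the logarithm of
  \<open>n\<close> at least 1.\<close>

lemma network_of_graph:
  assumes "pair_digraph G" "pverts G = {0..<n}" "represents I G s t" "n \<le> card (parcs G)" "s \<in> pverts G"
  shows "2 \<le> n" "network I n (8 * length (bits_of_number n))"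
    "(\<Sum>v<n. length (in_nbs I v)) = card (parcs G)"
proof -
  interpret pair_digraph G by fact
  note rep = representsD[OF assms(3,2)]
  have nbs: "distinct (in_nbs I v) \<and> set (in_nbs I v) = {u. (u, v) \<in> parcs G}" if "v < n" for v
    using rep(4)[OF that] by simp
  have less: "u < n" "v < n" "u \<noteq> v" if "(u, v) \<in> parcs G" for u v
    using arc_fst_in_verts[OF that] arc_snd_in_verts[OF that] pair_no_loops[OF that] assms(2) by auto
  have no_loop: "(v, v) \<notin> parcs G" for v using less(3)[of v v] by blast
  show "2 \<le> n"
  proof (rule ccontr)
    assume "\<not> 2 \<le> n"
    moreover have "0 < n" using assms(2,5) by auto
    ultimately have "n = 1" by linarith
    have "parcs G = {}"
    proof (rule equals0I)
      fix e assume "e \<in> parcs G"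
      then obtain u v where "(u, v) \<in> parcs G" by (cases e) auto
      from less[OF this] \<open>n = 1\<close> show False by simp
    qed
    then show False using assms(4) \<open>n = 1\<close> by simp
  qed
  have len: "length (in_nbs I v) < n" if "v < n" for v
  proof -
    have "distinct (in_nbs I v)" using nbs[OF that] by simp
    then have "length (in_nbs I v) = card (set (in_nbs I v))" by (rule distinct_card[symmetric])
    also have "\<dots> \<le> card ({..<n} - {v})"
    proof (rule card_mono)
      show "set (in_nbs I v) \<subseteq> {..<n} - {v}"
      proof
        fix u assume "u \<in> set (in_nbs I v)"
        then have "(u, v) \<in> parcs G" using nbs[OF that] by simp
        from less[OF this] show "u \<in> {..<n} - {v}" by simp
      qed
    qed simp
    also have "\<dots> < n" using that by simp
    finally show ?thesis .
  qed
  show "network I n (8 * length (bits_of_number n))"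
  proof
    define b where "b = length (bits_of_number n)"
    have nb: "n < 2 ^ b" using length_bits_of_number_le[of n b] by (simp add: b_def)
    have b: "1 \<le> b" using \<open>2 \<le> n\<close> nb by (cases b) simp_all
    show "0 < n" using \<open>2 \<le> n\<close> by simp
    show "0 < 8 * length (bits_of_number n)" using b unfolding b_def by linarith
    \<comment> \<open>The chain bounds \<open>8 * b + 1\<close> by \<open>2 ^ (7 * b)\<close>, which
      leaves a factor \<open>2 ^ b > n\<close> for the vertices.\<close>
    have "8 * b + 1 \<le> 8 * (b + 1)" by simp
    also have "\<dots> \<le> 8 * 2 ^ b"
    proof (rule mult_le_mono2)
      have "b < 2 ^ b" by (rule less_exp)
      then show "b + 1 \<le> 2 ^ b" by linarith
    qed
    also have "\<dots> = 2 ^ (3 + b)" by (simp add: power_add)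
    also have "\<dots> \<le> 2 ^ (7 * b)" using b by (intro power_increasing) auto
    finally have "n * (8 * b + 1) \<le> n * 2 ^ (7 * b)" by (rule mult_le_mono2)
    also have "\<dots> < 2 ^ b * 2 ^ (7 * b)" using nb by simp
    also have "\<dots> = 2 ^ (8 * b)" by (simp flip: power_add)
    finally show "n * (8 * length (bits_of_number n) + 1) < 2 ^ (8 * length (bits_of_number n))"
      by (simp add: b_def)
    show "u < n" if "v < n" "u \<in> set (in_nbs I v)" for u v
      using that(2) nbs[OF that(1)] less(1)[of u v] by simp
    show "v \<notin> set (in_nbs I v)" if "v < n" for v using nbs[OF that] no_loop by simp
    show "vertices I = n" by (rule rep(1))
    show "length (in_nbs I v) < n" if "v < n" for v using that by (rule len)
  qed
  have "(parcs G)\<inverse> = (SIGMA v:{..<n}. set (in_nbs I v))"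
  proof (intro subset_antisym subrelI)
    fix v u assume "(v, u) \<in> (parcs G)\<inverse>"
    then have uv: "(u, v) \<in> parcs G" by simp
    show "(v, u) \<in> (SIGMA v:{..<n}. set (in_nbs I v))"
      using less(2)[OF uv] nbs[OF less(2)[OF uv]] uv by simp
  next
    fix v u assume "(v, u) \<in> (SIGMA v:{..<n}. set (in_nbs I v))"
    then have "v < n" "u \<in> set (in_nbs I v)" by simp_all
    then show "(v, u) \<in> (parcs G)\<inverse>" using nbs[of v] by simp
  qed
  then have "card (parcs G) = card (SIGMA v:{..<n}. set (in_nbs I v))"
    using card_inverse[of "parcs G"] by simp
  also have "\<dots> = (\<Sum>v<n. card (set (in_nbs I v)))" by simp
  also have "\<dots> = (\<Sum>v<n. length (in_nbs I v))"
  proof (rule sum.cong[OF refl])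
    fix v assume "v \<in> {..<n}"
    then have "distinct (in_nbs I v)" using nbs[of v] by simp
    then show "card (set (in_nbs I v)) = length (in_nbs I v)" by (rule distinct_card)
  qed
  finally show "(\<Sum>v<n. length (in_nbs I v)) = card (parcs G)" by simp
qed

text \<open>All summands are absorbed into multiples of \<open>K = n * m * L\<close>, with
  \<open>34 + 268 + 100 = 402\<close>; \<open>n \<le> m\<close> covers the quadratic cost of the
  shift search. In \<open>L ^ 2\<close> one factor stands for the bits of a register and one for the
  cells of a sweep.\<close>

lemma steps_bound:
  fixes n m L b :: nat
  assumes "2 \<le> n" "n \<le> m" "L = 8 * b" "1 \<le> b"
  shows "(3 * L + 5) * ((n + 1) * (n * (8 * L + 15) + 7) + 4 * n * ((m + 4 * n) * (8 * L + 25) + 7) +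
      6 * (8 * L + 25) + 15 * b + 25 + 1) \<le> 8000 * (n * m * L ^ 2)"
proof -
  define K where "K = n * m * L"
  have L8: "8 \<le> L" "b \<le> L" using assms by simp_all
  have pos: "0 < n" "0 < m" "0 < L" using assms L8 by linarith+
  then have nm: "1 \<le> n * m" by (simp add: Suc_le_eq)
  have LK: "L \<le> K" using mult_le_mono1[OF nm, of L] by (simp add: K_def)
  have nL: "1 \<le> n * L" using pos by (simp add: Suc_le_eq)
  have "n * n * L \<le> n * m * L" using assms(2) by (intro mult_le_mono) auto
  then have nnL: "n * (n * L) \<le> K" by (simp add: K_def mult.assoc)
  have mL: "1 \<le> m * L" using pos by (simp add: Suc_le_eq)
  have "n * (8 * L + 15) + 7 \<le> n * (10 * L) + 7 * (n * L)"
    using L8 nL by (intro add_mono mult_le_mono2) simp_all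
  also have "\<dots> = 17 * (n * L)" by simp
  finally have "n * (8 * L + 15) + 7 \<le> 17 * (n * L)" .
  then have "(n + 1) * (n * (8 * L + 15) + 7) \<le> (2 * n) * (17 * (n * L))"
    using assms(1) by (intro mult_le_mono) linarith+
  also have "\<dots> = 34 * (n * (n * L))" by simp
  finally have 1: "(n + 1) * (n * (8 * L + 15) + 7) \<le> 34 * K" using nnL by linarith
  have "(m + 4 * n) * (8 * L + 25) + 7 \<le> (5 * m) * (12 * L) + 7 * (m * L)"
    using assms(2) L8 mL by (intro add_mono mult_le_mono) simp_all
  also have "\<dots> = 67 * (m * L)" by simp
  finally have "(m + 4 * n) * (8 * L + 25) + 7 \<le> 67 * (m * L)" .
  then have "4 * n * ((m + 4 * n) * (8 * L + 25) + 7) \<le> 4 * n * (67 * (m * L))"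
    by (rule mult_le_mono2)
  also have "\<dots> = 268 * K" by (simp add: K_def)
  finally have 2: "4 * n * ((m + 4 * n) * (8 * L + 25) + 7) \<le> 268 * K" .
  have "6 * (8 * L + 25) + 15 * b + 25 + 1 \<le> 48 * L + 15 * L + 22 * 8" using L8(2) by simp
  also have "\<dots> \<le> 48 * L + 15 * L + 22 * L" using L8(1) by (intro add_mono mult_le_mono2 order_refl)
  finally have "6 * (8 * L + 25) + 15 * b + 25 + 1 \<le> 100 * L" by simp
  then have "6 * (8 * L + 25) + 15 * b + 25 + 1 \<le> 100 * K" using LK by linarith
  with 1 2 have "(n + 1) * (n * (8 * L + 15) + 7) + 4 * n * ((m + 4 * n) * (8 * L + 25) + 7) +
      6 * (8 * L + 25) + 15 * b + 25 + 1 \<le> 402 * K" by linarith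
  then have "(3 * L + 5) * ((n + 1) * (n * (8 * L + 15) + 7) + 4 * n * ((m + 4 * n) * (8 * L + 25) + 7) +
      6 * (8 * L + 25) + 15 * b + 25 + 1) \<le> (4 * L) * (402 * K)"
    using L8 by (intro mult_le_mono) simp_all
  also have "\<dots> = 1608 * (n * m * L ^ 2)" by (simp add: K_def power2_eq_square)
  finally show ?thesis by linarith
qed

text \<open>The bit length exceeds the logarithm by at most 1, hence is at most twice the logarithm,
  which turns 8 into 16.\<close>

lemma word_length_le_log:
  assumes "2 \<le> n"
  shows "real (8 * length (bits_of_number n)) \<le> 16 * log 2 (real n)" "1 \<le> log 2 (real n)"
    "2 \<le> length (bits_of_number n)"
proof -
  define b where "b = length (bits_of_number n)"
  show l: "1 \<le> log 2 (real n)" using assms by (simp add: le_log_iff)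
  have b: "l < b \<longleftrightarrow> 2 ^ l \<le> n" for l
    using length_bits_of_number_le[of n l] unfolding b_def by linarith
  show "2 \<le> length (bits_of_number n)" using b[of 1] assms by (simp add: b_def)
  then have "b - 1 < b" by (simp add: b_def)
  then have "2 ^ (b - 1) \<le> n" using b[of "b - 1"] by blast
  then have "real (2 ^ (b - 1)) \<le> real n" by (simp only: of_nat_le_iff)
  then have "real (b - 1) \<le> log 2 (real n)"
    using assms by (simp add: le_log_iff powr_realpow)
  then have "real b \<le> log 2 (real n) + 1" by linarith
  then show "real (8 * length (bits_of_number n)) \<le> 16 * log 2 (real n)"
    using l by (simp add: b_def)
qed

text \<open>\<open>N\<close> is obtained before \<open>\<tau>\<close> and \<open>\<omega>\<close>:
  it depends on the graph and the two vertices, and the coins enter only through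
  \<open>\<delta>\<close>. The constant is \<open>8000 * 16 ^ 2 = 2048000\<close>, rounded up and
  shared by all three resources.\<close>

lemma decide_correct:
  fixes G :: "nat pair_pre_digraph" and n m s t :: nat and I :: st_input
  defines "M \<equiv> machine_of 22 decide" and "b \<equiv> length (bits_of_number n)"
  assumes G: "pair_digraph G" "pverts G = {0..<n}" "card (parcs G) = m" "n \<le> m" "s \<in> pverts G" "t \<in> pverts G"
    "represents I G s t"
  obtains N :: nat where "0 < N \<longleftrightarrow> reachable (with_proj G) s t" "N \<le> 2 ^ (b * n * n)"
    "\<And>\<tau> \<omega>. halts_within M I \<tau> \<omega> (2100000 * (real n * real m) * log 2 (real n) ^ 2)"
    "\<And>\<tau> \<omega>. workspace_within M I \<tau> \<omega> (2100000 * log 2 (real n))"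
    "\<And>\<tau> \<omega>. catalytic_space_within M I \<tau> \<omega> (2100000 * real n * log 2 (real n) ^ 2)"
    "\<And>\<tau> \<omega>. restores M I \<tau> \<omega>"
    "\<And>\<tau> \<omega> a. answers M I \<tau> \<omega> a \<longleftrightarrow> a = (\<not> (2 ^ (8 * b) - 1 - draw (2 * b) \<omega> 0) dvd N)"
proof -
  interpret pair_digraph G by fact
  note I = representsD(1-3)[OF G(7,2)]
  have nbs: "set (in_nbs I v) = {u. (u, v) \<in> parcs G}" if "v < n" for v
    using representsD(4)[OF G(7,2) that] by simp
  have st: "s < n" "t < n" using G(2,5,6) by auto
  have n2: "2 \<le> n" and net: "network I n (8 * b)" and edges: "(\<Sum>v<n. length (in_nbs I v)) = m"
    using network_of_graph[OF G(1,2,7) _ G(5)] G(3,4) by (simp_all add: b_def)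
  define L where "L = 8 * b"
  note log = word_length_le_log[OF n2, folded b_def, folded L_def]
  have L_pos: "0 < L" using log(3) by (simp add: L_def)
  define F where "F = (fold (relax (in_nbs I)) [0..<n] ^^ n) (\<lambda>u. of_bool (u = s)) t"
  define N where "N = nat F"
  have nbs_props: "\<And>v. v < n \<Longrightarrow> set (in_nbs I v) \<subseteq> {..<n}" "\<And>v. v < n \<Longrightarrow> length (in_nbs I v) < n"
    using network.nbs_less[OF net] network.degree_less[OF net] by blast+
  have "of_bool (t = s) \<le> F" unfolding F_def by (rule relax_steps_ge) simp
  then have F0: "0 \<le> F" by (rule order_trans[rotated]) simp
  have iff: "0 < N \<longleftrightarrow> reachable (with_proj G) s t"
    unfolding N_def F_def zero_less_nat_eq
    by (rule relax_steps_pos_iff[OF _ G(2,5) nbs st(2)]) unfold_locales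
  have "F \<le> int n ^ (n * n)"
    unfolding F_def by (rule relax_steps_bound[OF nbs_props _ st(2)]) auto
  then have "N \<le> n ^ (n * n)" unfolding N_def by (simp add: nat_le_iff)
  also have "\<dots> \<le> (2 ^ b) ^ (n * n)"
    using length_bits_of_number_le[of n b] by (intro power_mono) (simp_all add: b_def)
  also have "\<dots> = 2 ^ (b * n * n)" by (simp add: power_mult mult.assoc)
  finally have N_le: "N \<le> 2 ^ (b * n * n)" .
  define C where "C = (n + 1) * (n * (8 * L + 15) + 7) + 4 * n * ((m + 4 * n) * (8 * L + 25) + 7) +
      6 * (8 * L + 25) + 15 * b + 25"
  have run: "\<exists>j. j \<le> (3 * L + 5) * (C + 1) \<and> current M (run M I \<tau> \<omega> j) = Halt \<and>
      cat (run M I \<tau> \<omega> j) = \<tau> \<and>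
      out (run M I \<tau> \<omega> j) = [\<not> (2 ^ (8 * b) - 1 - draw (2 * b) \<omega> 0) dvd N] \<and>
      (\<forall>i. pos (run M I \<tau> \<omega> i) + length (query1 (run M I \<tau> \<omega> i)) +
        length (query2 (run M I \<tau> \<omega> i)) \<le> 3 * L + 1) \<and>
      (\<forall>i a. accesses_cell M (run M I \<tau> \<omega> i) a \<longrightarrow> a < n * L)" for \<tau> \<omega>
  proof -
    interpret network I n L \<tau> unfolding L_def by (rule net)
    define q where "q = 2 ^ L - 1 - draw (2 * b) \<omega> 0"
    have "layout.wp I n L decide (\<lambda>u. tape u = \<tau> \<and> verdict u = [\<not> int q dvd F] \<and> clock u \<le> C) (start \<tau> \<omega>)"
      using wp_decide[of \<omega>] st unfolding I F_def q_def C_def L_def b_def edges_def edges[unfolded b_def] by simp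
    then obtain u where u: "big I L (n * L) decide (start \<tau> \<omega>) u" "tape u = \<tau>"
      "verdict u = [\<not> int q dvd F]" "clock u \<le> C"
      unfolding wp_def by blast
    have dvd: "int q dvd F \<longleftrightarrow> q dvd N"
    proof -
      have "F = int N" using F0 by (simp add: N_def)
      then show ?thesis by (simp only: int_dvd_int_iff)
    qed
    have regs: "com_regs decide \<subseteq> {3..}" using decide_regs by auto
    have L: "L = 8 * length (bits_of_number (vertices I))" by (simp add: L_def b_def I)
    show ?thesis
    proof (rule machine_of_correct[OF u(1) L L_pos regs])
      show "M = machine_of 22 decide" by (simp add: M_def)
      fix j y
      assume j: "j \<le> (3 * L + 5) * (clock u + 1)" "run M I \<tau> \<omega> j = y" "current M y = Halt" "cat y = tape u"
        "out y = verdict u"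
        "\<And>i. pos (run M I \<tau> \<omega> i) + length (query1 (run M I \<tau> \<omega> i)) +
          length (query2 (run M I \<tau> \<omega> i)) \<le> 3 * L + 1"
        "\<And>i a. accesses_cell M (run M I \<tau> \<omega> i) a \<Longrightarrow> a < n * L"
      have "(3 * L + 5) * (clock u + 1) \<le> (3 * L + 5) * (C + 1)"
        using u(4) by (intro mult_le_mono2) simp
      with j(1) have jle: "j \<le> (3 * L + 5) * (C + 1)" by (rule order_trans)
      have qe: "q = 2 ^ (8 * b) - 1 - draw (2 * b) \<omega> 0" by (simp only: q_def L_def)
      have "out y = [\<not> q dvd N]" by (simp only: j(5) u(3) dvd)
      then have "out (run M I \<tau> \<omega> j) = [\<not> (2 ^ (8 * b) - 1 - draw (2 * b) \<omega> 0) dvd N]"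
        by (simp only: j(2) qe)
      moreover have "current M (run M I \<tau> \<omega> j) = Halt" "cat (run M I \<tau> \<omega> j) = \<tau>"
        by (simp_all only: j(2-4) u(2))
      ultimately show ?thesis using jle j(6,7) by blast
    qed
  qed
  have L_log: "real L \<le> 16 * log 2 (real n)" "1 \<le> log 2 (real n)" using log by simp_all
  have log2: "log 2 (real n) \<le> log 2 (real n) ^ 2" using L_log(2) by (simp add: power2_eq_square)
  have "(3 * L + 5) * (C + 1) \<le> 8000 * (n * m * L ^ 2)"
    using steps_bound[OF n2 G(4) L_def] log(3) unfolding C_def by simp
  then have "real ((3 * L + 5) * (C + 1)) \<le> real (8000 * (n * m * L ^ 2))" by (simp only: of_nat_le_iff)
  also have "\<dots> = 8000 * (real n * real m) * real L ^ 2" by simp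
  also have "\<dots> \<le> 8000 * (real n * real m) * (16 * log 2 (real n)) ^ 2"
    using L_log by (intro mult_left_mono power_mono) auto
  also have "\<dots> = 2048000 * (real n * real m * log 2 (real n) ^ 2)" by (simp add: power_mult_distrib)
  also have "\<dots> \<le> 2100000 * (real n * real m * log 2 (real n) ^ 2)" by (intro mult_right_mono) auto
  finally have time: "real ((3 * L + 5) * (C + 1)) \<le> 2100000 * (real n * real m) * log 2 (real n) ^ 2"
    by (simp only: mult.assoc)
  show thesis
  proof (rule that[OF iff N_le])
    fix \<tau> \<omega>
    obtain j where j: "j \<le> (3 * L + 5) * (C + 1)" "current M (run M I \<tau> \<omega> j) = Halt"
      "cat (run M I \<tau> \<omega> j) = \<tau>"
      "out (run M I \<tau> \<omega> j) = [\<not> (2 ^ (8 * b) - 1 - draw (2 * b) \<omega> 0) dvd N]"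
      "\<And>i. pos (run M I \<tau> \<omega> i) + length (query1 (run M I \<tau> \<omega> i)) +
        length (query2 (run M I \<tau> \<omega> i)) \<le> 3 * L + 1"
      "\<And>i a. accesses_cell M (run M I \<tau> \<omega> i) a \<Longrightarrow> a < n * L"
      using run[of \<tau> \<omega>] by blast
    have "real j \<le> real ((3 * L + 5) * (C + 1))" using j(1) by (simp only: of_nat_le_iff)
    with time have "real j \<le> 2100000 * (real n * real m) * log 2 (real n) ^ 2" by linarith
    then show "halts_within M I \<tau> \<omega> (2100000 * (real n * real m) * log 2 (real n) ^ 2)"
      unfolding halts_within_def using j(2) by blast
    have "real (pos (run M I \<tau> \<omega> i) + 1 + length (query1 (run M I \<tau> \<omega> i)) +
        length (query2 (run M I \<tau> \<omega> i))) \<le> 2100000 * log 2 (real n)" for i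
      using j(5)[of i] L_log by linarith
    then show "workspace_within M I \<tau> \<omega> (2100000 * log 2 (real n))"
      unfolding workspace_within_def Let_def by blast
    have "real (a + 1) \<le> 2100000 * real n * log 2 (real n) ^ 2" if "accesses_cell M (run M I \<tau> \<omega> i) a" for i a
    proof -
      have "a + 1 \<le> n * L" using j(6)[OF that] by simp
      then have "real (a + 1) \<le> real (n * L)" by (simp only: of_nat_le_iff)
      also have "\<dots> \<le> real n * (16 * log 2 (real n) ^ 2)"
        unfolding of_nat_mult using L_log(1) log2 by (intro mult_left_mono) linarith+
      also have "\<dots> = 16 * (real n * log 2 (real n) ^ 2)" by simp
      also have "\<dots> \<le> 2100000 * (real n * log 2 (real n) ^ 2)" by (intro mult_right_mono) auto
      finally show ?thesis by simp
    qed
    then show "catalytic_space_within M I \<tau> \<omega> (2100000 * real n * log 2 (real n) ^ 2)"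
      unfolding catalytic_space_within_def by blast
    show "restores M I \<tau> \<omega>"
      unfolding restores_def halts_with_def using j(2,3) by blast
    show "answers M I \<tau> \<omega> a \<longleftrightarrow> a = (\<not> (2 ^ (8 * b) - 1 - draw (2 * b) \<omega> 0) dvd N)" for a
      by (rule answers_iff[OF j(2,4)])
  qed
qed

theorem theorem1p2:
  shows "\<exists>(M :: machine) (c :: real) (k :: nat). catalytic_machine M \<and>
    (\<forall>(G :: nat pair_pre_digraph) (n :: nat) (m :: nat) (s :: nat) (t :: nat) (I :: st_input).
       pair_digraph G \<and> pverts G = {0..<n} \<and> card (parcs G) = m \<and> m \<ge> n \<and>
       s \<in> pverts G \<and> t \<in> pverts G \<and> represents I G s t \<longrightarrow>
       (\<forall>(\<tau> :: nat \<Rightarrow> bool) (\<omega> :: bool stream).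
          halts_within M I \<tau> \<omega> (c * (real n * real m) * (log 2 (real n)) ^ k) \<and>
          workspace_within M I \<tau> \<omega> (c * log 2 (real n)) \<and>
          catalytic_space_within M I \<tau> \<omega> (c * real n * (log 2 (real n)) ^ k) \<and>
          restores M I \<tau> \<omega> \<and>
          (answers M I \<tau> \<omega> True \<or> answers M I \<tau> \<omega> False)) \<and>
       (\<not> s \<rightarrow>\<^sup>*\<^bsub>with_proj G\<^esub> t \<longrightarrow> (\<forall>\<tau> \<omega>. answers M I \<tau> \<omega> False)) \<and>
       (s \<rightarrow>\<^sup>*\<^bsub>with_proj G\<^esub> t \<longrightarrow>
          (\<forall>\<tau>. measure coin_space {\<omega> \<in> space coin_space. answers M I \<tau> \<omega> True} \<ge> 1 / 2)))"
proof (rule exI[of _ "machine_of 22 decide"], rule exI[of _ 2100000], rule exI[of _ 2], rule conjI)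
  show "catalytic_machine (machine_of 22 decide)"
    using decide_regs by (intro catalytic_machine_of) auto
next
  let ?M = "machine_of 22 decide"
  show "\<forall>(G :: nat pair_pre_digraph) (n :: nat) (m :: nat) (s :: nat) (t :: nat) (I :: st_input).
       pair_digraph G \<and> pverts G = {0..<n} \<and> card (parcs G) = m \<and> m \<ge> n \<and>
       s \<in> pverts G \<and> t \<in> pverts G \<and> represents I G s t \<longrightarrow>
       (\<forall>(\<tau> :: nat \<Rightarrow> bool) (\<omega> :: bool stream).
          halts_within ?M I \<tau> \<omega> (2100000 * (real n * real m) * (log 2 (real n)) ^ 2) \<and>
          workspace_within ?M I \<tau> \<omega> (2100000 * log 2 (real n)) \<and>
          catalytic_space_within ?M I \<tau> \<omega> (2100000 * real n * (log 2 (real n)) ^ 2) \<and>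
          restores ?M I \<tau> \<omega> \<and>
          (answers ?M I \<tau> \<omega> True \<or> answers ?M I \<tau> \<omega> False)) \<and>
       (\<not> s \<rightarrow>\<^sup>*\<^bsub>with_proj G\<^esub> t \<longrightarrow> (\<forall>\<tau> \<omega>. answers ?M I \<tau> \<omega> False)) \<and>
       (s \<rightarrow>\<^sup>*\<^bsub>with_proj G\<^esub> t \<longrightarrow>
          (\<forall>\<tau>. measure coin_space {\<omega> \<in> space coin_space. answers ?M I \<tau> \<omega> True} \<ge> 1 / 2))"
  proof (rule allI, rule allI, rule allI, rule allI, rule allI, rule allI, rule impI)
    fix G :: "nat pair_pre_digraph" and n m s t :: nat and I :: st_input
    assume "pair_digraph G \<and> pverts G = {0..<n} \<and> card (parcs G) = m \<and> m \<ge> n \<and>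
       s \<in> pverts G \<and> t \<in> pverts G \<and> represents I G s t"
    then have G: "pair_digraph G" "pverts G = {0..<n}" "card (parcs G) = m" "n \<le> m" "s \<in> pverts G" "t \<in> pverts G"
      "represents I G s t" by blast+
    define b where "b = length (bits_of_number n)"
    show "(\<forall>(\<tau> :: nat \<Rightarrow> bool) (\<omega> :: bool stream).
          halts_within ?M I \<tau> \<omega> (2100000 * (real n * real m) * (log 2 (real n)) ^ 2) \<and>
          workspace_within ?M I \<tau> \<omega> (2100000 * log 2 (real n)) \<and>
          catalytic_space_within ?M I \<tau> \<omega> (2100000 * real n * (log 2 (real n)) ^ 2) \<and>
          restores ?M I \<tau> \<omega> \<and>
          (answers ?M I \<tau> \<omega> True \<or> answers ?M I \<tau> \<omega> False)) \<and>
       (\<not> s \<rightarrow>\<^sup>*\<^bsub>with_proj G\<^esub> t \<longrightarrow> (\<forall>\<tau> \<omega>. answers ?M I \<tau> \<omega> False)) \<and>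
       (s \<rightarrow>\<^sup>*\<^bsub>with_proj G\<^esub> t \<longrightarrow>
          (\<forall>\<tau>. measure coin_space {\<omega> \<in> space coin_space. answers ?M I \<tau> \<omega> True} \<ge> 1 / 2))"
    proof (rule decide_correct[OF G, folded b_def])
      fix N
      assume N: "0 < N \<longleftrightarrow> reachable (with_proj G) s t" "N \<le> 2 ^ (b * n * n)"
        and bounds: "\<And>\<tau> \<omega>. halts_within ?M I \<tau> \<omega> (2100000 * (real n * real m) * log 2 (real n) ^ 2)"
          "\<And>\<tau> \<omega>. workspace_within ?M I \<tau> \<omega> (2100000 * log 2 (real n))"
          "\<And>\<tau> \<omega>. catalytic_space_within ?M I \<tau> \<omega> (2100000 * real n * log 2 (real n) ^ 2)"
          "\<And>\<tau> \<omega>. restores ?M I \<tau> \<omega>"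
        and ans: "\<And>\<tau> \<omega> a. answers ?M I \<tau> \<omega> a \<longleftrightarrow> a = (\<not> (2 ^ (8 * b) - 1 - draw (2 * b) \<omega> 0) dvd N)"
      have total: "answers ?M I \<tau> \<omega> True \<or> answers ?M I \<tau> \<omega> False" for \<tau> \<omega>
        unfolding ans by blast
      have no: "answers ?M I \<tau> \<omega> False" if "\<not> reachable (with_proj G) s t" for \<tau> \<omega>
        using that N(1) unfolding ans by simp
      have yes: "1 / 2 \<le> measure coin_space {\<omega> \<in> space coin_space. answers ?M I \<tau> \<omega> True}"
        if "reachable (with_proj G) s t" for \<tau>
      proof -
        define A where "A = {\<delta>. \<delta> < 4 ^ b \<and> \<not> (2 ^ (8 * b) - 1 - \<delta>) dvd N}"
        have n2: "2 \<le> n" using network_of_graph(1)[OF G(1,2,7) _ G(5)] G(3,4) by blast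
        have four: "(4::nat) ^ b = 2 ^ (2 * b)" by (simp add: power_mult)
        have "draw (2 * b) \<omega> 0 < 4 ^ b" for \<omega> unfolding four by (rule draw_less)
        then have "answers ?M I \<tau> \<omega> True \<longleftrightarrow> draw (2 * b) \<omega> 0 \<in> A" for \<omega>
          unfolding ans A_def by blast
        \<comment> \<open>The event is the preimage of \<open>A\<close> under \<open>draw\<close>,
          which for accumulator 0 is uniform on the numbers below \<open>4 ^ b\<close>.\<close>
        then have "measure coin_space {\<omega> \<in> space coin_space. answers ?M I \<tau> \<omega> True} =
            card (A \<inter> {0 * 2 ^ (2 * b)..<(0 + 1) * 2 ^ (2 * b)}) / 2 ^ (2 * b)"
          by (simp only: measure_draw)
        also have "A \<inter> {0 * 2 ^ (2 * b)..<(0 + 1) * 2 ^ (2 * b)} = A"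
          unfolding A_def four by auto
        finally have eq: "measure coin_space {\<omega> \<in> space coin_space. answers ?M I \<tau> \<omega> True} =
            card A / 2 ^ (2 * b)" .
        have "4 ^ b \<le> 2 * card A"
          unfolding A_def
        proof (rule many_non_divisors[OF _ _ _ N(2)])
          show "2 \<le> b" using word_length_le_log(3)[OF n2] by (simp add: b_def)
          show "n < 2 ^ b" using length_bits_of_number_le[of n b] by (simp add: b_def)
          show "0 < N" using that N(1) by simp
        qed
        then have "real (2 ^ (2 * b)) \<le> real (2 * card A)" unfolding four by (simp only: of_nat_le_iff)
        then show ?thesis unfolding eq by (simp add: field_simps)
      qed
      show ?thesis using bounds total no yes by blast
    qed
  qed
qed

end
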